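(* Let $(I,\cdot)$ be a super Cartan datum with a root datum $(Y,X,\langle\,,\rangle)$ and let $\mathbf U$ be the associated quantum covering group. Let $M$ be a $\mathbf U$-module in $\mathcal O_{\mathrm{int}}$. Then $M$ is a sum of simple $\mathbf U$-submodules.
   Context: A super Cartan datum is a finite set $I=I_{\bar 0}\sqcup I_{\bar 1}$ with $I_{\bar 1}\ne\emptyset$ and a symmetric $\mathbb Z$-valued bilinear form on $\mathbb Z[I]$ such that $d_i=\frac{i\cdot i}{2}\in\mathbb Z_{>0}$; $2\frac{i\cdot j}{i\cdot i}\in-\mathbb N$ for $i\ne j$; and $2\frac{i\cdot j}{i\cdot i}\in 2\mathbb Z$ for $i\in I_{\bar 1}$, $j\in I$. The parity $p:\mathbb Z[I]\to\mathbb Z$ is the homomorphism with $p(i)=0$ on $I_{\bar 0}$, $p(i)=1$ on $I_{\bar 1}$. A root datum consists of finitely generated free abelian groups $Y,X$, a perfect pairing $\langle\,,\rangle:Y\times X\to\mathbb Z$, and embeddings $I\subset X$ ($i\mapsto i'$), $I\subset Y$ ($i\mapsto i$) with linearly independent images and $\langle i,j'\rangle=\frac{2i\cdot j}{i\cdot i}$. For $\nu=\sum\nu_ii$, $\mathrm{ht}\,\nu=\sum\nu_i$. $\mathbb Q(q)^\pi=\mathbb Q(q)[\pi]/(\pi^2-1)$; $q_i=q^{d_i}$, $\pi_i=\pi^{p(i)}$. $[n]_i=\frac{(\pi_iq_i)^n-q_i^{-n}}{\pi_iq_i-q_i^{-1}}$, $[n]_i^!=\prod_{s=1}^n[s]_i$.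 ${}'\mathbf f$ is the free associative unital $\mathbb Q(q)^\pi$-superalgebra on $\theta_i$ $(i\in I)$, with weight grading $|\theta_i|=i$ and parity $p(x)=p(|x|)$. ${}'\mathbf f\otimes{}'\mathbf f$ has multiplication $(x_1\otimes x_2)(x_1'\otimes x_2')=q^{|x_2|\cdot|x_1'|}\pi^{p(x_2)p(x_1')}x_1x_1'\otimes x_2x_2'$, and $r$ is the algebra homomorphism with $r(\theta_i)=\theta_i\otimes1+1\otimes\theta_i$. $(\cdot,\cdot)$ is the unique $\mathbb Q(q)^\pi$-valued bilinear form on ${}'\mathbf f$ with $(1,1)=1$, $(\theta_i,\theta_j)=\delta_{ij}(1-\pi_iq_i^{-2})^{-1}$, $(x,y'y'')=(r(x),y'\otimes y'')$, $(xx',y'')=(x\otimes x',r(y''))$, where $(x_1\otimes x_2,x_1'\otimes x_2')=(x_1,x_1')(x_2,x_2')$. $\mathcal I$ is its radical, $\mathbf f={}'\mathbf f/\mathcal I$, and $\mathbf f_\nu$ is the image of the weight-$\nu$ part ${}'\mathbf f_\nu$. $\mathbf U$ (the quantum covering group) is the unital associative $\mathbb Q(q)^\pi$-superalgebra with generators $E_i,F_i$ $(i\in I)$ of parity $p(i)$ and even generators $J_\mu,K_\mu$ $(\mu\in Y)$, and relations: $K_0=1$, $K_\mu K_{\mu'}=K_{\mu+\mu'}$; $J_{2\mu}=1$, $J_\mu J_{\mu'}=J_{\mu+\mu'}$; $J_\mu K_{\mu'}=K_{\mu'}J_\mu$; $K_\mu E_i=q^{\langle\mu,i'\rangle}E_iK_\mu$,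 $J_\mu E_i=\pi^{\langle\mu,i'\rangle}E_iJ_\mu$; $K_\mu F_i=q^{-\langle\mu,i'\rangle}F_iK_\mu$, $J_\mu F_i=\pi^{-\langle\mu,i'\rangle}F_iJ_\mu$; $E_iF_j-\pi^{p(i)p(j)}F_jE_i=\delta_{ij}\frac{\widetilde J_i\widetilde K_i-\widetilde K_{-i}}{\pi_iq_i-q_i^{-1}}$ with $\widetilde K_{\pm i}=K_{\pm d_ii}$, $\widetilde J_i=J_{d_ii}$; and $f(E_i:i\in I)=f(F_i:i\in I)=0$ for every $f(\theta_i:i\in I)\in\mathcal I$. $x\mapsto x^+$ is the algebra homomorphism $\mathbf f\to\mathbf U$ with $\theta_i^+=E_i$. $E_i^{(n)}=E_i^n/[n]_i^!$, $F_i^{(n)}=F_i^n/[n]_i^!$. Category $\mathcal C$: $\mathbb Z_2$-graded $\mathbf U$-modules $M=M_{\bar0}\oplus M_{\bar1}$ (compatible with the grading of $\mathbf U$) with $M=\bigoplus_{\lambda\in X}M^\lambda$, $M^\lambda=\{m\mid K_\mu m=q^{\langle\mu,\lambda\rangle}m,\ J_\mu m=\pi^{\langle\mu,\lambda\rangle}m\ \forall\mu\in Y\}$, each $M^\lambda$ being $\mathbb Z_2$-graded. $\mathcal O$: the full subcategory of those $M$ such that for each $m\in M$ there is $n\ge0$ with $x^+m=0$ for all $x\in\mathbf f_\nu$ with $\mathrm{ht}\,\nu\ge n$. $\mathcal C_{\mathrm{int}}$: the full subcategory of integrable modules, i.e. for any $m\in M$, $i\in I$ there is $n_0\ge1$ with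 $E_i^{(n)}m=F_i^{(n)}m=0$ for all $n\ge n_0$. $\mathcal O_{\mathrm{int}}=\mathcal O\cap\mathcal C_{\mathrm{int}}$. *)

theory Defs
  imports
    "HOL-Algebra.Algebraic_Closure_Type"
    "HOL-Algebra.Module"
    "HOL-Algebra.QuotRing"
    "HOL-Computational_Algebra.Fraction_Field"
    "HOL-Computational_Algebra.Polynomial"
    "HOL-Library.Poly_Mapping"
    "HOL-Library.Z2"
begin

section \<open>The coefficient ring\<close>

text \<open>The element \<open>QPi a b\<close> is \<open>a + b \<pi>\<close>, where \<open>a\<close> and \<open>b\<close> lie in the field of rational
  functions in \<open>q\<close> over the rationals and \<open>\<pi>\<^sup>2 = 1\<close>.\<close>

datatype qpi = QPi (qpi_fst: "rat poly fract") (qpi_snd: "rat poly fract")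

lemma qpi_eq_iff: "x = y \<longleftrightarrow> qpi_fst x = qpi_fst y \<and> qpi_snd x = qpi_snd y"
  by (cases x; cases y) simp

instantiation qpi :: comm_ring_1
begin

definition "0 = QPi 0 0"
definition "1 = QPi 1 0"
definition "x + y = QPi (qpi_fst x + qpi_fst y) (qpi_snd x + qpi_snd y)"
definition "x - y = QPi (qpi_fst x - qpi_fst y) (qpi_snd x - qpi_snd y)"
definition "- x = QPi (- qpi_fst x) (- qpi_snd x)"
definition "x * y = QPi (qpi_fst x * qpi_fst y + qpi_snd x * qpi_snd y)
                        (qpi_fst x * qpi_snd y + qpi_snd x * qpi_fst y)"

instance
  by standard
    (simp_all add: zero_qpi_def one_qpi_def plus_qpi_def minus_qpi_def uminus_qpi_def
      times_qpi_def algebra_simps)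

end

text \<open>Inverses come from \<open>(a + b \<pi>) (a - b \<pi>) = a\<^sup>2 - b\<^sup>2\<close>; the inverse of a non-unit is \<open>0\<close>.\<close>

instantiation qpi :: inverse
begin

definition "inverse x =
  QPi (qpi_fst x / (qpi_fst x ^ 2 - qpi_snd x ^ 2)) (- qpi_snd x / (qpi_fst x ^ 2 - qpi_snd x ^ 2))"

definition "x div y = x * inverse (y::qpi)"

instance ..

end

lemma qpi_inverse_unique:
  fixes x y :: qpi
  assumes "x * y = 1"
  shows "inverse x = y"
proof -
  obtain a b c d where xy: "x = QPi a b" "y = QPi c d" by (cases x; cases y)
  have 1: "a * c + b * d = 1" and 2: "a * d + b * c = 0"
    using assms by (simp_all add: xy times_qpi_def one_qpi_def)
  define N where "N = a ^ 2 - b ^ 2"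
  have "N * (c ^ 2 - d ^ 2) = (a * c + b * d) ^ 2 - (a * d + b * c) ^ 2"
    by (simp add: N_def power2_eq_square algebra_simps)
  then have "N \<noteq> 0" using 1 2 by auto
  have "N * c = a * (a * c + b * d) - b * (a * d + b * c)"
    by (simp add: N_def power2_eq_square algebra_simps)
  then have c: "a / N = c" using 1 2 \<open>N \<noteq> 0\<close> by (simp add: field_simps)
  have "N * d = a * (a * d + b * c) - b * (a * c + b * d)"
    by (simp add: N_def power2_eq_square algebra_simps)
  then have d: "- b / N = d" using 1 2 \<open>N \<noteq> 0\<close> by (simp add: field_simps)
  show ?thesis using c d by (simp add: xy inverse_qpi_def N_def)
qed

definition qq :: qpi where
  "qq = QPi (Fract [:0, 1:] 1) 0"

definition pp :: qpi where
  "pp = QPi 0 1"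

lemma pp_square: "pp * pp = 1"
  by (simp add: pp_def times_qpi_def one_qpi_def)

lemma qq_inverse: "qq * inverse qq = 1"
proof -
  define t :: "rat poly fract" where "t = Fract [:0, 1:] 1"
  have "t \<noteq> 0" by (simp add: t_def Zero_fract_def eq_fract)
  moreover have qq: "qq = QPi t 0" by (simp add: qq_def t_def)
  ultimately show ?thesis
    by (simp add: qq inverse_qpi_def times_qpi_def one_qpi_def power2_eq_square)
qed


section \<open>Abelian groups as modules over the integers\<close>

definition zscale :: "int \<Rightarrow> 'a \<Rightarrow> 'a::ab_group_add" where
  "zscale n x = (\<Sum>_<nat n. x) - (\<Sum>_<nat (- n). x)"

lemma zscale_diff: "zscale (int m - int n) x = (\<Sum>_<m. x) - (\<Sum>_<n. x)"
proof -
  have sum_add: "(\<Sum>_<a + b. x) = (\<Sum>_<a. x) + (\<Sum>_<b. x)" for a b :: nat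
    by (induction b) (simp_all add: algebra_simps)
  show ?thesis
  proof (cases "m \<le> n")
    case True
    then obtain k where k: "n = m + k" using le_Suc_ex by blast
    show ?thesis by (simp add: k zscale_def sum_add)
  next
    case False
    then obtain k where k: "m = n + k" using le_Suc_ex nat_le_linear by blast
    show ?thesis by (simp add: k zscale_def sum_add)
  qed
qed

lemma module_zscale: "Modules.module zscale"
proof
  fix a b :: int and x y :: 'a
  show "zscale a (x + y) = zscale a x + zscale a y"
    by (simp add: zscale_def sum.distrib)
  have sum_add: "(\<Sum>_<a + b. x) = (\<Sum>_<a. x) + (\<Sum>_<b. x)" for a b :: nat and x :: 'a
    by (induction b) (simp_all add: algebra_simps)
  have sum_mult: "(\<Sum>_<m * n. x) = (\<Sum>_<m. \<Sum>_<n. x)" for m n :: nat and x :: 'a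
    by (induction m) (simp_all add: sum_add algebra_simps)
  obtain m n where a: "a = int m - int n" by (rule int_diff_cases)
  obtain k l where b: "b = int k - int l" by (rule int_diff_cases)
  have "a + b = int (m + k) - int (n + l)" by (simp add: a b)
  then have "zscale (a + b) x = (\<Sum>_<m + k. x) - (\<Sum>_<n + l. x)" by (simp only: zscale_diff)
  then show "zscale (a + b) x = zscale a x + zscale b x"
    unfolding a b zscale_diff sum_add by (simp add: algebra_simps)
  have "a * b = int (m * k + n * l) - int (m * l + n * k)" by (simp add: a b algebra_simps)
  then have "zscale (a * b) x = (\<Sum>_<m * k + n * l. x) - (\<Sum>_<m * l + n * k. x)"
    by (simp only: zscale_diff)
  then show "zscale a (zscale b x) = zscale (a * b) x"
    unfolding a b zscale_diff sum_add sum_mult by (simp add: sum_subtractf algebra_simps)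
  show "zscale 1 x = x" by (simp add: zscale_def)
qed

definition fg_free :: "'a::ab_group_add itself \<Rightarrow> bool" where
  "fg_free _ \<longleftrightarrow> (\<exists>B :: 'a set. finite B \<and> \<not> Modules.module.dependent zscale B \<and>
     Modules.module.span zscale B = UNIV)"

definition perfect_pairing :: "('y::ab_group_add \<Rightarrow> 'x::ab_group_add \<Rightarrow> int) \<Rightarrow> bool" where
  "perfect_pairing b \<longleftrightarrow>
     (\<forall>x. additive (\<lambda>y. b y x)) \<and> (\<forall>y. additive (b y)) \<and>
     (\<forall>f. additive f \<longrightarrow> (\<exists>!y. b y = f)) \<and>
     (\<forall>f. additive f \<longrightarrow> (\<exists>!x. (\<lambda>y. b y x) = f))"


section \<open>Super Cartan data and root data\<close>

text \<open>The index set \<open>I\<close> is the type \<open>'i\<close>; the lattices \<open>Y\<close> and \<open>X\<close> are the types \<open>'y\<close> and \<open>'x\<close>.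
  The form on \<open>\<int>[I]\<close> is given by its values on the basis \<open>I\<close>.\<close>

record ('i, 'y, 'x) root_data =
  dot :: "'i \<Rightarrow> 'i \<Rightarrow> int"
  odds :: "'i set"
  pairing :: "'y \<Rightarrow> 'x \<Rightarrow> int"
  coroot :: "'i \<Rightarrow> 'y"
  sroot :: "'i \<Rightarrow> 'x"

definition super_cartan_datum :: "('i::finite, 'y, 'x) root_data \<Rightarrow> bool" where
  "super_cartan_datum D \<longleftrightarrow>
     odds D \<noteq> {} \<and>
     (\<forall>i j. dot D i j = dot D j i) \<and>
     (\<forall>i. \<exists>d>0. dot D i i = 2 * d) \<and>
     (\<forall>i j. i \<noteq> j \<longrightarrow> (\<exists>n::nat. 2 * dot D i j = - int n * dot D i i)) \<and>
     (\<forall>i\<in>odds D. \<forall>j. \<exists>k. 2 * dot D i j = (2 * k) * dot D i i)"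

definition root_datum :: "('i::finite, 'y::ab_group_add, 'x::ab_group_add) root_data \<Rightarrow> bool" where
  "root_datum D \<longleftrightarrow>
     fg_free TYPE('y) \<and> fg_free TYPE('x) \<and> perfect_pairing (pairing D) \<and>
     inj (coroot D) \<and> \<not> Modules.module.dependent zscale (range (coroot D)) \<and>
     inj (sroot D) \<and> \<not> Modules.module.dependent zscale (range (sroot D)) \<and>
     (\<forall>i j. pairing D (coroot D i) (sroot D j) * dot D i i = 2 * dot D i j)"

text \<open>Elements of \<open>\<int>[I]\<close> are functions \<open>'i \<Rightarrow> int\<close>. Below, \<open>dd\<close>, \<open>pari\<close>, \<open>qi\<close> and
  \<open>ppi\<close> stand for \<open>d\<^sub>i\<close>, \<open>p(i)\<close>, \<open>q\<^sub>i\<close> and \<open>\<pi>\<^sub>i\<close>, and \<open>qq\<close>, \<open>pp\<close> for \<open>q\<close>, \<open>\<pi>\<close>.\<close>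

definition dotZ :: "('i::finite, 'y, 'x) root_data \<Rightarrow> ('i \<Rightarrow> int) \<Rightarrow> ('i \<Rightarrow> int) \<Rightarrow> int" where
  "dotZ D \<nu> \<nu>' = (\<Sum>i\<in>UNIV. \<Sum>j\<in>UNIV. \<nu> i * \<nu>' j * dot D i j)"

definition par :: "('i::finite, 'y, 'x) root_data \<Rightarrow> ('i \<Rightarrow> int) \<Rightarrow> int" where
  "par D \<nu> = (\<Sum>i\<in>odds D. \<nu> i)"

definition ht :: "('i::finite \<Rightarrow> int) \<Rightarrow> int" where
  "ht \<nu> = (\<Sum>i\<in>UNIV. \<nu> i)"

definition dd :: "('i, 'y, 'x) root_data \<Rightarrow> 'i \<Rightarrow> int" where
  "dd D i = dot D i i div 2"

definition pari :: "('i, 'y, 'x) root_data \<Rightarrow> 'i \<Rightarrow> int" where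
  "pari D i = (if i \<in> odds D then 1 else 0)"

definition qi :: "('i, 'y, 'x) root_data \<Rightarrow> 'i \<Rightarrow> qpi" where
  "qi D i = qq powi dd D i"

definition ppi :: "('i, 'y, 'x) root_data \<Rightarrow> 'i \<Rightarrow> qpi" where
  "ppi D i = pp powi pari D i"

definition qint :: "('i, 'y, 'x) root_data \<Rightarrow> 'i \<Rightarrow> nat \<Rightarrow> qpi" where
  "qint D i n =
     ((ppi D i * qi D i) ^ n - inverse (qi D i) ^ n) / (ppi D i * qi D i - inverse (qi D i))"

definition qfact :: "('i, 'y, 'x) root_data \<Rightarrow> 'i \<Rightarrow> nat \<Rightarrow> qpi" where
  "qfact D i n = (\<Prod>s=1..n. qint D i s)"


section \<open>Free algebras\<close>

text \<open>With concatenation as addition of words, the convolution product of \<open>Poly_Mapping\<close> turns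
  \<open>'g list \<Rightarrow>\<^sub>0 qpi\<close> into the free associative unital algebra on \<open>'g\<close>.\<close>

instantiation list :: (type) monoid_add
begin

definition zero_list :: "'a list" where "0 = []"
definition plus_list :: "'a list \<Rightarrow> 'a list \<Rightarrow> 'a list" where "xs + ys = xs @ ys"

instance by standard (simp_all add: zero_list_def plus_list_def)

end

type_synonym 'g free_alg = "'g list \<Rightarrow>\<^sub>0 qpi"

definition csmult :: "qpi \<Rightarrow> ('a \<Rightarrow>\<^sub>0 qpi) \<Rightarrow> ('a \<Rightarrow>\<^sub>0 qpi)" (infixr \<open>*c\<close> 75) where
  "c *c x = Poly_Mapping.map ((*) c) x"

definition word :: "'g list \<Rightarrow> 'g free_alg" where
  "word w = Poly_Mapping.single w 1"

definition gen :: "'g \<Rightarrow> 'g free_alg" where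
  "gen g = word [g]"

text \<open>\<open>substitute h x\<close> is the value of the noncommutative polynomial \<open>x\<close> at \<open>g \<mapsto> h g\<close>.\<close>

definition substitute :: "('g \<Rightarrow> 'h free_alg) \<Rightarrow> 'g free_alg \<Rightarrow> 'h free_alg" where
  "substitute h x =
     (\<Sum>w\<in>Poly_Mapping.keys x. Poly_Mapping.lookup x w *c prod_list (map h w))"


section \<open>The algebra \<open>'f\<close>, its bilinear form, and \<open>f\<close>\<close>

definition wt :: "'i list \<Rightarrow> 'i \<Rightarrow> int" where
  "wt w i = int (count_list w i)"

definition fwt :: "('i \<Rightarrow> int) \<Rightarrow> 'i free_alg set" where
  "fwt \<nu> = {x. \<forall>w\<in>Poly_Mapping.keys x. wt w = \<nu>}"

text \<open>The tensor square of \<open>'f\<close> is the free module on pairs of words. Its multiplication is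
  \<open>tmult\<close>, which is the given formula on pairs of words, extended bilinearly.\<close>

type_synonym 'i tens = "('i list \<times> 'i list) \<Rightarrow>\<^sub>0 qpi"

definition tensor :: "'i free_alg \<Rightarrow> 'i free_alg \<Rightarrow> 'i tens" where
  "tensor x y = (\<Sum>u\<in>Poly_Mapping.keys x. \<Sum>v\<in>Poly_Mapping.keys y.
     Poly_Mapping.single (u, v) (Poly_Mapping.lookup x u * Poly_Mapping.lookup y v))"

definition tmult :: "('i::finite, 'y, 'x) root_data \<Rightarrow> 'i tens \<Rightarrow> 'i tens \<Rightarrow> 'i tens" where
  "tmult D s t = (\<Sum>(x1, x2)\<in>Poly_Mapping.keys s. \<Sum>(y1, y2)\<in>Poly_Mapping.keys t.
     Poly_Mapping.single (x1 @ y1, x2 @ y2)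
       (Poly_Mapping.lookup s (x1, x2) * Poly_Mapping.lookup t (y1, y2) *
        qq powi dotZ D (wt x2) (wt y1) * pp powi (par D (wt x2) * par D (wt y1))))"

primrec coprod_word :: "('i::finite, 'y, 'x) root_data \<Rightarrow> 'i list \<Rightarrow> 'i tens" where
  "coprod_word D [] = tensor 1 1"
| "coprod_word D (i # w) = tmult D (tensor (gen i) 1 + tensor 1 (gen i)) (coprod_word D w)"

definition coprod :: "('i::finite, 'y, 'x) root_data \<Rightarrow> 'i free_alg \<Rightarrow> 'i tens" where
  "coprod D x = (\<Sum>w\<in>Poly_Mapping.keys x. Poly_Mapping.lookup x w *c coprod_word D w)"

definition bilinear_form :: "('i free_alg \<Rightarrow> 'i free_alg \<Rightarrow> qpi) \<Rightarrow> bool" where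
  "bilinear_form B \<longleftrightarrow>
     (\<forall>x x' y. B (x + x') y = B x y + B x' y) \<and> (\<forall>c x y. B (c *c x) y = c * B x y) \<and>
     (\<forall>x y y'. B x (y + y') = B x y + B x y') \<and> (\<forall>c x y. B x (c *c y) = c * B x y)"

definition tform :: "('i free_alg \<Rightarrow> 'i free_alg \<Rightarrow> qpi) \<Rightarrow> 'i tens \<Rightarrow> 'i tens \<Rightarrow> qpi" where
  "tform B s t = (\<Sum>(x1, x2)\<in>Poly_Mapping.keys s. \<Sum>(y1, y2)\<in>Poly_Mapping.keys t.
     Poly_Mapping.lookup s (x1, x2) * Poly_Mapping.lookup t (y1, y2) *
     (B (word x1) (word y1) * B (word x2) (word y2)))"

definition is_form ::
  "('i::finite, 'y, 'x) root_data \<Rightarrow> ('i free_alg \<Rightarrow> 'i free_alg \<Rightarrow> qpi) \<Rightarrow> bool" where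
  "is_form D B \<longleftrightarrow>
     bilinear_form B \<and> B 1 1 = 1 \<and>
     (\<forall>i j. B (gen i) (gen j) =
        (if i = j then inverse (1 - ppi D i * qi D i powi (- 2)) else 0)) \<and>
     (\<forall>x y' y''. B x (y' * y'') = tform B (coprod D x) (tensor y' y'')) \<and>
     (\<forall>x x' y''. B (x * x') y'' = tform B (tensor x x') (coprod D y''))"

definition the_form ::
  "('i::finite, 'y, 'x) root_data \<Rightarrow> 'i free_alg \<Rightarrow> 'i free_alg \<Rightarrow> qpi" where
  "the_form D = (THE B. is_form D B)"

definition radical :: "('i::finite, 'y, 'x) root_data \<Rightarrow> 'i free_alg set" where
  "radical D = {x. \<forall>y. the_form D x y = 0}"

definition ff :: "('i::finite, 'y, 'x) root_data \<Rightarrow> 'i free_alg set ring" where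
  "ff D = ring_of_type_algebra Quot radical D"

definition ff_wt :: "('i::finite, 'y, 'x) root_data \<Rightarrow> ('i \<Rightarrow> int) \<Rightarrow> 'i free_alg set set" where
  "ff_wt D \<nu> = (\<lambda>x. radical D +>\<^bsub>ring_of_type_algebra\<^esub> x) ` fwt \<nu>"


section \<open>The quantum covering group\<close>

datatype ('i, 'y) ugen = GE 'i | GF 'i | GJ 'y | GK 'y

definition urels ::
  "('i::finite, 'y::ab_group_add, 'x::ab_group_add) root_data \<Rightarrow> ('i, 'y) ugen free_alg set" where
  "urels D =
     (let E = (\<lambda>i. gen (GE i)); F = (\<lambda>i. gen (GF i)); J = (\<lambda>\<mu>. gen (GJ \<mu>)); K = (\<lambda>\<mu>. gen (GK \<mu>));
          ev = (\<lambda>\<mu> i. pairing D \<mu> (sroot D i))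
      in {K 0 - 1}
       \<union> {K \<mu> * K \<mu>' - K (\<mu> + \<mu>') | \<mu> \<mu>'. True}
       \<union> {J (zscale 2 \<mu>) - 1 | \<mu>. True}
       \<union> {J \<mu> * J \<mu>' - J (\<mu> + \<mu>') | \<mu> \<mu>'. True}
       \<union> {J \<mu> * K \<mu>' - K \<mu>' * J \<mu> | \<mu> \<mu>'. True}
       \<union> {K \<mu> * E i - (qq powi ev \<mu> i) *c (E i * K \<mu>) | \<mu> i. True}
       \<union> {J \<mu> * E i - (pp powi ev \<mu> i) *c (E i * J \<mu>) | \<mu> i. True}
       \<union> {K \<mu> * F i - (qq powi (- ev \<mu> i)) *c (F i * K \<mu>) | \<mu> i. True}
       \<union> {J \<mu> * F i - (pp powi (- ev \<mu> i)) *c (F i * J \<mu>) | \<mu> i. True}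
       \<union> {E i * F j - (pp powi (pari D i * pari D j)) *c (F j * E i)
            - (if i = j then
                 inverse (ppi D i * qi D i - inverse (qi D i)) *c
                   (J (zscale (dd D i) (coroot D i)) * K (zscale (dd D i) (coroot D i))
                    - K (- zscale (dd D i) (coroot D i)))
               else 0) | i j. True}
       \<union> substitute E ` radical D
       \<union> substitute F ` radical D)"

definition uideal ::
  "('i::finite, 'y::ab_group_add, 'x::ab_group_add) root_data \<Rightarrow> ('i, 'y) ugen free_alg set" where
  "uideal D = Idl\<^bsub>ring_of_type_algebra\<^esub> (urels D)"

type_synonym ('i, 'y) U_elem = "('i, 'y) ugen free_alg set"

definition UU ::
  "('i::finite, 'y::ab_group_add, 'x::ab_group_add) root_data \<Rightarrow> ('i, 'y) U_elem ring" where
  "UU D = ring_of_type_algebra Quot uideal D"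

definition ucls :: "('i::finite, 'y::ab_group_add, 'x::ab_group_add) root_data
    \<Rightarrow> ('i, 'y) ugen free_alg \<Rightarrow> ('i, 'y) U_elem" where
  "ucls D x = uideal D +>\<^bsub>ring_of_type_algebra\<^esub> x"

primrec ugen_par :: "('i::finite, 'y, 'x) root_data \<Rightarrow> ('i, 'y) ugen \<Rightarrow> bit" where
  "ugen_par D (GE i) = of_int (pari D i)"
| "ugen_par D (GF i) = of_int (pari D i)"
| "ugen_par D (GJ \<mu>) = 0"
| "ugen_par D (GK \<mu>) = 0"

definition U_par ::
  "('i::finite, 'y::ab_group_add, 'x::ab_group_add) root_data \<Rightarrow> bit \<Rightarrow> ('i, 'y) U_elem set" where
  "U_par D a = ucls D ` {x. \<forall>w\<in>Poly_Mapping.keys x. sum_list (map (ugen_par D) w) = a}"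

text \<open>Scalars act on a \<open>U\<close>-module through \<open>U\<close>.\<close>

definition U_scalar :: "('i::finite, 'y::ab_group_add, 'x::ab_group_add) root_data
    \<Rightarrow> qpi \<Rightarrow> ('i, 'y) U_elem" where
  "U_scalar D c = ucls D (c *c 1)"

definition U_E where "U_E D i = ucls D (gen (GE i))"
definition U_F where "U_F D i = ucls D (gen (GF i))"
definition U_J where "U_J D \<mu> = ucls D (gen (GJ \<mu>))"
definition U_K where "U_K D \<mu> = ucls D (gen (GK \<mu>))"

definition U_Ediv :: "('i::finite, 'y::ab_group_add, 'x::ab_group_add) root_data
    \<Rightarrow> 'i \<Rightarrow> nat \<Rightarrow> ('i, 'y) U_elem" where
  "U_Ediv D i n = U_scalar D (inverse (qfact D i n)) \<otimes>\<^bsub>UU D\<^esub> (U_E D i [^]\<^bsub>UU D\<^esub> n)"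

definition U_Fdiv :: "('i::finite, 'y::ab_group_add, 'x::ab_group_add) root_data
    \<Rightarrow> 'i \<Rightarrow> nat \<Rightarrow> ('i, 'y) U_elem" where
  "U_Fdiv D i n = U_scalar D (inverse (qfact D i n)) \<otimes>\<^bsub>UU D\<^esub> (U_F D i [^]\<^bsub>UU D\<^esub> n)"

text \<open>The homomorphism \<open>f \<rightarrow> U\<close> with \<open>\<theta>\<^sub>i \<mapsto> E\<^sub>i\<close>, computed on the coset \<open>x\<close> from any representative.\<close>

definition U_plus :: "('i::finite, 'y::ab_group_add, 'x::ab_group_add) root_data
    \<Rightarrow> 'i free_alg set \<Rightarrow> ('i, 'y) U_elem" where
  "U_plus D x = the_elem ((\<lambda>y. ucls D (substitute (\<lambda>i. gen (GE i)) y)) ` x)"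


section \<open>Modules\<close>

text \<open>The library's \<open>module\<close> locale requires a commutative ring of scalars.\<close>

locale left_module = R?: ring R + M?: abelian_group M
  for R :: "('a, 'c) ring_scheme" (structure) and M :: "('a, 'm, 'b) module_scheme" (structure) +
  assumes smult_closed: "\<lbrakk>a \<in> carrier R; x \<in> carrier M\<rbrakk> \<Longrightarrow> a \<odot>\<^bsub>M\<^esub> x \<in> carrier M"
    and smult_l_distr: "\<lbrakk>a \<in> carrier R; b \<in> carrier R; x \<in> carrier M\<rbrakk> \<Longrightarrow>
      (a \<oplus>\<^bsub>R\<^esub> b) \<odot>\<^bsub>M\<^esub> x = a \<odot>\<^bsub>M\<^esub> x \<oplus>\<^bsub>M\<^esub> b \<odot>\<^bsub>M\<^esub> x"
    and smult_r_distr: "\<lbrakk>a \<in> carrier R; x \<in> carrier M; y \<in> carrier M\<rbrakk> \<Longrightarrow>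
      a \<odot>\<^bsub>M\<^esub> (x \<oplus>\<^bsub>M\<^esub> y) = a \<odot>\<^bsub>M\<^esub> x \<oplus>\<^bsub>M\<^esub> a \<odot>\<^bsub>M\<^esub> y"
    and smult_assoc: "\<lbrakk>a \<in> carrier R; b \<in> carrier R; x \<in> carrier M\<rbrakk> \<Longrightarrow>
      (a \<otimes>\<^bsub>R\<^esub> b) \<odot>\<^bsub>M\<^esub> x = a \<odot>\<^bsub>M\<^esub> (b \<odot>\<^bsub>M\<^esub> x)"
    and smult_one: "x \<in> carrier M \<Longrightarrow> \<one>\<^bsub>R\<^esub> \<odot>\<^bsub>M\<^esub> x = x"

definition internal_direct_sum :: "('m, 'b) ring_scheme \<Rightarrow> ('l \<Rightarrow> 'm set) \<Rightarrow> bool" where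
  "internal_direct_sum M A \<longleftrightarrow>
     (\<forall>l. additive_subgroup (A l) M) \<and>
     (\<forall>m\<in>carrier M. \<exists>!f. (\<forall>l. f l \<in> A l) \<and> finite {l. f l \<noteq> \<zero>\<^bsub>M\<^esub>} \<and>
        m = (\<Oplus>\<^bsub>M\<^esub>l\<in>{l. f l \<noteq> \<zero>\<^bsub>M\<^esub>}. f l))"

text \<open>A \<open>\<int>\<^sub>2\<close>-grading of \<open>M\<close> is given by its two homogeneous parts \<open>G 0\<close> and \<open>G 1\<close>.\<close>

definition graded_subset :: "('m, 'b) ring_scheme \<Rightarrow> (bit \<Rightarrow> 'm set) \<Rightarrow> 'm set \<Rightarrow> bool" where
  "graded_subset M G N \<longleftrightarrow> (\<forall>m\<in>N. \<exists>m0\<in>N \<inter> G 0. \<exists>m1\<in>N \<inter> G 1. m = m0 \<oplus>\<^bsub>M\<^esub> m1)"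

definition graded_U_module :: "('i::finite, 'y::ab_group_add, 'x::ab_group_add) root_data
    \<Rightarrow> (('i, 'y) U_elem, 'm) module \<Rightarrow> (bit \<Rightarrow> 'm set) \<Rightarrow> bool" where
  "graded_U_module D M G \<longleftrightarrow>
     left_module (UU D) M \<and> internal_direct_sum M G \<and>
     (\<forall>a b. \<forall>u\<in>U_par D a. \<forall>m\<in>G b. u \<odot>\<^bsub>M\<^esub> m \<in> G (a + b))"

definition weight_space :: "('i::finite, 'y::ab_group_add, 'x::ab_group_add) root_data
    \<Rightarrow> (('i, 'y) U_elem, 'm) module \<Rightarrow> 'x \<Rightarrow> 'm set" where
  "weight_space D M l = {m \<in> carrier M. \<forall>\<mu>.
     U_K D \<mu> \<odot>\<^bsub>M\<^esub> m = U_scalar D (qq powi pairing D \<mu> l) \<odot>\<^bsub>M\<^esub> m \<and>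
     U_J D \<mu> \<odot>\<^bsub>M\<^esub> m = U_scalar D (pp powi pairing D \<mu> l) \<odot>\<^bsub>M\<^esub> m}"

definition cat_C :: "('i::finite, 'y::ab_group_add, 'x::ab_group_add) root_data
    \<Rightarrow> (('i, 'y) U_elem, 'm) module \<Rightarrow> (bit \<Rightarrow> 'm set) \<Rightarrow> bool" where
  "cat_C D M G \<longleftrightarrow>
     graded_U_module D M G \<and> internal_direct_sum M (weight_space D M) \<and>
     (\<forall>l. graded_subset M G (weight_space D M l))"

definition cat_O :: "('i::finite, 'y::ab_group_add, 'x::ab_group_add) root_data
    \<Rightarrow> (('i, 'y) U_elem, 'm) module \<Rightarrow> (bit \<Rightarrow> 'm set) \<Rightarrow> bool" where
  "cat_O D M G \<longleftrightarrow>
     cat_C D M G \<and>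
     (\<forall>m\<in>carrier M. \<exists>n::nat. \<forall>\<nu>. int n \<le> ht \<nu> \<longrightarrow>
        (\<forall>x\<in>ff_wt D \<nu>. U_plus D x \<odot>\<^bsub>M\<^esub> m = \<zero>\<^bsub>M\<^esub>))"

definition cat_C_int :: "('i::finite, 'y::ab_group_add, 'x::ab_group_add) root_data
    \<Rightarrow> (('i, 'y) U_elem, 'm) module \<Rightarrow> (bit \<Rightarrow> 'm set) \<Rightarrow> bool" where
  "cat_C_int D M G \<longleftrightarrow>
     cat_C D M G \<and>
     (\<forall>m\<in>carrier M. \<forall>i. \<exists>n0\<ge>1. \<forall>n\<ge>n0.
        U_Ediv D i n \<odot>\<^bsub>M\<^esub> m = \<zero>\<^bsub>M\<^esub> \<and> U_Fdiv D i n \<odot>\<^bsub>M\<^esub> m = \<zero>\<^bsub>M\<^esub>)"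

definition cat_O_int :: "('i::finite, 'y::ab_group_add, 'x::ab_group_add) root_data
    \<Rightarrow> (('i, 'y) U_elem, 'm) module \<Rightarrow> (bit \<Rightarrow> 'm set) \<Rightarrow> bool" where
  "cat_O_int D M G \<longleftrightarrow> cat_O D M G \<and> cat_C_int D M G"

text \<open>Submodules of \<open>\<int>\<^sub>2\<close>-graded modules are \<open>\<int>\<^sub>2\<close>-graded, and simplicity is tested against these.\<close>

definition U_submodule :: "('i::finite, 'y::ab_group_add, 'x::ab_group_add) root_data
    \<Rightarrow> (('i, 'y) U_elem, 'm) module \<Rightarrow> (bit \<Rightarrow> 'm set) \<Rightarrow> 'm set \<Rightarrow> bool" where
  "U_submodule D M G N \<longleftrightarrow> submodule N (UU D) M \<and> graded_subset M G N"

definition simple_U_submodule :: "('i::finite, 'y::ab_group_add, 'x::ab_group_add) root_data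
    \<Rightarrow> (('i, 'y) U_elem, 'm) module \<Rightarrow> (bit \<Rightarrow> 'm set) \<Rightarrow> 'm set \<Rightarrow> bool" where
  "simple_U_submodule D M G N \<longleftrightarrow>
     U_submodule D M G N \<and> N \<noteq> {\<zero>\<^bsub>M\<^esub>} \<and>
     (\<forall>N'. U_submodule D M G N' \<and> N' \<subseteq> N \<longrightarrow> N' = {\<zero>\<^bsub>M\<^esub>} \<or> N' = N)"

definition sum_of_submodules :: "('m, 'b) ring_scheme \<Rightarrow> 'm set set \<Rightarrow> 'm set" where
  "sum_of_submodules M S =
     {\<Oplus>\<^bsub>M\<^esub>N\<in>T. f N | T f. finite T \<and> T \<subseteq> S \<and> (\<forall>N\<in>T. f N \<in> N)}"

end

theory Submission
  imports Defs "HOL-Library.Function_Algebras"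
begin

text \<open>Evaluating \<open>\<pi>\<close> at \<open>\<plusminus>1\<close> splits \<open>M\<close> into two vector spaces over the rational functions in
  \<open>q\<close>. On each of them the relation for \<open>E\<^sub>i F\<^sub>i\<close> has the coefficient \<open>[\<langle>i, \<lambda>\<rangle>]\<^sub>i\<close> on the weight space of
  weight \<open>\<lambda>\<close>: for a datum that is not bar-consistent a sign could intervene, but integrability in rank
  one excludes it. The same computation shows that weights of primitive vectors are dominant.

  Everything else rests on the Casimir operator \<open>\<Omega> = \<Sum> A(u, w) s(w) F\<^sub>u E\<^sub>w\<close>, summed over pairs of words of
  equal length, where \<open>A\<close> is a generalized inverse of the Gram matrix of the form on words; it replaces
  dual bases of \<open>f\<close>. Since \<open>\<Omega>\<close> commutes with \<open>E\<^sub>i\<close> and \<open>F\<^sub>i\<close> up to scalars and fixes primitive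
  vectors, it acts on a weight space of \<open>U v\<close>, for \<open>v\<close> primitive of weight \<open>\<lambda>\<close>, by a scalar that is up to
  sign \<open>q\<close> to the power \<open>- \<Sum> d\<^sub>i (\<langle>i, \<lambda>\<rangle> + \<langle>i, \<mu>\<rangle> + 2)\<close>, the sum running over the letters \<open>i\<close> of a word
  of weight \<open>\<lambda> - \<mu>\<close>. This is not \<open>\<plusminus>1\<close> if \<open>\<mu> \<noteq> \<lambda>\<close> is dominant, so \<open>U v\<close> contains no further primitive
  vectors and is simple. If the submodule \<open>M'\<close> generated by all primitive vectors were proper, there would
  be \<open>m \<notin> M'\<close> of weight \<open>\<mu>\<close> with \<open>E\<^sub>i m \<in> M'\<close> for all \<open>i\<close>; changing \<open>m\<close> modulo \<open>M'\<close> gives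
  \<open>(\<Omega> - 1)\<^sup>2 m = 0\<close>, and comparing with the eigenvalue \<open>1\<close> on a primitive vector \<open>E\<^sub>w m\<close> shows \<open>w = []\<close>,
  whence \<open>m \<in> M'\<close>.\<close>

section \<open>Generalized inverses of matrices\<close>

text \<open>Working with words avoids choosing a basis of f, but the form on words is degenerate.
  The identity b A b = b is enough: it says that a word and its expansion through A differ by an
  element of the radical, and operators that kill the radical cannot tell the two apart. The Casimir
  operator is not corrected by a quadratic function of the weight; the scalars it picks up along a
  word are multiplied instead. The resulting exponent is |l + beta + rho|^2 - |l + rho|^2, written
  without a form on X, and its summands are positive when both ends are dominant. Only squares of
  the scalars are tracked, which disposes of all signs. If every E_i m lies in M', then g = Omega m
  - m lies in M'. As Omega has eigenvectors spanning the weight spaces of M', g is a fixed vector e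
  plus an element of the image of Omega - 1 on M'. Subtracting a preimage from m leaves Omega m = m
  + e, that is (Omega - 1)^2 m = 0. The coefficients have zero divisors and M is a carrier set. So M
  is embedded in a free vector space by a linear section, and pi becomes an operator with
  eigenvalues 1 and -1.\<close>

lemma sum_pointwise: "sum f S x = (\<Sum>i\<in>S. f i x)"
  for f :: "'b \<Rightarrow> 'a \<Rightarrow> 'c::comm_monoid_add"
  by (induction S rule: infinite_finite_induct) (auto simp: plus_fun_def zero_fun_def)

text \<open>The linear map \<open>T\<close> with matrix \<open>G\<close> has a linear
  \<open>g\<close> inverting it on its range, so T g T = T; \<open>A\<close> is the matrix of
  \<open>g\<close> on the coordinate functions.\<close>

lemma generalized_inverse_exists:
  fixes G :: "'a \<Rightarrow> 'a \<Rightarrow> 'k::field"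
  assumes "finite S"
  shows "\<exists>A. \<forall>x\<in>S. \<forall>y\<in>S. (\<Sum>a\<in>S. \<Sum>c\<in>S. G x a * A a c * G c y) = G x y"
proof -
  define sc :: "'k \<Rightarrow> ('a \<Rightarrow> 'k) \<Rightarrow> 'a \<Rightarrow> 'k" where "sc = (\<lambda>c f x. c * f x)"
  interpret vs: vector_space sc
    by unfold_locales (auto simp: sc_def fun_eq_iff algebra_simps)
  interpret vp: vector_space_pair sc sc ..
  define T where "T = (\<lambda>f x. if x \<in> S then \<Sum>a\<in>S. G x a * f a else 0)"
  have T: "Vector_Spaces.linear sc sc T"
  proof (unfold Vector_Spaces.linear_iff, intro conjI allI ext)
    show "T (f + h) x = (T f + T h) x" for f h x
      by (simp add: T_def distrib_left sum.distrib)
    show "T (sc c f) x = sc c (T f) x" for c f x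
      by (simp add: T_def sc_def sum_distrib_left mult.left_commute)
  qed (rule vs.vector_space_axioms)+
  obtain g where g: "Vector_Spaces.linear sc sc g" and Tg: "\<And>f. T (g (T f)) = T f"
    using vp.linear_exists_right_inverse_on[OF T vs.subspace_UNIV] by blast
  interpret g: Vector_Spaces.linear sc sc g by fact
  define e :: "'a \<Rightarrow> 'a \<Rightarrow> 'k" where "e = (\<lambda>c x. if x = c then 1 else 0)"
  have "(\<Sum>a\<in>S. \<Sum>c\<in>S. G x a * g (e c) a * G c y) = G x y" if "x \<in> S" "y \<in> S" for x y
  proof -
    define h where "h = T (e y)"
    have hx: "h z = (if z \<in> S then G z y else 0)" for z
      using that assms by (simp add: h_def T_def e_def if_distrib[of "(*) _"] cong: if_cong)
    have "h = (\<Sum>c\<in>S. sc (G c y) (e c))"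
    proof
      fix z
      show "h z = (\<Sum>c\<in>S. sc (G c y) (e c)) z"
        unfolding sum_pointwise hx using assms
        by (simp add: sc_def e_def if_distrib[of "(*) _"] cong: if_cong)
    qed
    then have "g h = (\<Sum>c\<in>S. sc (G c y) (g (e c)))"
      by (simp only: g.sum g.scale)
    then have gh: "g h z = (\<Sum>c\<in>S. G c y * g (e c) z)" for z
      by (simp add: sum_pointwise sc_def)
    have "G x y = T (g h) x"
      using Tg[of "e y"] that by (simp add: hx flip: h_def)
    also have "\<dots> = (\<Sum>a\<in>S. G x a * (\<Sum>c\<in>S. G c y * g (e c) a))"
      using that by (simp only: T_def gh if_True)
    also have "\<dots> = (\<Sum>a\<in>S. \<Sum>c\<in>S. G x a * g (e c) a * G c y)"
      unfolding sum_distrib_left by (intro sum.cong refl) (simp only: ac_simps)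
    finally show ?thesis by (rule sym)
  qed
  then show ?thesis by (intro exI[of _ "\<lambda>a c. g (e c) a"] ballI)
qed

section \<open>Words\<close>

definition del :: "nat \<Rightarrow> 'a list \<Rightarrow> 'a list" where
  "del k u = take k u @ drop (Suc k) u"

lemma del_Cons [simp]: "del 0 (i # u) = u" "del (Suc k) (i # u) = i # del k u"
  by (simp_all add: del_def)

lemma length_del [simp]: "k < length u \<Longrightarrow> length (del k u) = length u - 1"
  by (simp add: del_def)

lemma mset_del: "k < length u \<Longrightarrow> mset u = add_mset (u ! k) (mset (del k u))"
  by (subst id_take_nth_drop[of k u]) (simp_all add: del_def)

primrec wact :: "('i \<Rightarrow> 'v \<Rightarrow> 'v) \<Rightarrow> 'i list \<Rightarrow> 'v \<Rightarrow> 'v" where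
  "wact f [] m = m"
| "wact f (i # w) m = f i (wact f w m)"

lemma wact_append: "wact f (u @ w) m = wact f u (wact f w m)"
  by (induction u) auto

abbreviation words :: "nat \<Rightarrow> 'i list set" where
  "words n \<equiv> {u. length u = n}"

lemma finite_words [simp]: "finite (words n :: 'i::finite list set)"
  using finite_lists_length_eq[of "UNIV :: 'i set" n] by simp

section \<open>Scalars and skew derivations\<close>

text \<open>Here \<open>eps\<close> is the value of \<open>\<pi>\<close>, \<open>dt\<close> the form on \<open>I\<close>, \<open>p\<close> the parity and \<open>a\<close> the Cartan matrix.\<close>

locale qdatum =
  fixes q eps :: "'k::field_char_0" and dt :: "'i::finite \<Rightarrow> 'i \<Rightarrow> int"
    and d :: "'i \<Rightarrow> int" and p :: "'i \<Rightarrow> nat" and a :: "'i \<Rightarrow> 'i \<Rightarrow> int"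
    and b :: "'i list \<Rightarrow> 'i list \<Rightarrow> 'k"
  assumes q0 [simp]: "q \<noteq> 0"
    and q_root: "q powi z = 1 \<Longrightarrow> z = 0"
    and eps2: "eps * eps = 1"
    and d_pos: "d i > 0"
    and dt_sym: "dt i j = dt j i"
    and dt_diag: "dt i i = 2 * d i"
    and dt_a: "d i * a i j = dt i j"
    and p01: "p i = 0 \<or> p i = 1"
    and a_even: "p i = 1 \<Longrightarrow> even (a i j)"
begin

definition ep :: "'i \<Rightarrow> 'k" where "ep i = eps ^ p i"
text \<open>The norm (theta_i, theta_i) with pi replaced by \<open>eps\<close>.\<close>

definition cc :: "'i \<Rightarrow> 'k" where "cc i = inverse (1 - ep i * q powi (- 2 * d i))"
definition pw :: "'i list \<Rightarrow> nat" where "pw w = (\<Sum>i\<leftarrow>w. p i)"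
definition dw :: "'i \<Rightarrow> 'i list \<Rightarrow> int" where "dw j w = (\<Sum>i\<leftarrow>w. dt j i)"
text \<open>The factor for moving theta_j past the word \<open>w\<close> in the twisted product of
  the tensor square.\<close>

definition chi :: "'i \<Rightarrow> 'i list \<Rightarrow> 'k" where "chi j w = q powi dw j w * eps ^ (p j * pw w)"
text \<open>The coefficient of the word with its \<open>k\<close>-th letter deleted in the left, respectively right, skew
  derivation \<open>r\<^sub>j\<close> of the word \<open>u\<close>.\<close>

definition Lcf :: "'i \<Rightarrow> 'i list \<Rightarrow> nat \<Rightarrow> 'k" where
  "Lcf j u k = (if u ! k = j then chi j (take k u) else 0)"
definition Rcf :: "'i \<Rightarrow> 'i list \<Rightarrow> nat \<Rightarrow> 'k" where
  "Rcf j u k = (if u ! k = j then chi j (drop (Suc k) u) else 0)"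

lemma sum_list_mset_cong:
  fixes f :: "'b \<Rightarrow> 'c::comm_monoid_add"
  assumes "mset u = mset w" shows "(\<Sum>i\<leftarrow>u. f i) = (\<Sum>i\<leftarrow>w. f i)"
proof -
  have "mset (map f u) = mset (map f w)" using assms by simp
  then have "sum_mset (mset (map f u)) = sum_mset (mset (map f w))" by simp
  then show ?thesis by (simp only: sum_mset_sum_list)
qed

lemma pw_simps [simp]: "pw [] = 0" "pw (i # w) = p i + pw w" "pw (u @ w) = pw u + pw w"
  by (simp_all add: pw_def)

lemma dw_simps [simp]: "dw j [] = 0" "dw j (i # w) = dt j i + dw j w" "dw j (u @ w) = dw j u + dw j w"
  by (simp_all add: dw_def)

lemma pw_mset: "mset u = mset w \<Longrightarrow> pw u = pw w"
  unfolding pw_def by (rule sum_list_mset_cong)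

lemma dw_mset: "mset u = mset w \<Longrightarrow> dw j u = dw j w"
  unfolding dw_def by (rule sum_list_mset_cong)

lemma eps_nz [simp]: "eps \<noteq> 0"
proof
  assume "eps = 0"
  then show False using eps2 by simp
qed

lemma eps_pow_even [simp]: "eps ^ (m + m) = 1" "eps * (eps * x) = x"
proof -
  have "eps ^ (m + m) = (eps * eps) ^ m" by (simp only: power_add power_mult_distrib)
  then show "eps ^ (m + m) = 1" by (simp add: eps2)
  show "eps * (eps * x) = x" by (simp only: eps2 mult_1 flip: mult.assoc)
qed

lemma ep_nz [simp]: "ep i \<noteq> 0"
  by (simp add: ep_def)

lemma ep2 [simp]: "ep i * ep i = 1" "ep i * (ep i * x) = x"
proof -
  show 1: "ep i * ep i = 1" by (simp only: ep_def eps_pow_even flip: power_add)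
  show "ep i * (ep i * x) = x" by (simp only: 1 mult_1 flip: mult.assoc)
qed

text \<open>Squaring removes the sign \<open>ep i\<close> and leaves a power of \<open>q\<close>
  with nonzero exponent.\<close>

lemma cc_denom_nz: "1 - ep i * q powi (- 2 * d i) \<noteq> 0"
proof
  assume "1 - ep i * q powi (- 2 * d i) = 0"
  then have 1: "ep i * q powi (- 2 * d i) = 1" by simp
  have "q powi (- 4 * d i) = (ep i * q powi (- 2 * d i)) * (ep i * q powi (- 2 * d i))"
    by (simp add: ac_simps flip: power_int_add)
  then have "q powi (- 4 * d i) = 1" by (simp only: 1 mult_1)
  then show False using q_root[of "- 4 * d i"] d_pos[of i] by simp
qed

lemma cc_nz [simp]: "cc i \<noteq> 0"
  using cc_denom_nz[of i] by (simp add: cc_def)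

text \<open>Links the norm of theta_i to the denominator in the relation for E_i and F_i;
  \<open>const1\<close> and \<open>const2\<close> rest on it.\<close>

lemma cc_eq: "inverse (cc i) * (ep i * q powi d i) = ep i * q powi d i - q powi (- d i)"
proof -
  have "q powi (- 2 * d i) * q powi d i = q powi (- d i)"
    by (simp flip: power_int_add)
  then show ?thesis by (simp add: cc_def algebra_simps)
qed

lemma denom_nz [simp]: "ep i * q powi d i - q powi (- d i) \<noteq> 0"
  by (subst cc_eq[symmetric]) simp

end

text \<open>All that the module theory uses of the form: symmetry, the values at the empty word, and
  the adjointness of left and right multiplication by theta_j to the two skew derivations.\<close>

locale qform = qdatum q eps dt d p a b
  for q eps :: "'k::field_char_0" and dt :: "'i::finite \<Rightarrow> 'i \<Rightarrow> int"
    and d :: "'i \<Rightarrow> int" and p :: "'i \<Rightarrow> nat" and a :: "'i \<Rightarrow> 'i \<Rightarrow> int"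
    and b :: "'i list \<Rightarrow> 'i list \<Rightarrow> 'k" +
  assumes b_sym: "b u w = b w u"
    and b_Nil: "b u [] = (if u = [] then 1 else 0)"
    and b_Cons: "b u (j # w) = cc j * (\<Sum>k<length u. Lcf j u k * b (del k u) w)"
    and b_snoc: "b u (w @ [j]) = cc j * (\<Sum>k<length u. Rcf j u k * b (del k u) w)"
begin

text \<open>Each step of the recursion removes the same letter from both words.\<close>

lemma b_mset: "b u w \<noteq> 0 \<Longrightarrow> mset u = mset w"
proof (induction w arbitrary: u)
  case Nil
  then show ?case by (auto simp: b_Nil split: if_splits)
next
  case (Cons j w)
  then obtain k where k: "k < length u" "Lcf j u k * b (del k u) w \<noteq> 0"
    by (auto simp: b_Cons elim!: sum.not_neutral_contains_not_neutral)
  then show ?case using Cons.IH[of "del k u"] mset_del[of k u]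
    by (auto simp: Lcf_def split: if_splits)
qed

text \<open>Besides b A b = b, symmetry lets the two words be interchanged (\<open>tr_swap\<close>),
  and vanishing between different weights lets identities be checked on pairs with equal letters
  only (\<open>tr_cong\<close>).\<close>

definition ginv :: "nat \<Rightarrow> ('i list \<Rightarrow> 'i list \<Rightarrow> 'k) \<Rightarrow> bool" where
  "ginv n A \<longleftrightarrow> (\<forall>x\<in>words n. \<forall>y\<in>words n.
     (\<Sum>u\<in>words n. \<Sum>w\<in>words n. b x u * A u w * b w y) = b x y) \<and>
     (\<forall>u w. A u w = A w u) \<and> (\<forall>u w. mset u \<noteq> mset w \<longrightarrow> A u w = 0)"

text \<open>Entries between different weights can be set to 0 because \<open>b\<close> vanishes
  there. Since \<open>b\<close> is symmetric, the transpose is again a generalized inverse, and so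
  is the mean of the two.\<close>

lemma ginv_exists: "\<exists>A. ginv n A"
proof -
  obtain A0 where A0: "\<And>x y. \<lbrakk>x \<in> words n; y \<in> words n\<rbrakk> \<Longrightarrow>
      (\<Sum>u\<in>words n. \<Sum>w\<in>words n. b x u * A0 u w * b w y) = b x y"
    using generalized_inverse_exists[of "words n :: 'i list set" b] by auto
  define A1 where "A1 = (\<lambda>u w. if mset u = mset w then A0 u w else 0)"
  have A1: "(\<Sum>u\<in>words n. \<Sum>w\<in>words n. b x u * A1 u w * b w y) = b x y"
    if xy: "x \<in> words n" "y \<in> words n" for x y
  proof (cases "mset x = mset y")
    case True
    have "b x u * A1 u w * b w y = b x u * A0 u w * b w y" for u w
      using b_mset[of x u] b_mset[of w y] True by (cases "b x u = 0"; cases "b w y = 0") (auto simp: A1_def)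
    then show ?thesis using A0[OF xy] by (simp only:)
  next
    case False
    have z: "b x u * A1 u w * b w y = 0" for u w
      using b_mset[of x u] b_mset[of w y] False by (cases "b x u = 0"; cases "b w y = 0") (auto simp: A1_def)
    have "b x y = 0" using False b_mset by blast
    then show ?thesis by (simp add: z)
  qed
  have A1': "(\<Sum>u\<in>words n. \<Sum>w\<in>words n. b x u * A1 w u * b w y) = b x y"
    if xy: "x \<in> words n" "y \<in> words n" for x y
  proof -
    have "(\<Sum>u\<in>words n. \<Sum>w\<in>words n. b x u * A1 w u * b w y)
        = (\<Sum>w\<in>words n. \<Sum>u\<in>words n. b y w * A1 w u * b u x)"
      by (subst sum.swap) (simp add: b_sym ac_simps)
    also have "\<dots> = b y x" by (rule A1[OF xy(2,1)])
    finally show ?thesis by (simp add: b_sym)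
  qed
  have "ginv n (\<lambda>u w. (A1 u w + A1 w u) / 2)"
    unfolding ginv_def
  proof (intro conjI ballI allI impI)
    fix x y :: "'i list" assume xy: "x \<in> words n" "y \<in> words n"
    have "b x u * ((A1 u w + A1 w u) / 2) * b w y
        = (b x u * A1 u w * b w y + b x u * A1 w u * b w y) / 2" for u w
      by (simp add: field_simps)
    then show "(\<Sum>u\<in>words n. \<Sum>w\<in>words n. b x u * ((A1 u w + A1 w u) / 2) * b w y) = b x y"
      using A1[OF xy] A1'[OF xy] by (simp add: sum.distrib flip: sum_divide_distrib)
  next
    fix u w :: "'i list" assume "mset u \<noteq> mset w"
    then show "(A1 u w + A1 w u) / 2 = 0" by (auto simp: A1_def)
  qed (simp add: add.commute)
  then show ?thesis by blast
qed

definition gram_inv :: "nat \<Rightarrow> 'i list \<Rightarrow> 'i list \<Rightarrow> 'k" where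
  "gram_inv n = (SOME A. ginv n A)"

lemma gram_inv: "ginv n (gram_inv n)"
  unfolding gram_inv_def by (rule someI_ex[OF ginv_exists])

lemma gram_inv_sym: "gram_inv n u w = gram_inv n w u"
  using gram_inv by (auto simp: ginv_def)

lemma gram_inv_mset: "gram_inv n u w \<noteq> 0 \<Longrightarrow> mset u = mset w"
  using gram_inv[of n] by (auto simp: ginv_def)

lemma gram_inv_inverse:
  "\<lbrakk>length x = n; length y = n\<rbrakk> \<Longrightarrow>
    (\<Sum>u\<in>words n. \<Sum>w\<in>words n. b x u * gram_inv n u w * b w y) = b x y"
  using gram_inv[of n] by (auto simp: ginv_def)

lemma gram_inv_0: "gram_inv 0 [] [] = 1"
proof -
  have "words 0 = {[] :: 'i list}" by auto
  then show ?thesis using gram_inv_inverse[of "[]" 0 "[]"] by (simp add: b_Nil)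
qed

text \<open>Testing against words of length \<open>n\<close> suffices, as words of other lengths are
  orthogonal to these by \<open>b_mset\<close>.\<close>

definition rad :: "nat \<Rightarrow> ('i list \<Rightarrow> 'k) \<Rightarrow> bool" where
  "rad n x \<longleftrightarrow> (\<forall>z. length z = n \<longrightarrow> (\<Sum>u\<in>words n. x u * b u z) = 0)"

text \<open>The radical is graded by weight, so it is stable under scaling by a function of the
  weight.\<close>

lemma rad_times:
  assumes "rad n x" "\<And>u w. mset u = mset w \<Longrightarrow> t u = t w"
  shows "rad n (\<lambda>u. t u * x u)"
  unfolding rad_def
proof (intro allI impI)
  fix z :: "'i list" assume z: "length z = n"
  have "t u * x u * b u z = t z * (x u * b u z)" for u
    using assms(2)[of u z] b_mset[of u z] by (cases "b u z = 0") auto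
  then have "(\<Sum>u\<in>words n. t u * x u * b u z) = t z * (\<Sum>u\<in>words n. x u * b u z)"
    by (simp only: sum_distrib_left)
  then show "(\<Sum>u\<in>words n. t u * x u * b u z) = 0" using assms(1) z by (simp add: rad_def)
qed

text \<open>This is b A b = b read on words. It replaces the expansion of a vector in a pair of dual
  bases.\<close>

lemma rad_expand:
  assumes "length v = n"
  shows "rad n (\<lambda>u. (if u = v then 1 else 0) - (\<Sum>c\<in>words n. b v c * gram_inv n c u))"
  unfolding rad_def
proof (intro allI impI)
  fix z :: "'i list" assume z: "length z = n"
  have "(\<Sum>u\<in>words n. (\<Sum>c\<in>words n. b v c * gram_inv n c u) * b u z) = b v z"
    using gram_inv_inverse[OF assms z] by (subst (asm) sum.swap) (simp add: sum_distrib_right)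
  moreover have "(\<Sum>u\<in>words n. (if u = v then 1 else 0) * b u z) = b v z"
    using assms by (simp add: if_distrib[of "\<lambda>x. x * _"] cong: if_cong)
  ultimately show "(\<Sum>u\<in>words n. ((if u = v then 1 else 0) - (\<Sum>c\<in>words n. b v c * gram_inv n c u)) * b u z) = 0"
    by (simp add: left_diff_distrib sum_subtractf)
qed

end

section \<open>Modules over the algebra of raising and lowering operators\<close>

text \<open>One specialization of the module, with \<open>n i l\<close> for the pairing of the
  coroot i with l. The relations of f enter only through \<open>E_rad\<close> and
  \<open>F_rad\<close>; \<open>E_nil\<close> comes from category O and \<open>F_nil\<close> from
  integrability. In \<open>EF_raw\<close> the power of \<open>eps\<close> is the one contributed by
  the element J, not yet the one in the quantum integer.\<close>

locale qmod = qform q eps dt d p a b + vector_space scale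
  for q eps :: "'k::field_char_0" and dt :: "'i::finite \<Rightarrow> 'i \<Rightarrow> int"
    and d :: "'i \<Rightarrow> int" and p :: "'i \<Rightarrow> nat" and a :: "'i \<Rightarrow> 'i \<Rightarrow> int"
    and b :: "'i list \<Rightarrow> 'i list \<Rightarrow> 'k"
    and scale :: "'k \<Rightarrow> 'v::ab_group_add \<Rightarrow> 'v" (infixr \<open>*s\<close> 75) +
  fixes rt :: "'i \<Rightarrow> 'x::ab_group_add" and n :: "'i \<Rightarrow> 'x \<Rightarrow> int"
    and V :: "'x \<Rightarrow> 'v set" and E F :: "'i \<Rightarrow> 'v \<Rightarrow> 'v"
  assumes n_add: "n i (l + rt j) = n i l + a i j"
    and rt_inj: "(\<Sum>i\<leftarrow>u. rt i) = (\<Sum>i\<leftarrow>w. rt i) \<Longrightarrow> mset u = mset w"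
    and V_subspace: "subspace (V l)"
    and E_linear: "Vector_Spaces.linear scale scale (E i)"
    and F_linear: "Vector_Spaces.linear scale scale (F i)"
    and E_V: "m \<in> V l \<Longrightarrow> E i m \<in> V (l + rt i)"
    and F_V: "m \<in> V l \<Longrightarrow> F i m \<in> V (l - rt i)"
    and EF_raw: "m \<in> V l \<Longrightarrow> E i (F j m) = eps ^ (p i * p j) *s F j (E i m) +
      (if i = j then ((eps powi (d i * n i l) * q powi (d i * n i l) - q powi (- (d i * n i l))) /
         (ep i * q powi d i - q powi (- d i))) *s m else 0)"
    and E_rad: "\<lbrakk>m \<in> V l; rad N x\<rbrakk> \<Longrightarrow> (\<Sum>u\<in>words N. x u *s wact E u m) = 0"
    and F_rad: "\<lbrakk>m \<in> V l; rad N x\<rbrakk> \<Longrightarrow> (\<Sum>u\<in>words N. x u *s wact F u m) = 0"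
    and E_nil: "m \<in> V l \<Longrightarrow> \<exists>N. \<forall>w. N \<le> length w \<longrightarrow> wact E w m = 0"
    and F_nil: "m \<in> V l \<Longrightarrow> \<exists>N. (F i ^^ N) m = 0"
begin

abbreviation "Ew \<equiv> wact E"
abbreviation "Fw \<equiv> wact F"

definition rts :: "'i list \<Rightarrow> 'x" where "rts w = (\<Sum>i\<leftarrow>w. rt i)"

lemma rts_simps [simp]: "rts [] = 0" "rts (i # w) = rt i + rts w" "rts (u @ w) = rts u + rts w"
  by (simp_all add: rts_def)

lemma rts_mset: "mset u = mset w \<Longrightarrow> rts u = rts w"
  by (metis mset_map rts_def sum_mset_sum_list)

lemma n_sub: "n i (l - rt j) = n i l - a i j"
  using n_add[of i "l - rt j" j] by simp

lemma n_rts: "d i * n i (l + rts w) = d i * n i l + dw i w"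
  by (induction w arbitrary: l) (simp_all add: n_add dt_a distrib_left flip: add.assoc)

lemma n_sub_rts: "d i * n i (l - rts w) = d i * n i l - dw i w"
  using n_rts[of i "l - rts w" w] by simp

lemma linE [simp]: "E i (x + y) = E i x + E i y" "E i (c *s x) = c *s E i x" "E i 0 = 0"
    "E i (x - y) = E i x - E i y" "E i (sum g S) = (\<Sum>s\<in>S. E i (g s))"
proof -
  interpret Vector_Spaces.linear scale scale "E i" by (rule E_linear)
  show "E i (x + y) = E i x + E i y" "E i (c *s x) = c *s E i x" "E i 0 = 0"
    "E i (x - y) = E i x - E i y" "E i (sum g S) = (\<Sum>s\<in>S. E i (g s))"
    by (rule add scale zero diff sum)+
qed

lemma linF [simp]: "F i (x + y) = F i x + F i y" "F i (c *s x) = c *s F i x" "F i 0 = 0"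
    "F i (x - y) = F i x - F i y" "F i (sum g S) = (\<Sum>s\<in>S. F i (g s))"
proof -
  interpret Vector_Spaces.linear scale scale "F i" by (rule F_linear)
  show "F i (x + y) = F i x + F i y" "F i (c *s x) = c *s F i x" "F i 0 = 0"
    "F i (x - y) = F i x - F i y" "F i (sum g S) = (\<Sum>s\<in>S. F i (g s))"
    by (rule add scale zero diff sum)+
qed

lemma linEw [simp]: "Ew w (x + y) = Ew w x + Ew w y" "Ew w (c *s x) = c *s Ew w x"
    "Ew w 0 = 0" "Ew w (x - y) = Ew w x - Ew w y"
    "Ew w (sum g S) = (\<Sum>s\<in>S. Ew w (g s))"
  by (induction w) simp_all

lemma linFw [simp]: "Fw w (x + y) = Fw w x + Fw w y" "Fw w (c *s x) = c *s Fw w x"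
    "Fw w 0 = 0" "Fw w (x - y) = Fw w x - Fw w y"
    "Fw w (sum g S) = (\<Sum>s\<in>S. Fw w (g s))"
  by (induction w) simp_all

lemma V_closed [simp]: "x \<in> V l \<Longrightarrow> y \<in> V l \<Longrightarrow> x + y \<in> V l" "x \<in> V l \<Longrightarrow> y \<in> V l \<Longrightarrow> x - y \<in> V l"
  "x \<in> V l \<Longrightarrow> c *s x \<in> V l" "0 \<in> V l" "(\<And>s. s \<in> S \<Longrightarrow> g s \<in> V l) \<Longrightarrow> sum g S \<in> V l"
  by (simp_all add: subspace_add subspace_diff subspace_scale subspace_0 subspace_sum V_subspace)

lemma Ew_V: "m \<in> V l \<Longrightarrow> Ew w m \<in> V (l + rts w)"
proof (induction w)
  case (Cons i w)
  then show ?case using E_V[of "Ew w m" "l + rts w" i] by (simp add: ac_simps)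
qed simp

lemma Fw_V: "m \<in> V l \<Longrightarrow> Fw w m \<in> V (l - rts w)"
proof (induction w)
  case (Cons i w)
  then show ?case using F_V[of "Fw w m" "l - rts w" i] by (simp add: algebra_simps)
qed simp

lemma wact_replicate: "wact f (replicate t i) m = (f i ^^ t) m"
  by (induction t) simp_all

lemma F_pow_V: "m \<in> V l \<Longrightarrow> (F i ^^ t) m \<in> V (l - rts (replicate t i))"
  using Fw_V[of m l "replicate t i"] by (simp add: wact_replicate)

lemma E_pow_V: "m \<in> V l \<Longrightarrow> (E i ^^ t) m \<in> V (l + rts (replicate t i))"
  using Ew_V[of m l "replicate t i"] by (simp add: wact_replicate)

section \<open>Rank one\<close>

text \<open>This is \<open>eps\<close> to the power (d_i + p(i)) n, hence 1 if d_i and p(i) have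
  equal parity, the bar-consistent case. In general it depends only on the parity of n, so it is
  constant along an i-string.\<close>

definition bar_sign :: "'i \<Rightarrow> 'x \<Rightarrow> 'k" where
  "bar_sign i l = eps powi (d i * n i l) * ep i powi n i l"

lemma pm1_powi_even: "x * x = (1::'k) \<Longrightarrow> even z \<Longrightarrow> x powi z = 1"
  by (auto elim!: evenE simp: power_int_mult power2_eq_square)

lemma pm1_powi_cong: 
  assumes "x * x = (1::'k)" "even (z - z')" shows "x powi z = x powi z'"
proof -
  have "x \<noteq> 0" using assms by auto
  then have "x powi z = x powi (z - z') * x powi z'" by (simp flip: power_int_add)
  then show ?thesis using pm1_powi_even[OF assms] by simp
qed

lemma pm1_powi_sq: "x * x = (1::'k) \<Longrightarrow> x powi z * x powi z = 1"
  by (simp flip: power_int_mult_distrib)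

lemma sg2: "bar_sign i l * bar_sign i l = 1"
proof -
  have "bar_sign i l * bar_sign i l = (eps powi (d i * n i l) * eps powi (d i * n i l)) * (ep i powi n i l * ep i powi n i l)"
    by (simp add: bar_sign_def ac_simps)
  also have "\<dots> = 1"
    by (simp add: pm1_powi_sq eps2)
  finally show ?thesis .
qed

lemma dw_replicate: "dw i (replicate t i) = int t * (2 * d i)"
  by (induction t) (simp_all add: dt_diag algebra_simps)

lemma n_replicate: "n i (l - rts (replicate t i)) = n i l - 2 * int t" "n i (l + rts (replicate t i)) = n i l + 2 * int t"
proof -
  have "d i * n i (l - rts (replicate t i)) = d i * (n i l - 2 * int t)"
    by (simp add: n_sub_rts dw_replicate algebra_simps)
  then show "n i (l - rts (replicate t i)) = n i l - 2 * int t"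
    using d_pos[of i] by simp
  have "d i * n i (l + rts (replicate t i)) = d i * (n i l + 2 * int t)"
    by (simp add: n_rts dw_replicate algebra_simps)
  then show "n i (l + rts (replicate t i)) = n i l + 2 * int t"
    using d_pos[of i] by simp
qed

lemma bar_sign_even: "even (n i l - n i l') \<Longrightarrow> bar_sign i l = bar_sign i l'"
  unfolding bar_sign_def
  by (intro arg_cong2[where f = "(*)"] pm1_powi_cong) (auto simp: eps2 simp flip: right_diff_distrib)

text \<open>The quantum integer \<open>[n]\<^sub>i\<close> is \<open>(A1 i powi n - B1 i powi n) / (A1 i - B1 i)\<close>.\<close>

definition A1 :: "'i \<Rightarrow> 'k" where "A1 i = ep i * q powi d i"
definition B1 :: "'i \<Rightarrow> 'k" where "B1 i = q powi (- d i)"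

lemma AB: "A1 i * B1 i = ep i" "A1 i \<noteq> 0" "B1 i \<noteq> 0" "A1 i - B1 i \<noteq> 0"
proof -
  have "q powi d i * q powi (- d i) = 1" by (simp flip: power_int_add)
  then show "A1 i * B1 i = ep i" by (simp add: A1_def B1_def mult.assoc)
  show "A1 i - B1 i \<noteq> 0" using denom_nz[of i] by (simp only: A1_def B1_def not_False_eq_True)
qed (simp_all add: A1_def B1_def)

text \<open>Squaring kills \<open>s\<close> and the sign in \<open>A1\<close>; what remains is
  \<open>q\<close> to the power 4 d_i z.\<close>

lemma A1_B1_powi: "A1 i powi z = s * B1 i powi z \<Longrightarrow> s * s = 1 \<Longrightarrow> z = 0"
proof -
  assume h: "A1 i powi z = s * B1 i powi z" and s: "s * s = 1"
  define Z where "Z = d i * z"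
  have Z: "q powi Z = (q powi d i) powi z" "q powi (- Z) = (q powi (- d i)) powi z"
    by (simp_all add: Z_def flip: power_int_mult)
  have 1: "q powi Z * q powi Z = A1 i powi z * A1 i powi z"
  proof -
    have "A1 i powi z * A1 i powi z = (ep i powi z * ep i powi z) * (q powi Z * q powi Z)"
      unfolding A1_def power_int_mult_distrib Z by (simp only: ac_simps)
    also have "ep i powi z * ep i powi z = 1" by (simp add: pm1_powi_sq eps2)
    finally show ?thesis by simp
  qed
  have "A1 i powi z * A1 i powi z = (s * s) * (B1 i powi z * B1 i powi z)"
    unfolding h by (simp only: ac_simps)
  then have "q powi Z * q powi Z = q powi (- Z) * q powi (- Z)"
    unfolding 1 s by (simp add: B1_def Z)
  then have "q powi (2 * Z) = q powi (- 2 * Z)"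
    by (simp flip: power_int_add)
  then have "q powi (4 * Z) = 1"
    by (simp add: field_simps power_int_minus flip: power_int_add)
  then show "z = 0" using q_root[of "4 * Z"] d_pos[of i] by (simp add: Z_def)
qed

lemma powi_double: "(x::'k) powi (2 * int t) = x ^ t * x ^ t"
proof -
  have "2 * int t = int (t + t)" by simp
  then show ?thesis by (simp only: power_int_of_nat power_add)
qed

text \<open>\<open>Cf i l t\<close> is the coefficient of \<open>F\<^sub>i\<^sup>t\<^sup>-\<^sup>1\<close> in the commutator of \<open>E\<^sub>i\<close> and \<open>F\<^sub>i\<^sup>t\<close> on weight \<open>l\<close>.\<close>

fun Cf :: "'i \<Rightarrow> 'x \<Rightarrow> nat \<Rightarrow> 'k" where
  "Cf i l 0 = 0"
| "Cf i l (Suc t) = ep i * Cf i l t +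
    (bar_sign i l * A1 i powi (n i l - 2 * int t) - B1 i powi (n i l - 2 * int t)) / (A1 i - B1 i)"

text \<open>If \<open>bar_sign\<close> is 1, this says that \<open>Cf i l t\<close> is ep_i^(t-1)
  [t]_i [n+1-t]_i, the usual rank one formula. Cleared of denominators it is an identity in A, B, x
  = A^t and y = B^t, where (A B)^2 = (x y)^2 = 1.\<close>

lemma Cf_closed:
  "Cf i l t * ((A1 i - B1 i) * (A1 i - B1 i)) * (A1 i * B1 i) =
    (A1 i * B1 i) ^ t * (A1 i ^ t - B1 i ^ t) *
      (bar_sign i l * A1 i powi (n i l + 1 - int t) - B1 i powi (n i l + 1 - int t))"
proof (induction t)
  case 0
  then show ?case by simp
next
  case (Suc t)
  define A where "A = A1 i"
  define B where "B = B1 i"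
  define x where "x = A ^ t"
  define y where "y = B ^ t"
  define U where "U = A powi n i l"
  define W where "W = B powi n i l"
  have nz: "A \<noteq> 0" "B \<noteq> 0" "x \<noteq> 0" "y \<noteq> 0" "A - B \<noteq> 0"
    using AB[of i] by (auto simp: A_def B_def x_def y_def)
  have AB2: "(A * B) * (A * B) = 1" and epAB: "ep i = A * B" by (simp_all add: A_def B_def AB)
  have "(x * y) * (x * y) = ((A * B) * (A * B)) ^ t"
    by (simp only: x_def y_def power_mult_distrib ac_simps)
  then have xy2: "(x * y) * (x * y) = 1" by (simp only: AB2 power_one)
  \<comment> \<open>As (x y)^2 = 1, the factor A^(-2t) may be written y^2; the same trick with x^2
    serves for B.\<close>
  have pA: "A powi (n i l - 2 * int t) = U * y * y"
  proof -
    have "A powi (n i l - 2 * int t) = U / (x * x)"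
      using nz by (simp add: U_def x_def power_int_diff powi_double)
    also have "\<dots> = U * y * y" using xy2 nz by (simp add: field_simps)
    finally show ?thesis .
  qed
  have pB: "B powi (n i l - 2 * int t) = W * x * x"
  proof -
    have "B powi (n i l - 2 * int t) = W / (y * y)"
      using nz by (simp add: W_def y_def power_int_diff powi_double)
    also have "\<dots> = W * x * x" using xy2 nz by (simp add: field_simps)
    finally show ?thesis .
  qed
  have q1: "A powi (n i l + 1 - int t) = U * A / x" "B powi (n i l + 1 - int t) = W * B / y"
    using nz by (simp_all add: U_def W_def x_def y_def power_int_diff power_int_add)
  have q2: "n i l + 1 - int (Suc t) = n i l - int t" "A powi (n i l - int t) = U / x"
    "B powi (n i l - int t) = W / y"
    using nz by (simp_all add: U_def W_def x_def y_def power_int_diff)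
  have ABt: "(A * B) ^ t = x * y" by (simp add: x_def y_def power_mult_distrib)
  have IH: "Cf i l t * ((A - B) * (A - B)) * (A * B) = x * y * (x - y) * (bar_sign i l * (U * A / x) - W * B / y)"
    using Suc[folded A_def B_def] by (simp only: q1 ABt flip: x_def y_def)
  have CS: "Cf i l (Suc t) = (A * B) * Cf i l t + (bar_sign i l * (U * y * y) - W * x * x) / (A - B)"
    by (simp only: Cf.simps pA pB epAB flip: A_def B_def)
  have "Cf i l (Suc t) * ((A - B) * (A - B)) * (A * B)
      = (A * B) * (Cf i l t * ((A - B) * (A - B)) * (A * B)) +
        (bar_sign i l * (U * y * y) - W * x * x) * (A - B) * (A * B)"
    using nz unfolding CS by (simp add: field_simps)
  also have "\<dots> = (A * B) * (x * y * (x - y) * (bar_sign i l * (U * A / x) - W * B / y) +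
        (bar_sign i l * (U * y * y) - W * x * x) * (A - B))"
    unfolding IH by (simp add: algebra_simps)
  also have "\<dots> = (A * B) * (x * y) * (A * x - B * y) * (bar_sign i l * (U / x) - W / y)"
    using nz by (simp add: field_simps)
  finally show ?case
    by (simp only: q2 power_Suc ABt flip: A_def B_def x_def y_def)
qed

text \<open>The factor A^t - B^t does not vanish, so the last factor of \<open>Cf_closed\<close>
  does. Comparing powers of \<open>q\<close> makes its exponent 0, and the equation that is left
  says that the sign is 1.\<close>

lemma Cf_0_imp:
  assumes "Cf i l t = 0" "t > 0"
  shows "bar_sign i l = 1 \<and> n i l + 1 = int t"
proof -
  have "A1 i ^ t \<noteq> B1 i ^ t"
    using A1_B1_powi[where i = i and z = "int t" and s = 1] assms(2) by auto
  then have h: "bar_sign i l * A1 i powi (n i l + 1 - int t) = B1 i powi (n i l + 1 - int t)"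
    using Cf_closed[of i l t] assms(1) AB by auto
  then have "bar_sign i l * (bar_sign i l * A1 i powi (n i l + 1 - int t)) = bar_sign i l * B1 i powi (n i l + 1 - int t)"
    by simp
  then have "A1 i powi (n i l + 1 - int t) = bar_sign i l * B1 i powi (n i l + 1 - int t)"
    by (simp add: sg2 flip: mult.assoc)
  from A1_B1_powi[OF this sg2] have "n i l + 1 - int t = 0" .
  with h show ?thesis by simp
qed

lemma EF_raw_same:
  assumes "m \<in> V l"
  shows "E i (F i m) = ep i *s F i (E i m) +
    ((bar_sign i l * A1 i powi n i l - B1 i powi n i l) / (A1 i - B1 i)) *s m"
proof -
  have "eps powi (d i * n i l) * q powi (d i * n i l) = bar_sign i l * A1 i powi n i l"
  proof -
    have "ep i powi n i l * ep i powi n i l = 1" by (simp add: pm1_powi_sq eps2)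
    then show ?thesis
      by (simp add: bar_sign_def A1_def power_int_mult_distrib ac_simps flip: power_int_mult)
  qed
  moreover have "q powi (- (d i * n i l)) = B1 i powi n i l"
    by (simp add: B1_def flip: power_int_mult)
  moreover have "eps ^ (p i * p i) = ep i" using p01[of i] by (auto simp: ep_def)
  ultimately show ?thesis using EF_raw[OF assms, of i i] by (simp add: A1_def B1_def)
qed

lemma EF_pow:
  assumes "m \<in> V l"
  shows "E i ((F i ^^ t) m) = ep i ^ t *s (F i ^^ t) (E i m) + Cf i l t *s (F i ^^ (t - 1)) m"
proof (induction t)
  case 0
  then show ?case by simp
next
  case (Suc t)
  have bar_sign: "bar_sign i (l - rts (replicate t i)) = bar_sign i l"
    by (intro bar_sign_even) (simp add: n_replicate)
  have "E i ((F i ^^ Suc t) m) = ep i *s F i (E i ((F i ^^ t) m)) +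
    ((bar_sign i l * A1 i powi (n i l - 2 * int t) - B1 i powi (n i l - 2 * int t)) / (A1 i - B1 i)) *s (F i ^^ t) m"
    using EF_raw_same[OF F_pow_V[OF assms, where i = i and t = t], of i] by (simp only: bar_sign n_replicate funpow.simps o_apply)
  also have "F i (E i ((F i ^^ t) m)) = ep i ^ t *s (F i ^^ Suc t) (E i m) + Cf i l t *s (F i ^^ t) m"
    unfolding Suc by (cases t) simp_all
  finally show ?case by (simp add: scale_right_distrib scale_left_distrib)
qed

text \<open>The rank one argument for a primitive vector in an integrable module, relative to a
  stable family \<open>S\<close>: \<open>m\<close> is primitive only modulo \<open>S\<close>. It is
  applied with \<open>S\<close> zero and with the submodule generated by all primitive
  vectors.\<close>

lemma string_dominant:
  assumes "m \<in> V l" "m \<notin> S l" "E i m \<in> S (l + rt i)" "\<And>l. subspace (S l)"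
    and SE: "\<And>x l. x \<in> S l \<Longrightarrow> E i x \<in> S (l + rt i)" and SF: "\<And>x l. x \<in> S l \<Longrightarrow> F i x \<in> S (l - rt i)"
  shows "bar_sign i l = 1 \<and> n i l \<ge> 0"
proof -
  define r where "r = (\<lambda>t. rts (replicate t i))"
  have rS: "r (Suc t) = rt i + r t" for t by (simp add: r_def)
  obtain N where "(F i ^^ N) m = 0" using F_nil[OF assms(1)] by blast
  then have ex: "\<exists>N. (F i ^^ N) m \<in> S (l - r N)" using subspace_0[OF assms(4)] by metis
  \<comment> \<open>For the least power moving \<open>m\<close> into \<open>S\<close>, applying E_i
    produces \<open>Cf i l t\<close> times the previous power, which is not in \<open>S\<close>;
    hence the coefficient is 0.\<close>
  define t where "t = (LEAST N. (F i ^^ N) m \<in> S (l - r N))"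
  have t: "(F i ^^ t) m \<in> S (l - r t)" unfolding t_def by (rule LeastI_ex[OF ex])
  have "t \<noteq> 0"
  proof
    assume "t = 0"
    then show False using t assms(2) by (simp add: r_def)
  qed
  then obtain t0 where t0: "t = Suc t0" by (cases t) auto
  have t': "(F i ^^ t0) m \<notin> S (l - r t0)"
    using not_less_Least[of t0 "\<lambda>N. (F i ^^ N) m \<in> S (l - r N)"] t0 by (simp flip: t_def)
  have pow: "(F i ^^ s) x \<in> S (l - r s)" if "x \<in> S l" for s x l
  proof (induction s)
    case (Suc s)
    then show ?case using SF[OF Suc] by (simp add: rS algebra_simps)
  qed (simp add: r_def that)
  have "E i ((F i ^^ t) m) \<in> S (l - r t0)"
    using SE[OF t] by (simp add: t0 rS algebra_simps)
  moreover have "(F i ^^ t) (E i m) \<in> S (l - r t0)"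
    using pow[OF assms(3), of t] by (simp add: t0 rS)
  ultimately have "E i ((F i ^^ t) m) - ep i ^ t *s (F i ^^ t) (E i m) \<in> S (l - r t0)"
    using assms(4) by (blast intro: subspace_diff subspace_scale)
  then have C: "Cf i l t *s (F i ^^ t0) m \<in> S (l - r t0)"
    unfolding EF_pow[OF assms(1)] by (simp add: t0)
  have "Cf i l t = 0"
  proof (rule ccontr)
    assume "Cf i l t \<noteq> 0"
    then have "(F i ^^ t0) m = inverse (Cf i l t) *s (Cf i l t *s (F i ^^ t0) m)" by simp
    then show False using t' C assms(4) subspace_scale by metis
  qed
  then have "bar_sign i l = 1 \<and> n i l + 1 = int t" using Cf_0_imp t0 by blast
  then show ?thesis using t0 by simp
qed

text \<open>Without bar-consistency the two signs may differ; integrability forces them to agree on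
  every nonzero weight space.\<close>

lemma bar_sign_1:
  assumes "m \<in> V l" "m \<noteq> 0"
  shows "bar_sign i l = 1"
proof -
  obtain N where N: "\<And>w. N \<le> length w \<Longrightarrow> Ew w m = 0" using E_nil[OF assms(1)] by blast
  have "(E i ^^ N) m = 0" using N[of "replicate N i"] by (simp add: wact_replicate)
  then have ex: "\<exists>t. (E i ^^ t) m = 0" ..
  \<comment> \<open>The last nonzero vector of the string is killed by E_i, so the sign at its
    weight is 1; it is the same at \<open>l\<close> because n changes in steps of 2.\<close>
  define t where "t = (LEAST t. (E i ^^ t) m = 0)"
  have t: "(E i ^^ t) m = 0" unfolding t_def by (rule LeastI_ex[OF ex])
  then obtain t0 where t0: "t = Suc t0" using assms(2) by (cases t) auto
  have t': "(E i ^^ t0) m \<noteq> 0"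
    using not_less_Least[of t0 "\<lambda>N. (E i ^^ N) m = 0"] t0 by (simp flip: t_def)
  have "bar_sign i (l + rts (replicate t0 i)) = 1 \<and> n i (l + rts (replicate t0 i)) \<ge> 0"
    using t' t t0 by (intro string_dominant[OF E_pow_V[OF assms(1)], where S = "\<lambda>_. {0}"]) auto
  moreover have "bar_sign i (l + rts (replicate t0 i)) = bar_sign i l"
    by (intro bar_sign_even) (simp add: n_replicate)
  ultimately show ?thesis by simp
qed

section \<open>Commutation formulas\<close>

definition den :: "'i \<Rightarrow> 'k" where "den j = ep j * q powi d j - q powi (- d j)"
text \<open>The contributions of K and of its inverse to the commutator of E_j and F_j. They are
  kept apart because a weight shift scales them by opposite powers of \<open>q\<close>, which is
  what produces two different skew derivations.\<close>

definition kp :: "'i \<Rightarrow> 'x \<Rightarrow> 'k" where "kp j l = ep j powi n j l * q powi (d j * n j l) / den j"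
definition km :: "'i \<Rightarrow> 'x \<Rightarrow> 'k" where "km j l = q powi (- (d j * n j l)) / den j"

lemma EF:
  assumes "m \<in> V l"
  shows "E i (F j m) = eps ^ (p i * p j) *s F j (E i m) + (if i = j then (kp i l - km i l) *s m else 0)"
proof (cases "m = 0")
  case False
  have "eps powi (d i * n i l) = ep i powi n i l"
  proof -
    have "eps powi (d i * n i l) * (ep i powi n i l * ep i powi n i l) = ep i powi n i l"
      using bar_sign_1[OF assms False, of i] by (simp add: bar_sign_def flip: mult.assoc)
    then show ?thesis by (simp add: pm1_powi_sq)
  qed
  then show ?thesis
    using EF_raw[OF assms, of i j] by (cases "i = j") (simp_all add: kp_def km_def den_def diff_divide_distrib)
qed simp

text \<open>For odd j the integers a_ji are even, so this sign does not change along the root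
  lattice.\<close>

lemma ep_n: "ep j powi n j (l + rt i) = ep j powi n j l"
proof (cases "p j = 0")
  case True
  then show ?thesis by (simp add: ep_def)
next
  case False
  then have "p j = 1" using p01[of j] by simp
  then show ?thesis using a_even[of j i] by (intro pm1_powi_cong) (auto simp: n_add)
qed

lemma ep_n_rts: "ep j powi n j (l + rts w) = ep j powi n j l"
  by (induction w arbitrary: l) (simp_all add: ep_n flip: add.assoc)

lemma ep_n_sub_rts: "ep j powi n j (l - rts w) = ep j powi n j l"
  using ep_n_rts[of j "l - rts w" w] by simp

lemma kp_rts: "kp j (l + rts w) = kp j l * q powi dw j w" "kp j (l - rts w) = kp j l * q powi (- dw j w)"
  by (simp_all add: kp_def ep_n_rts ep_n_sub_rts n_rts n_sub_rts power_int_add power_int_diff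
      power_int_minus field_simps)

lemma km_rts: "km j (l + rts w) = km j l * q powi (- dw j w)" "km j (l - rts w) = km j l * q powi dw j w"
  by (simp_all add: km_def n_rts n_sub_rts power_int_add power_int_diff power_int_minus field_simps)

text \<open>The linear extension of \<open>g\<close> evaluated at the left skew derivation of the
  word \<open>u\<close>; \<open>Rsum\<close> does the same for the right one.\<close>

definition Lsum :: "'i \<Rightarrow> 'i list \<Rightarrow> ('i list \<Rightarrow> 'v) \<Rightarrow> 'v" where
  "Lsum j u g = (\<Sum>k<length u. Lcf j u k *s g (del k u))"
definition Rsum :: "'i \<Rightarrow> 'i list \<Rightarrow> ('i list \<Rightarrow> 'v) \<Rightarrow> 'v" where
  "Rsum j u g = (\<Sum>k<length u. Rcf j u k *s g (del k u))"

lemma chi_Cons: "chi j (i # w) = q powi dt j i * eps ^ (p j * p i) * chi j w"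
  by (simp add: chi_def power_int_add distrib_left power_add)

lemma chi_Nil [simp]: "chi j [] = 1"
  by (simp add: chi_def)

lemma Lsum_Nil [simp]: "Lsum j [] g = 0" and Rsum_Nil [simp]: "Rsum j [] g = 0"
  by (simp_all add: Lsum_def Rsum_def)

lemma Lsum_Cons: "Lsum j (i # u) g = (if i = j then g u else 0) +
    (q powi dt j i * eps ^ (p j * p i)) *s Lsum j u (\<lambda>z. g (i # z))"
proof -
  have "Lcf j (i # u) (Suc k) = q powi dt j i * eps ^ (p j * p i) * Lcf j u k" for k
    by (simp add: Lcf_def chi_Cons)
  then show ?thesis
    by (simp add: Lsum_def sum.lessThan_Suc_shift scale_sum_right del: sum.lessThan_Suc)
      (simp add: Lcf_def)
qed

lemma Rsum_Cons: "Rsum j (i # u) g = (if i = j then chi j u *s g u else 0) + Rsum j u (\<lambda>z. g (i # z))"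
proof -
  have "Rcf j (i # u) (Suc k) = Rcf j u k" for k
    by (simp add: Rcf_def)
  then show ?thesis
    by (simp add: Rsum_def sum.lessThan_Suc_shift del: sum.lessThan_Suc) (simp add: Rcf_def)
qed

lemma Lsum_lin: "E i (Lsum j u g) = Lsum j u (\<lambda>z. E i (g z))" "F i (Lsum j u g) = Lsum j u (\<lambda>z. F i (g z))"
    "Fw v (Lsum j u g) = Lsum j u (\<lambda>z. Fw v (g z))" "c *s Lsum j u g = Lsum j u (\<lambda>z. c *s g z)"
  by (simp_all add: Lsum_def scale_sum_right mult.commute)

lemma Rsum_lin: "E i (Rsum j u g) = Rsum j u (\<lambda>z. E i (g z))" "F i (Rsum j u g) = Rsum j u (\<lambda>z. F i (g z))"
    "Fw v (Rsum j u g) = Rsum j u (\<lambda>z. Fw v (g z))" "c *s Rsum j u g = Rsum j u (\<lambda>z. c *s g z)"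
  by (simp_all add: Rsum_def scale_sum_right mult.commute)

text \<open>At each letter j of \<open>u\<close> the commutator yields a power of \<open>q\<close>
  from the letters to its right and a sign from the letters to its left. Rewritten relative to the
  whole word, the K part becomes the left derivation and the part with inverse K the right
  one.\<close>

lemma E_Fw:
  assumes "m \<in> V l"
  shows "E j (Fw u m) = eps ^ (p j * pw u) *s Fw u (E j m) +
    (kp j l * q powi (dt j j - dw j u)) *s Lsum j u (\<lambda>z. Fw z m) -
    (km j l * eps ^ (p j * (pw u + p j))) *s Rsum j u (\<lambda>z. Fw z m)"
proof (induction u)
  case Nil
  then show ?case by simp
next
  case (Cons i u)
  let ?y = "Fw u m"
  have y: "?y \<in> V (l - rts u)" by (rule Fw_V[OF assms])
  let ?L = "Lsum j u (\<lambda>z. Fw (i # z) m)" and ?R = "Rsum j u (\<lambda>z. Fw (i # z) m)"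
  have 1: "F i (E j ?y) = eps ^ (p j * pw u) *s Fw (i # u) (E j m) +
      (kp j l * q powi (dt j j - dw j u)) *s ?L - (km j l * eps ^ (p j * (pw u + p j))) *s ?R"
    unfolding Cons by (simp add: Lsum_lin(2) Rsum_lin(2))
  have c1: "eps ^ (p j * p i) * eps ^ (p j * pw u) = eps ^ (p j * pw (i # u))"
    by (simp add: power_add distrib_left)
  have c2: "eps ^ (p j * p i) * (kp j l * q powi (dt j j - dw j u)) =
      kp j l * q powi (dt j j - dw j (i # u)) * (q powi dt j i * eps ^ (p j * p i))"
    by (simp add: power_int_diff power_int_add field_simps)
  have c3: "eps ^ (p j * p i) * (km j l * eps ^ (p j * (pw u + p j))) = km j l * eps ^ (p j * (pw (i # u) + p j))"
    by (simp add: power_add distrib_left)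
  have c4: "kp j (l - rts u) = kp j l * q powi (dt j j - dw j (i # u))" if "i = j"
    using that by (simp add: kp_rts)
  have c5: "km j (l - rts u) = km j l * eps ^ (p j * (pw (i # u) + p j)) * chi j u" if "i = j"
  proof -
    have "eps ^ (p j * (p j + pw u + p j)) * eps ^ (p j * pw u) = eps ^ (N + N)"
      if "N = p j * (p j + pw u)" for N
      unfolding that by (simp add: algebra_simps flip: power_add)
    then show ?thesis using that by (simp add: km_rts chi_def mult.left_commute)
  qed
  have "E j (Fw (i # u) m) = eps ^ (p j * p i) *s F i (E j ?y) +
      (if j = i then kp j (l - rts u) *s ?y - km j (l - rts u) *s ?y else 0)"
    using EF[OF y, of j i] by (simp add: scale_left_diff_distrib)
  also have "\<dots> = (eps ^ (p j * p i) * eps ^ (p j * pw u)) *s Fw (i # u) (E j m) +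
      (eps ^ (p j * p i) * (kp j l * q powi (dt j j - dw j u))) *s ?L -
      (eps ^ (p j * p i) * (km j l * eps ^ (p j * (pw u + p j)))) *s ?R +
      (if j = i then kp j (l - rts u) *s ?y - km j (l - rts u) *s ?y else 0)"
    unfolding 1 by (simp only: scale_right_distrib scale_right_diff_distrib scale_scale)
  finally show ?case
    unfolding c1 c2 c3 Lsum_Cons Rsum_Cons
    using c4 c5 by (cases "i = j") (simp_all add: scale_right_distrib)
qed

text \<open>Mirror image of \<open>E_Fw\<close>: F_j enters from the right, so the two derivations
  exchange their roles.\<close>

lemma Ew_F:
  assumes "m \<in> V l"
  shows "Ew w (F j m) = eps ^ (p j * pw w) *s F j (Ew w m) +
    kp j l *s Rsum j w (\<lambda>z. Ew z m) -
    (km j l * eps ^ (p j * (pw w + p j)) * q powi (dt j j - dw j w)) *s Lsum j w (\<lambda>z. Ew z m)"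
proof (induction w)
  case Nil
  then show ?case by simp
next
  case (Cons i w)
  let ?y = "Ew w m"
  have y: "?y \<in> V (l + rts w)" by (rule Ew_V[OF assms])
  let ?L = "Lsum j w (\<lambda>z. Ew (i # z) m)" and ?R = "Rsum j w (\<lambda>z. Ew (i # z) m)"
  have 1: "E i (Ew w (F j m)) = eps ^ (p j * pw w) *s E i (F j ?y) + kp j l *s ?R -
      (km j l * eps ^ (p j * (pw w + p j)) * q powi (dt j j - dw j w)) *s ?L"
    unfolding Cons by (simp add: Lsum_lin(1) Rsum_lin(1))
  have 2: "E i (F j ?y) = eps ^ (p j * p i) *s F j (E i ?y) +
      (if i = j then kp j (l + rts w) *s ?y - km j (l + rts w) *s ?y else 0)"
    using EF[OF y, of i j] by (simp add: scale_left_diff_distrib mult.commute)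
  have c1: "eps ^ (p j * pw w) * eps ^ (p j * p i) = eps ^ (p j * pw (i # w))"
    by (simp add: power_add distrib_left)
  have c2: "km j l * eps ^ (p j * (pw w + p j)) * q powi (dt j j - dw j w) =
      km j l * eps ^ (p j * (pw (i # w) + p j)) * q powi (dt j j - dw j (i # w)) * (q powi dt j i * eps ^ (p j * p i))"
  proof -
    have "eps ^ (p j * (p i + pw w + p j)) * eps ^ (p j * p i) = eps ^ (p j * (pw w + p j)) * eps ^ (p j * p i + p j * p i)"
      by (simp only: power_add distrib_left ac_simps)
    then have "eps ^ (p j * (p i + pw w + p j)) * eps ^ (p j * p i) = eps ^ (p j * (pw w + p j))"
      by (simp only: eps_pow_even mult_1_right)
    then show ?thesis by (simp add: power_int_diff power_int_add field_simps)
  qed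
  have c4: "eps ^ (p j * pw w) * kp j (l + rts w) = kp j l * chi j w"
    by (simp add: kp_rts chi_def)
  have c5: "eps ^ (p j * pw w) * km j (l + rts w) =
      km j l * eps ^ (p j * (pw (i # w) + p j)) * q powi (dt j j - dw j (i # w))" if "i = j"
  proof -
    have "eps ^ (p j * (p j + pw w + p j)) = eps ^ (p j * pw w) * eps ^ (p j * p j + p j * p j)"
      by (simp only: power_add distrib_left ac_simps)
    then show ?thesis using that by (simp add: km_rts)
  qed
  have "Ew (i # w) (F j m) = (eps ^ (p j * pw w) * eps ^ (p j * p i)) *s F j (E i ?y) +
      (if i = j then (eps ^ (p j * pw w) * kp j (l + rts w)) *s ?y - (eps ^ (p j * pw w) * km j (l + rts w)) *s ?y else 0) +
      kp j l *s ?R - (km j l * eps ^ (p j * (pw w + p j)) * q powi (dt j j - dw j w)) *s ?L"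
    unfolding wact.simps 1 2 by (simp add: scale_right_distrib scale_right_diff_distrib)
  then show ?case
    unfolding c1 c2 c4 Lsum_Cons Rsum_Cons
    using c5 by (cases "i = j") (simp_all add: scale_right_distrib)
qed

section \<open>The trace of a bilinear map with respect to the form\<close>

text \<open>\<open>tr N\<close> evaluates a bilinear map at the canonical element of the form in degree \<open>N\<close>; \<open>compat\<close> says
  that the map vanishes on the radical in its first argument.\<close>

definition tr :: "nat \<Rightarrow> ('i list \<Rightarrow> 'i list \<Rightarrow> 'v) \<Rightarrow> 'v" where
  "tr N \<Psi> = (\<Sum>u\<in>words N. \<Sum>w\<in>words N. gram_inv N u w *s \<Psi> u w)"

definition compat :: "nat \<Rightarrow> ('i list \<Rightarrow> 'i list \<Rightarrow> 'v) \<Rightarrow> bool" where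
  "compat N \<Psi> \<longleftrightarrow> (\<forall>x w. rad N x \<longrightarrow> (\<Sum>u\<in>words N. x u *s \<Psi> u w) = 0)"

lemma tr_swap: "tr N \<Psi> = tr N (\<lambda>u w. \<Psi> w u)"
  unfolding tr_def by (subst sum.swap) (simp add: gram_inv_sym)

lemma tr_cong:
  assumes "\<And>u w. \<lbrakk>length u = N; length w = N; mset u = mset w\<rbrakk> \<Longrightarrow> \<Psi> u w = \<Phi> u w"
  shows "tr N \<Psi> = tr N \<Phi>"
  unfolding tr_def
proof (intro sum.cong refl)
  fix u w :: "'i list" assume "u \<in> words N" "w \<in> words N"
  then show "gram_inv N u w *s \<Psi> u w = gram_inv N u w *s \<Phi> u w"
    using assms[of u w] gram_inv_mset[of N u w] by (cases "gram_inv N u w = 0") auto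
qed

lemma tr_add: "tr N (\<lambda>u w. \<Psi> u w + \<Phi> u w) = tr N \<Psi> + tr N \<Phi>"
  by (simp add: tr_def scale_right_distrib sum.distrib)

lemma tr_diff: "tr N (\<lambda>u w. \<Psi> u w - \<Phi> u w) = tr N \<Psi> - tr N \<Phi>"
  by (simp add: tr_def scale_right_diff_distrib sum_subtractf)

lemma tr_scale: "tr N (\<lambda>u w. c *s \<Psi> u w) = c *s tr N \<Psi>"
  by (simp add: tr_def scale_sum_right mult.commute)

lemma tr_minus: "tr N (\<lambda>u w. - \<Psi> u w) = - tr N \<Psi>"
  by (simp add: tr_def sum_negf)

lemma tr_E: "tr N (\<lambda>u w. E j (\<Psi> u w)) = E j (tr N \<Psi>)"
  by (simp add: tr_def)

lemma tr_F: "tr N (\<lambda>u w. F j (\<Psi> u w)) = F j (tr N \<Psi>)"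
  by (simp add: tr_def)

lemma tr_zero: "(\<And>u w. length w = N \<Longrightarrow> \<Psi> u w = 0) \<Longrightarrow> tr N \<Psi> = 0"
  by (simp add: tr_def)

text \<open>A map that kills the radical does not distinguish \<open>v\<close> from its expansion in
  \<open>rad_expand\<close>.\<close>

lemma compat_expand:
  assumes "compat N \<Psi>" "length v = N"
  shows "\<Psi> v w = (\<Sum>u\<in>words N. (\<Sum>c\<in>words N. b v c * gram_inv N c u) *s \<Psi> u w)"
proof -
  have "(\<Sum>u\<in>words N. ((if u = v then 1 else 0) - (\<Sum>c\<in>words N. b v c * gram_inv N c u)) *s \<Psi> u w) = 0"
    using assms(1) rad_expand[OF assms(2)] unfolding compat_def by blast
  moreover have "(\<Sum>u\<in>words N. (if u = v then 1 else 0) *s \<Psi> u w) = \<Psi> v w"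
    using assms(2) by (simp add: if_distrib[of "\<lambda>x. x *s _"] cong: if_cong)
  ultimately show ?thesis by (simp add: scale_left_diff_distrib sum_subtractf)
qed

text \<open>The adjointness of deleting and appending a letter, transported to the canonical element.\<close>

lemma tr_del:
  assumes 1: "compat N \<Psi>" and 2: "compat (Suc N) (\<lambda>w u. \<Psi> u w)"
    and ext: "\<And>u c. \<lbrakk>length u = Suc N; length c = N\<rbrakk> \<Longrightarrow>
      b u (ext c) = cc j * (\<Sum>k<length u. cf u k * b (del k u) c)"
    and len: "\<And>c. length c = N \<Longrightarrow> length (ext c) = Suc N"
  shows "tr (Suc N) (\<lambda>u w. \<Sum>k<length u. cf u k *s \<Psi> (del k u) w) =
    inverse (cc j) *s tr N (\<lambda>u w. \<Psi> u (ext w))"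
proof -
  let ?W = "words N :: 'i list set" and ?W' = "words (Suc N) :: 'i list set"
  let ?c = "inverse (cc j)"
  \<comment> \<open>Expanding the shortened word collects the sum over k into the right-hand side of
    the adjointness \<open>ext\<close>.\<close>
  have A: "(\<Sum>k<length u. cf u k *s \<Psi> (del k u) w) =
      (\<Sum>z\<in>?W. \<Sum>c\<in>?W. (?c * b u (ext c) * gram_inv N c z) *s \<Psi> z w)" if u: "u \<in> ?W'" for u w
  proof -
    have "(\<Sum>k<length u. cf u k *s \<Psi> (del k u) w) =
        (\<Sum>k<length u. \<Sum>z\<in>?W. \<Sum>c\<in>?W. (cf u k * b (del k u) c * gram_inv N c z) *s \<Psi> z w)"
    proof (intro sum.cong refl)
      fix k assume "k \<in> {..<length u}"
      then have "length (del k u) = N" using u by simp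
      from compat_expand[OF 1 this, of w]
      show "cf u k *s \<Psi> (del k u) w = (\<Sum>z\<in>?W. \<Sum>c\<in>?W. (cf u k * b (del k u) c * gram_inv N c z) *s \<Psi> z w)"
        by (simp add: scale_sum_right scale_sum_left mult.assoc)
    qed
    also have "\<dots> = (\<Sum>z\<in>?W. \<Sum>c\<in>?W. \<Sum>k<length u. (cf u k * b (del k u) c * gram_inv N c z) *s \<Psi> z w)"
      by (subst sum.swap, rule sum.cong[OF refl], subst sum.swap, rule refl)
    also have "\<dots> = (\<Sum>z\<in>?W. \<Sum>c\<in>?W. ((\<Sum>k<length u. cf u k * b (del k u) c) * gram_inv N c z) *s \<Psi> z w)"
      by (simp only: scale_sum_left sum_distrib_right)
    also have "\<dots> = (\<Sum>z\<in>?W. \<Sum>c\<in>?W. (?c * b u (ext c) * gram_inv N c z) *s \<Psi> z w)"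
      using u by (intro sum.cong refl) (simp add: ext)
    finally show ?thesis .
  qed
  \<comment> \<open>The expansion of the lengthened word in the second argument, read backwards; it
    absorbs the matrix in degree \<open>Suc N\<close>.\<close>
  have B: "(\<Sum>u\<in>?W'. \<Sum>w\<in>?W'. (b u (ext c) * gram_inv (Suc N) u w) *s \<Psi> z w) = \<Psi> z (ext c)" if "c \<in> ?W" for z c
  proof -
    have "\<Psi> z (ext c) = (\<Sum>w\<in>?W'. (\<Sum>u\<in>?W'. b (ext c) u * gram_inv (Suc N) u w) *s \<Psi> z w)"
      using that compat_expand[OF 2 len] by simp
    also have "\<dots> = (\<Sum>u\<in>?W'. \<Sum>w\<in>?W'. (b u (ext c) * gram_inv (Suc N) u w) *s \<Psi> z w)"
      by (subst sum.swap) (simp only: scale_sum_left b_sym[of "ext c"])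
    finally show ?thesis by (rule sym)
  qed
  have "tr (Suc N) (\<lambda>u w. \<Sum>k<length u. cf u k *s \<Psi> (del k u) w) =
      (\<Sum>u\<in>?W'. \<Sum>w\<in>?W'. \<Sum>z\<in>?W. \<Sum>c\<in>?W. (?c * gram_inv N c z) *s (b u (ext c) * gram_inv (Suc N) u w) *s \<Psi> z w)"
    unfolding tr_def
  proof (intro sum.cong refl)
    fix u w assume u: "u \<in> ?W'" 
    show "gram_inv (Suc N) u w *s (\<Sum>k<length u. cf u k *s \<Psi> (del k u) w) =
      (\<Sum>z\<in>?W. \<Sum>c\<in>?W. (?c * gram_inv N c z) *s (b u (ext c) * gram_inv (Suc N) u w) *s \<Psi> z w)"
      unfolding A[OF u] by (simp add: scale_sum_right ac_simps)
  qed
  also have "\<dots> = (\<Sum>z\<in>?W. \<Sum>c\<in>?W. \<Sum>u\<in>?W'. \<Sum>w\<in>?W'. (?c * gram_inv N c z) *s (b u (ext c) * gram_inv (Suc N) u w) *s \<Psi> z w)"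
    unfolding sum.swap[of _ ?W' ?W] by (rule refl)
  also have "\<dots> = (\<Sum>z\<in>?W. \<Sum>c\<in>?W. (?c * gram_inv N c z) *s \<Psi> z (ext c))"
    by (intro sum.cong refl) (simp only: B flip: scale_sum_right)
  also have "\<dots> = ?c *s tr N (\<lambda>u w. \<Psi> u (ext w))"
    by (simp add: tr_def scale_sum_right gram_inv_sym[of N _ _])
  finally show ?thesis .
qed

section \<open>The Casimir operator\<close>

text \<open>The scalars \<open>sw\<close> are chosen so that in the commutator of the Casimir operator with \<open>E\<^sub>j\<close> and \<open>F\<^sub>j\<close>
  the two terms in which \<open>E\<^sub>j\<close> and \<open>F\<^sub>j\<close> stand between the words cancel in consecutive degrees.\<close>

definition sl :: "'i \<Rightarrow> 'x \<Rightarrow> 'k" where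
  "sl i l = - (ep i powi (n i l + 1) * q powi (- (d i * (n i l + 1))))"
definition sw :: "'x \<Rightarrow> 'i list \<Rightarrow> 'k" where
  "sw l w = (\<Prod>i\<leftarrow>w. sl i l) * eps ^ (pw w choose 2)"

lemma sw_Nil [simp]: "sw l [] = 1"
  by (simp add: sw_def numeral_2_eq_2)

text \<open>For p in {0, 1} the binomial coefficient satisfies C(p + k, 2) = p k + C(k, 2). This
  explains the exponent in \<open>sw\<close>: a new letter j adds exactly the sign that E_j receives
  on passing a word with the letters of \<open>w\<close>.\<close>

lemma sw_Cons: "sw l (j # w) = sl j l * eps ^ (p j * pw w) * sw l w"
proof -
  have "(p j + pw w) choose 2 = p j * pw w + (pw w choose 2)"
    using p01[of j] by (auto simp: numeral_2_eq_2)
  then show ?thesis by (simp add: sw_def power_add)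
qed

lemma sw_mset: "mset u = mset w \<Longrightarrow> sw l u = sw l w"
proof -
  assume h: "mset u = mset w"
  have "mset (map (\<lambda>i. sl i l) u) = mset (map (\<lambda>i. sl i l) w)" using h by simp
  then have "prod_mset (mset (map (\<lambda>i. sl i l) u)) = prod_mset (mset (map (\<lambda>i. sl i l) w))" by simp
  then show ?thesis using pw_mset[OF h] by (simp only: prod_mset_prod_list sw_def)
qed

lemma sl_add: "sl i (l + rt j) = sl i l * q powi (- dt j i)"
proof -
  have "ep i powi (n i (l + rt j) + 1) = ep i powi (n i l + 1)"
    using ep_n[of i l j] by (simp add: power_int_add)
  moreover have "- (d i * (n i (l + rt j) + 1)) = - (d i * (n i l + 1)) + - dt j i"
    using dt_a[of i j] by (simp add: n_add dt_sym algebra_simps)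
  ultimately show ?thesis by (simp only: sl_def power_int_add[OF disjI1[OF q0]]) simp
qed

lemma sw_add: "sw (l + rt j) w = sw l w * q powi (- dw j w)"
  by (induction w) (simp_all add: sw_Cons sl_add power_int_add power_int_diff power_int_minus field_simps)

text \<open>The equation that dictates \<open>sl\<close>: with the value -1, the first derivation
  term in degree N + 1 cancels the middle term in degree N.\<close>

lemma const1: "inverse (cc j) * (sl j l * kp j l * q powi (2 * d j)) = - 1"
proof -
  have s: "sl j l * kp j l * q powi (2 * d j) = - (ep j * q powi d j / den j)"
  proof -
    have "ep j powi (n j l + 1) * ep j powi n j l = ep j"
      using pm1_powi_sq[of "ep j" "n j l"] by (simp add: power_int_add)
    moreover have "q powi (- (d j * (n j l + 1))) * q powi (d j * n j l) * q powi (2 * d j) = q powi d j"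
      by (simp add: algebra_simps flip: power_int_add)
    ultimately have "(ep j powi (n j l + 1) * ep j powi n j l) *
        (q powi (- (d j * (n j l + 1))) * q powi (d j * n j l) * q powi (2 * d j)) = ep j * q powi d j" by simp
    then show ?thesis by (simp add: sl_def kp_def mult.assoc mult.left_commute)
  qed
  show ?thesis unfolding s using cc_eq[of j] denom_nz[of j]
    by (simp add: den_def mult.assoc[symmetric])
qed

text \<open>With \<open>sl\<close> fixed by \<open>const1\<close>, this is the scalar of the other
  derivation term; it becomes the factor by which the Casimir operator fails to commute with
  E_j.\<close>

lemma const2: "inverse (cc j) * (sl j l * km j l * q powi (- 2 * d j)) =
    - (ep j powi n j l * q powi (- 2 * d j * (n j l + 2)))"
proof -
  have i: "inverse (cc j) * (ep j * q powi d j) = den j" "den j \<noteq> 0"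
    using cc_eq[of j] denom_nz[of j] by (simp_all only: den_def not_False_eq_True)
  have "ep j powi (n j l + 1) = ep j powi n j l * ep j"
    by (simp add: power_int_add)
  moreover have "q powi (- (d j * (n j l + 1))) * q powi (- (d j * n j l)) * q powi (- 2 * d j)
      = q powi d j * q powi (- 2 * d j * (n j l + 2))"
    by (simp add: algebra_simps flip: power_int_add)
  ultimately have "ep j powi (n j l + 1) *
      (q powi (- (d j * (n j l + 1))) * q powi (- (d j * n j l)) * q powi (- 2 * d j)) =
      (ep j * q powi d j) * (ep j powi n j l * q powi (- 2 * d j * (n j l + 2)))" by simp
  then have "sl j l * km j l * q powi (- 2 * d j) =
      - ((ep j * q powi d j) * (ep j powi n j l * q powi (- 2 * d j * (n j l + 2)))) / den j"
    by (simp add: sl_def km_def mult.assoc mult.left_commute)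
  then have "inverse (cc j) * (sl j l * km j l * q powi (- 2 * d j)) =
      - ((inverse (cc j) * (ep j * q powi d j)) * (ep j powi n j l * q powi (- 2 * d j * (n j l + 2)))) / den j"
    by (simp only: mult.assoc times_divide_eq_right mult_minus_right)
  then show ?thesis unfolding i(1) using i(2) by simp
qed

definition level :: "'x \<Rightarrow> 'v \<Rightarrow> nat \<Rightarrow> 'v" where
  "level l m N = tr N (\<lambda>u w. sw l w *s Fw u (Ew w m))"
definition bd :: "'v \<Rightarrow> nat \<Rightarrow> bool" where
  "bd m N \<longleftrightarrow> (\<forall>w. N \<le> length w \<longrightarrow> Ew w m = 0)"
text \<open>The sum over all degrees, finite on each vector of a weight space; \<open>Cas_eq\<close>
  shows that any cutoff gives the same value. The weight is an argument because the scalars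
  \<open>sw\<close> depend on it.\<close>

definition Cas :: "'x \<Rightarrow> 'v \<Rightarrow> 'v" where
  "Cas l m = (\<Sum>N<(SOME N. bd m N). level l m N)"

lemma level_0: "bd m N \<Longrightarrow> N \<le> N' \<Longrightarrow> level l m N' = 0"
  unfolding level_def by (rule tr_zero) (simp add: bd_def)

lemma bd_mono: "bd m N \<Longrightarrow> N \<le> N' \<Longrightarrow> bd m N'"
  by (auto simp: bd_def)

lemma Cas_eq:
  assumes "bd m N" shows "Cas l m = (\<Sum>k<N. level l m k)"
proof -
  have "bd m (SOME N. bd m N)" using assms by (rule someI)
  moreover have "(\<Sum>k<N'. level l m k) = (\<Sum>k<min N N'. level l m k)" if "bd m N'" for N'
    using assms that by (intro sum.mono_neutral_right) (auto simp: level_0)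
  moreover have "(\<Sum>k<N. level l m k) = (\<Sum>k<min N N'. level l m k)" if "bd m N'" for N'
    using assms that by (intro sum.mono_neutral_right) (auto simp: level_0)
  ultimately show ?thesis unfolding Cas_def by metis
qed

lemma bd_ex: "m \<in> V l \<Longrightarrow> \<exists>N. bd m N"
  using E_nil[of m l] by (simp add: bd_def)

lemma bd_E: "bd m N \<Longrightarrow> bd (E j m) N"
  unfolding bd_def
proof (intro allI impI)
  fix w :: "'i list" assume h: "\<forall>w. N \<le> length w \<longrightarrow> Ew w m = 0" and "N \<le> length w"
  then have "Ew (w @ [j]) m = 0" by simp
  then show "Ew w (E j m) = 0" by (simp add: wact_append)
qed

lemma compat_F:
  assumes "\<And>w. Xf w \<in> V (f w)"
  shows "compat N (\<lambda>u w. t w *s Fw u (Xf w))"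
  unfolding compat_def
proof (intro allI impI)
  fix x w assume "rad N x"
  then have "t w *s (\<Sum>u\<in>words N. x u *s Fw u (Xf w)) = 0"
    using F_rad[OF assms] by simp
  then show "(\<Sum>u\<in>words N. x u *s t w *s Fw u (Xf w)) = 0"
    by (simp add: scale_sum_right mult.commute)
qed

text \<open>Here the scalar depends on the word being tested against the radical, so it has to be a
  function of the weight (\<open>rad_times\<close>).\<close>

lemma compat_E:
  assumes "m \<in> V l" "\<And>u w. mset u = mset w \<Longrightarrow> t u = t w"
  shows "compat N (\<lambda>w u. t w *s Fw (f u) (Ew w m))"
  unfolding compat_def
proof (intro allI impI)
  fix x u assume "rad N x"
  then have "(\<Sum>w\<in>words N. (t w * x w) *s Ew w m) = 0"
    using rad_times assms(2) E_rad[OF assms(1)] by blast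
  then have "Fw (f u) (\<Sum>w\<in>words N. (t w * x w) *s Ew w m) = 0" by simp
  then show "(\<Sum>w\<in>words N. x w *s t w *s Fw (f u) (Ew w m)) = 0"
    by (simp add: mult.commute)
qed

lemma compat_F':
  assumes "m \<in> V l" "\<And>u w. mset u = mset w \<Longrightarrow> t u = t w"
  shows "compat N (\<lambda>u w. t u *s Fw u (Ew w m))"
  unfolding compat_def
proof (intro allI impI)
  fix x w assume "rad N x"
  then have "(\<Sum>u\<in>words N. (t u * x u) *s Fw u (Ew w m)) = 0"
    using rad_times assms(2) F_rad[OF Ew_V[OF assms(1)]] by blast
  then show "(\<Sum>u\<in>words N. x u *s t u *s Fw u (Ew w m)) = 0"
    by (simp add: mult.commute)
qed

lemma compat_E':
  assumes "m \<in> V l"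
  shows "compat N (\<lambda>w u. t u *s Fw u (Ew w m))"
  unfolding compat_def
proof (intro allI impI)
  fix x u assume "rad N x"
  then have "t u *s Fw u (\<Sum>w\<in>words N. x w *s Ew w m) = 0"
    using E_rad[OF assms(1)] by simp
  then show "(\<Sum>w\<in>words N. x w *s t u *s Fw u (Ew w m)) = 0"
    by (simp add: mult.commute scale_sum_right)
qed

section \<open>Commutation of the Casimir operator with E_j\<close>

lemma Lsum_scaled: "t *s Lsum j u (\<lambda>z. Fw z x) = (\<Sum>k<length u. Lcf j u k *s t *s Fw (del k u) x)"
  by (simp add: Lsum_def scale_sum_right mult.commute)
lemma Rsum_scaled: "t *s Rsum j u (\<lambda>z. Fw z x) = (\<Sum>k<length u. Rcf j u k *s t *s Fw (del k u) x)"
  by (simp add: Rsum_def scale_sum_right mult.commute)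

lemma eps_cancel: "eps ^ (p j * t) * eps ^ (p j * (p j + t + p j)) = 1"
proof -
  have "eps ^ (p j * t) * eps ^ (p j * (p j + t + p j)) = eps ^ (p j * t + p j * t) * eps ^ (p j * p j + p j * p j)"
    by (simp only: power_add distrib_left ac_simps)
  then show ?thesis by simp
qed

text \<open>By \<open>E_Fw\<close> three terms arise. With E_j between the words one gets
  \<open>Xf\<close>. By \<open>tr_del\<close> the left derivation gives minus \<open>Xf\<close> one
  degree lower, and the right derivation gives a multiple of the level of E_j m one degree
  lower.\<close>

lemma E_level:
  fixes j :: 'i
  assumes m: "m \<in> V l"
  defines "Xf \<equiv> \<lambda>N. tr N (\<lambda>u w. (sw l w * eps ^ (p j * pw w)) *s Fw u (E j (Ew w m)))"
  shows "E j (level l m 0) = Xf 0"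
    and "E j (level l m (Suc N)) = Xf (Suc N) - Xf N +
      (ep j powi n j l * q powi (- 2 * d j * (n j l + 2))) *s level (l + rt j) (E j m) N"
proof -
  let ?e = "ep j powi n j l * q powi (- 2 * d j * (n j l + 2))"
  let ?L = "\<lambda>u w. Lsum j u (\<lambda>z. Fw z (Ew w m))" and ?R = "\<lambda>u w. Rsum j u (\<lambda>z. Fw z (Ew w m))"
  define t1 where "t1 = (\<lambda>w. sw l w * kp j (l + rts w) * q powi (dt j j - dw j w))"
  define t2 where "t2 = (\<lambda>w. sw l w * km j (l + rts w) * eps ^ (p j * (pw w + p j)))"
  have t1m: "t1 u = t1 w" and t2m: "t2 u = t2 w" if "mset u = mset w" for u w
    using sw_mset[OF that] rts_mset[OF that] pw_mset[OF that] dw_mset[OF that]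
    by (simp_all add: t1_def t2_def)
  have level: "E j (level l m N) = Xf N + tr N (\<lambda>u w. t1 w *s ?L u w)
      - tr N (\<lambda>u w. t2 w *s ?R u w)" for N
  proof -
    have "E j (level l m N) = tr N (\<lambda>u w. (sw l w * eps ^ (p j * pw w)) *s Fw u (E j (Ew w m)) +
        t1 w *s ?L u w - t2 w *s ?R u w)"
      unfolding level_def tr_E[symmetric]
    proof (rule tr_cong)
      fix u w :: "'i list" assume h: "mset u = mset w"
      show "E j (sw l w *s Fw u (Ew w m)) = (sw l w * eps ^ (p j * pw w)) *s Fw u (E j (Ew w m)) +
        t1 w *s ?L u w - t2 w *s ?R u w"
        using E_Fw[OF Ew_V[OF m], of j u w] pw_mset[OF h] dw_mset[OF h]
        by (simp add: t1_def t2_def scale_right_distrib scale_right_diff_distrib mult.assoc)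
    qed
    then show ?thesis by (simp only: tr_add tr_diff Xf_def)
  qed
  show "E j (level l m 0) = Xf 0"
    unfolding level by (simp add: tr_def)
  have Y: "tr (Suc N) (\<lambda>u w. t1 w *s ?L u w) = - Xf N"
  proof -
    have "tr (Suc N) (\<lambda>u w. t1 w *s ?L u w) =
        inverse (cc j) *s tr N (\<lambda>u w. t1 (j # w) *s Fw u (Ew (j # w) m))"
      unfolding Lsum_scaled
      by (rule tr_del[where ext = "\<lambda>w. j # w"])
        (use compat_F[OF Ew_V[OF m]] compat_E[OF m t1m] in \<open>simp_all add: b_Cons\<close>)
    also have "\<dots> = tr N (\<lambda>u w. - ((sw l w * eps ^ (p j * pw w)) *s Fw u (E j (Ew w m))))"
      unfolding tr_scale[symmetric]
    proof (rule tr_cong)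
      fix u w :: "'i list"
      have "t1 (j # w) = (sl j l * kp j l * q powi (2 * d j)) * (sw l w * eps ^ (p j * pw w)) *
          (q powi (dw j w) * q powi (- dw j w))"
        unfolding t1_def sw_Cons kp_rts(1) dw_simps dt_diag
        by (simp add: power_int_add power_int_diff power_int_minus field_simps)
      then have "t1 (j # w) = (sl j l * kp j l * q powi (2 * d j)) * (sw l w * eps ^ (p j * pw w))"
        by (simp add: power_int_minus)
      then have "inverse (cc j) * t1 (j # w) = - (sw l w * eps ^ (p j * pw w))"
        using const1[of j l] by (simp only: mult.assoc[symmetric]) simp
      then show "inverse (cc j) *s t1 (j # w) *s Fw u (Ew (j # w) m) =
          - ((sw l w * eps ^ (p j * pw w)) *s Fw u (E j (Ew w m)))"
        by simp
    qed
    finally show ?thesis by (simp only: tr_minus Xf_def)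
  qed
  have Z: "tr (Suc N) (\<lambda>u w. t2 w *s ?R u w) =
      - (?e *s level (l + rt j) (E j m) N)"
  proof -
    have "tr (Suc N) (\<lambda>u w. t2 w *s ?R u w) =
        inverse (cc j) *s tr N (\<lambda>u w. t2 (w @ [j]) *s Fw u (Ew (w @ [j]) m))"
      unfolding Rsum_scaled
      by (rule tr_del[where ext = "\<lambda>w. w @ [j]"])
        (use compat_F[OF Ew_V[OF m]] compat_E[OF m t2m] in \<open>simp_all add: b_snoc\<close>)
    also have "\<dots> = (- ?e) *s level (l + rt j) (E j m) N"
      unfolding tr_scale[symmetric] level_def
    proof (rule tr_cong)
      fix u w :: "'i list"
      \<comment> \<open>The scalar sees only the letters, so the new letter may be moved to the
        front, where \<open>sw_Cons\<close> applies.\<close>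
      have "t2 (w @ [j]) = t2 (j # w)" by (rule t2m) simp
      also have "\<dots> = (sl j l * km j l * q powi (- 2 * d j)) * sw (l + rt j) w *
          (eps ^ (p j * pw w) * eps ^ (p j * (p j + pw w + p j)))"
        unfolding t2_def sw_Cons km_rts(1) dw_simps dt_diag sw_add
        by (simp add: power_int_add power_int_diff power_int_minus field_simps)
      also have "eps ^ (p j * pw w) * eps ^ (p j * (p j + pw w + p j)) = 1" by (rule eps_cancel)
      finally have "inverse (cc j) * t2 (w @ [j]) =
          - ?e * sw (l + rt j) w"
        using const2[of j l] by (simp only: mult.assoc[symmetric] mult_1_right)
      then show "inverse (cc j) *s t2 (w @ [j]) *s Fw u (Ew (w @ [j]) m) =
          (- ?e) *s sw (l + rt j) w *s Fw u (Ew w (E j m))"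
        by (simp only: scale_scale wact_append wact.simps)
    qed
    finally show ?thesis by simp
  qed
  show "E j (level l m (Suc N)) = Xf (Suc N) - Xf N +
      ?e *s level (l + rt j) (E j m) N"
    unfolding level Y Z by simp
qed

text \<open>The \<open>Xf\<close> terms of \<open>E_level\<close> telescope, and the last one
  vanishes since long words in the E_i kill \<open>m\<close>.\<close>

lemma E_Cas:
  assumes m: "m \<in> V l"
  shows "E j (Cas l m) = (ep j powi n j l * q powi (- 2 * d j * (n j l + 2))) *s Cas (l + rt j) (E j m)"
proof -
  define Xf where "Xf \<equiv> \<lambda>N. tr N (\<lambda>u w. (sw l w * eps ^ (p j * pw w)) *s Fw u (E j (Ew w m)))"
  let ?c = "ep j powi n j l * q powi (- 2 * d j * (n j l + 2))"
  have S: "(\<Sum>k<Suc N. E j (level l m k)) = Xf N + ?c *s (\<Sum>k<N. level (l + rt j) (E j m) k)" for N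
  proof (induction N)
    case 0
    then show ?case using E_level(1)[OF m, of j] by (simp add: Xf_def)
  next
    case (Suc N)
    have "(\<Sum>k<Suc (Suc N). E j (level l m k)) = (\<Sum>k<Suc N. E j (level l m k)) + E j (level l m (Suc N))"
      by (rule sum.lessThan_Suc)
    also have "\<dots> = Xf (Suc N) + ?c *s (\<Sum>k<Suc N. level (l + rt j) (E j m) k)"
      unfolding Suc E_level(2)[OF m, of j N] by (simp add: scale_right_distrib Xf_def)
    finally show ?case .
  qed
  obtain N where N: "bd m N" using bd_ex[OF m] by blast
  have "Xf N = 0" unfolding Xf_def
  proof (rule tr_zero)
    fix u w :: "'i list" assume "length w = N"
    then have "Ew w m = 0" using N by (simp add: bd_def)
    then show "(sw l w * eps ^ (p j * pw w)) *s Fw u (E j (Ew w m)) = 0" by simp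
  qed
  then show ?thesis
    using S[of N] bd_mono[OF N, of "Suc N"] by (simp add: Cas_eq[OF bd_E[OF N]] Cas_eq del: sum.lessThan_Suc)
qed

section \<open>Commutation of the Casimir operator with F_j\<close>

lemma bd_F:
  assumes "m \<in> V l" "bd m N"
  shows "bd (F j m) (Suc N)"
  unfolding bd_def
proof (intro allI impI)
  fix w :: "'i list" assume w: "Suc N \<le> length w"
  \<comment> \<open>A skew derivation removes one letter, which is why the bound grows by
    one.\<close>
  have "Ew (del k w) m = 0" if "k < length w" for k
    using assms(2) w that by (auto simp: bd_def)
  moreover have "Ew w m = 0" using assms(2) w by (simp add: bd_def)
  ultimately show "Ew w (F j m) = 0"
    unfolding Ew_F[OF assms(1)] by (simp add: Lsum_def Rsum_def)
qed

text \<open>As \<open>E_level\<close>, but the derivations now act on the word of the E_i and the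
  new letter joins the word of the F_i. So the scalars are written in terms of \<open>u\<close>, and
  \<open>tr_swap\<close> brings the differentiated word into the first argument before
  \<open>tr_del\<close> is used.\<close>

lemma level_F:
  fixes j :: 'i
  assumes m: "m \<in> V l"
  defines "Xf \<equiv> \<lambda>N. tr N (\<lambda>u w. (sw (l - rt j) w * eps ^ (p j * pw w)) *s Fw u (F j (Ew w m)))"
  shows "level (l - rt j) (F j m) 0 = Xf 0"
    and "level (l - rt j) (F j m) (Suc N) = Xf (Suc N) - Xf N +
      (ep j powi n j l * q powi (- 2 * d j * n j l)) *s F j (level l m N)"
proof -
  let ?l = "l - rt j" and ?e = "ep j powi n j l * q powi (- 2 * d j * n j l)"
  let ?L = "\<lambda>u w. Fw u (Lsum j w (\<lambda>z. Ew z m))" and ?R = "\<lambda>u w. Fw u (Rsum j w (\<lambda>z. Ew z m))"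
  define t1 where "t1 = (\<lambda>u. sw ?l u * kp j l)"
  define t2 where "t2 = (\<lambda>u. sw ?l u * (km j l * eps ^ (p j * (pw u + p j)) * q powi (dt j j - dw j u)))"
  have t1m: "t1 u = t1 w" and t2m: "t2 u = t2 w" if "mset u = mset w" for u w
    using sw_mset[OF that] pw_mset[OF that] dw_mset[OF that]
    by (simp_all add: t1_def t2_def)
  have sl: "sl j ?l = sl j l * q powi (2 * d j)"
    using sl_add[of j ?l j] by (simp add: dt_diag power_int_minus field_simps)
  have swl: "sw ?l w = sw l w * q powi dw j w" for w
    using sw_add[of ?l j w] by (simp add: power_int_minus field_simps)
  have level: "level ?l (F j m) N = Xf N + tr N (\<lambda>u w. t1 u *s ?R u w)
      - tr N (\<lambda>u w. t2 u *s ?L u w)" for N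
  proof -
    have "level ?l (F j m) N = tr N (\<lambda>u w. (sw ?l w * eps ^ (p j * pw w)) *s Fw u (F j (Ew w m)) +
        t1 u *s ?R u w - t2 u *s ?L u w)"
      unfolding level_def
    proof (rule tr_cong)
      fix u w :: "'i list" assume h: "mset u = mset w"
      show "sw ?l w *s Fw u (Ew w (F j m)) = (sw ?l w * eps ^ (p j * pw w)) *s Fw u (F j (Ew w m)) +
        t1 u *s ?R u w - t2 u *s ?L u w"
        unfolding Ew_F[OF m, of w j] using pw_mset[OF h] dw_mset[OF h] sw_mset[OF h]
        by (simp add: t1_def t2_def scale_right_distrib scale_right_diff_distrib)
    qed
    then show ?thesis by (simp only: tr_add tr_diff Xf_def)
  qed
  show "level ?l (F j m) 0 = Xf 0"
    unfolding level by (simp add: tr_def)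
  have Rs: "t *s ?R u w = (\<Sum>k<length w. Rcf j w k *s t *s Fw u (Ew (del k w) m))"
    and Ls: "t *s ?L u w = (\<Sum>k<length w. Lcf j w k *s t *s Fw u (Ew (del k w) m))"
    for t u w
    by (simp_all add: Lsum_def Rsum_def scale_sum_right mult.commute)
  have Y: "tr (Suc N) (\<lambda>u w. t1 u *s ?R u w) = - Xf N"
  proof -
    have "tr (Suc N) (\<lambda>u w. t1 u *s ?R u w) =
        inverse (cc j) *s tr N (\<lambda>w u. t1 (u @ [j]) *s Fw (u @ [j]) (Ew w m))"
      unfolding Rs
      by (subst tr_swap, rule tr_del[where ext = "\<lambda>w. w @ [j]"])
        (use compat_E'[OF m] compat_F'[OF m t1m] in \<open>simp_all add: b_snoc\<close>)
    also have "\<dots> = tr N (\<lambda>w u. - ((sw ?l w * eps ^ (p j * pw w)) *s Fw u (F j (Ew w m))))"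
      unfolding tr_scale[symmetric]
    proof (rule tr_cong)
      fix u w :: "'i list" assume h: "mset w = mset u"
      have "t1 (u @ [j]) = t1 (j # u)" by (rule t1m) simp
      also have "\<dots> = (sl j l * kp j l * q powi (2 * d j)) * (sw ?l w * eps ^ (p j * pw w))"
        unfolding t1_def sw_Cons sl pw_mset[OF h] sw_mset[OF h] by simp
      finally have "inverse (cc j) * t1 (u @ [j]) = - (sw ?l w * eps ^ (p j * pw w))"
        using const1[of j l] by (simp only: mult.assoc[symmetric]) simp
      then show "inverse (cc j) *s t1 (u @ [j]) *s Fw (u @ [j]) (Ew w m) =
          - ((sw ?l w * eps ^ (p j * pw w)) *s Fw u (F j (Ew w m)))"
        by (simp add: wact_append)
    qed
    also have "\<dots> = tr N (\<lambda>u w. - ((sw ?l w * eps ^ (p j * pw w)) *s Fw u (F j (Ew w m))))"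
      by (rule tr_swap)
    finally show ?thesis by (simp only: tr_minus Xf_def)
  qed
  have Z: "tr (Suc N) (\<lambda>u w. t2 u *s ?L u w) =
      - (?e *s F j (level l m N))"
  proof -
    have "tr (Suc N) (\<lambda>u w. t2 u *s ?L u w) =
        inverse (cc j) *s tr N (\<lambda>w u. t2 (j # u) *s Fw (j # u) (Ew w m))"
      unfolding Ls
      by (subst tr_swap, rule tr_del[where ext = "\<lambda>w. j # w"])
        (use compat_E'[OF m] compat_F'[OF m t2m] in \<open>simp_all add: b_Cons\<close>)
    also have "\<dots> = (- ?e) *s tr N (\<lambda>w u. F j (sw l w *s Fw u (Ew w m)))"
      unfolding tr_scale[symmetric]
    proof (rule tr_cong)
      fix u w :: "'i list" assume h: "mset w = mset u"
      have e: "eps ^ (p j * pw u) * eps ^ (p j * (p j + pw u + p j)) = 1" by (rule eps_cancel)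
      have "t2 (j # u) = (sl j l * km j l * q powi (2 * d j)) * sw l u *
          (eps ^ (p j * pw u) * eps ^ (p j * (p j + pw u + p j))) * (q powi dw j u * q powi (- dw j u))"
        unfolding t2_def sw_Cons dw_simps dt_diag swl sl
        by (simp add: power_int_diff power_int_minus power_int_add field_simps)
      \<comment> \<open>Splitting off q^(4 d_j) makes \<open>const2\<close> applicable; the same
        factor then turns the exponent n + 2 into n.\<close>
      also have "\<dots> = (sl j l * km j l * q powi (- 2 * d j)) * (q powi (4 * d j) * sw l w)"
      proof -
        have "q powi (2 * d j) = q powi (- 2 * d j) * q powi (4 * d j)"
          by (simp flip: power_int_add)
        then show ?thesis unfolding e sw_mset[OF h] by (simp add: power_int_minus)
      qed
      finally have "inverse (cc j) * t2 (j # u) =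
          - (ep j powi n j l * q powi (- 2 * d j * (n j l + 2))) * (q powi (4 * d j) * sw l w)"
        using const2[of j l] by (simp only: mult.assoc[symmetric])
      moreover have "q powi (- 2 * d j * (n j l + 2)) * q powi (4 * d j) = q powi (- 2 * d j * n j l)"
        by (simp add: algebra_simps flip: power_int_add)
      ultimately have "inverse (cc j) * t2 (j # u) = - ?e * sw l w"
        by (simp add: mult.assoc[symmetric])
      then show "inverse (cc j) *s t2 (j # u) *s Fw (j # u) (Ew w m) =
          (- ?e) *s F j (sw l w *s Fw u (Ew w m))"
        by (simp only: scale_scale wact.simps linF)
    qed
    also have "tr N (\<lambda>w u. F j (sw l w *s Fw u (Ew w m))) = F j (level l m N)"
      unfolding level_def tr_F[symmetric] by (rule tr_swap)
    finally show ?thesis by simp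
  qed
  show "level ?l (F j m) (Suc N) = Xf (Suc N) - Xf N +
      ?e *s F j (level l m N)"
    unfolding level Y Z by simp
qed

lemma F_Cas:
  assumes m: "m \<in> V l"
  shows "Cas (l - rt j) (F j m) = (ep j powi n j l * q powi (- 2 * d j * n j l)) *s F j (Cas l m)"
proof -
  define Xf where "Xf \<equiv> \<lambda>N. tr N (\<lambda>u w. (sw (l - rt j) w * eps ^ (p j * pw w)) *s Fw u (F j (Ew w m)))"
  let ?c = "ep j powi n j l * q powi (- 2 * d j * n j l)"
  have S: "(\<Sum>k<Suc N. level (l - rt j) (F j m) k) = Xf N + ?c *s F j (\<Sum>k<N. level l m k)" for N
  proof (induction N)
    case 0
    then show ?case using level_F(1)[OF m, of j] by (simp add: Xf_def)
  next
    case (Suc N)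
    have "(\<Sum>k<Suc (Suc N). level (l - rt j) (F j m) k) = (\<Sum>k<Suc N. level (l - rt j) (F j m) k) + level (l - rt j) (F j m) (Suc N)"
      by (rule sum.lessThan_Suc)
    also have "\<dots> = Xf (Suc N) + ?c *s F j (\<Sum>k<Suc N. level l m k)"
      unfolding Suc level_F(2)[OF m, of j N] by (simp add: scale_right_distrib Xf_def)
    finally show ?case .
  qed
  obtain N where N: "bd m N" using bd_ex[OF m] by blast
  have "Xf N = 0" unfolding Xf_def
  proof (rule tr_zero)
    fix u w :: "'i list" assume "length w = N"
    then have "Ew w m = 0" using N by (simp add: bd_def)
    then show "(sw (l - rt j) w * eps ^ (p j * pw w)) *s Fw u (F j (Ew w m)) = 0" by simp
  qed
  then show ?thesis
    using S[of N] by (simp add: Cas_eq[OF bd_F[OF m N]] Cas_eq[OF N] del: sum.lessThan_Suc)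
qed

section \<open>Complete reducibility\<close>

definition prim :: "'x \<Rightarrow> 'v \<Rightarrow> bool" where
  "prim l v \<longleftrightarrow> v \<in> V l \<and> (\<forall>i. E i v = 0)"

lemma level_lin: "level l (x + y) N = level l x N + level l y N" "level l (c *s x) N = c *s level l x N"
  by (simp_all add: level_def scale_right_distrib mult.commute flip: tr_add tr_scale)

lemma Cas_lin:
  assumes "x \<in> V l" "y \<in> V l"
  shows "Cas l (x + y) = Cas l x + Cas l y" "Cas l (c *s x) = c *s Cas l x"
proof -
  obtain M N where M: "bd x M" and N: "bd y N" using bd_ex assms by blast
  let ?K = "max M N"
  have "bd x ?K" "bd y ?K" using M N by (auto intro: bd_mono)
  moreover from this have "bd (x + y) ?K" "bd (c *s x) ?K" by (auto simp: bd_def)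
  ultimately show "Cas l (x + y) = Cas l x + Cas l y" "Cas l (c *s x) = c *s Cas l x"
    by (simp_all add: Cas_eq level_lin sum.distrib scale_sum_right)
qed

lemma tr_in:
  assumes "subspace T" "\<And>u w. \<lbrakk>length u = N; length w = N; mset u = mset w\<rbrakk> \<Longrightarrow> \<Psi> u w \<in> T"
  shows "tr N \<Psi> \<in> T"
  unfolding tr_def
proof (intro subspace_sum[OF assms(1)])
  fix u w :: "'i list" assume "u \<in> words N" "w \<in> words N"
  then show "gram_inv N u w *s \<Psi> u w \<in> T"
    using assms gram_inv_mset[of N u w] by (cases "gram_inv N u w = 0") (auto intro: subspace_scale subspace_0)
qed

lemma Cas_V:
  assumes m: "m \<in> V l" shows "Cas l m \<in> V l"
proof -
  obtain N where N: "bd m N" using bd_ex[OF m] by blast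
  have "level l m k \<in> V l" for k unfolding level_def
  proof (rule tr_in[OF V_subspace])
    fix u w :: "'i list" assume h: "mset u = mset w"
    then show "sw l w *s Fw u (Ew w m) \<in> V l"
      using Fw_V[OF Ew_V[OF m], of u w] rts_mset[OF h] by simp
  qed
  then show ?thesis by (simp add: Cas_eq[OF N])
qed

lemma level_at_0: "level l m 0 = m"
proof -
  have "words 0 = {[] :: 'i list}" by auto
  then show ?thesis by (simp add: level_def tr_def gram_inv_0)
qed

lemma Cas_prim:
  assumes "prim l v" shows "Cas l v = v"
proof -
  have "Ew w v = 0" if ne: "w \<noteq> []" for w
    using ne assms by (cases w rule: rev_cases) (auto simp: wact_append prim_def)
  then have "bd v (Suc 0)" unfolding bd_def by (intro allI impI) (metis list.size(3) not_less_eq_eq zero_le)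
  then show ?thesis by (simp add: Cas_eq level_at_0)
qed

text \<open>With beta the weight of \<open>w\<close> and (alpha_i, rho) = d_i, this is (beta, 2 l +
  beta + 2 rho), the difference of the squared lengths of l + beta + rho and l + rho.\<close>

definition cas_exp :: "'x \<Rightarrow> 'i list \<Rightarrow> int" where
  "cas_exp l w = (\<Sum>i\<leftarrow>w. d i * (n i l + n i (l + rts w) + 2))"

lemma sum_list_dt: "(\<Sum>i\<leftarrow>w. d i * a i j) = dw j w"
  by (induction w) (simp_all add: dt_a dt_sym)

lemma n_rts_add: "n i (l + (rt j + rts w)) = n i (l + rts w) + a i j"
  using n_add[of i "l + rts w" j] by (simp add: ac_simps)

text \<open>The new letter shifts n_i at the upper end by a_ij. The resulting terms d_i a_ij add up
  to \<open>dw j w\<close>, which turns d_j n_j(l) into a second copy of d_j n_j at the weight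
  reached by \<open>w\<close>.\<close>

lemma cas_exp_Cons: "cas_exp l (j # w) = cas_exp l w + 2 * d j * (n j (l + rts w) + 2)"
proof -
  have "cas_exp l (j # w) = d j * (n j l + (n j (l + rts w) + a j j) + 2) +
      (\<Sum>i\<leftarrow>w. d i * (n i l + n i (l + rts w) + 2) + d i * a i j)"
    by (simp add: cas_exp_def n_rts_add algebra_simps)
  also have "\<dots> = d j * n j l + d j * n j (l + rts w) + d j * a j j + 2 * d j + cas_exp l w + dw j w"
    by (simp add: sum_list_addf cas_exp_def sum_list_dt algebra_simps)
  finally show ?thesis using n_rts[of j l w] by (simp add: dt_a dt_diag algebra_simps)
qed

lemma cas_exp_Cons': "cas_exp (l - rts (j # u)) (j # u) = cas_exp (l - rts u) u + 2 * d j * n j (l - rts u)"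
proof -
  have s: "n i (l - (rt j + rts u)) = n i (l - rts u) - a i j" for i
    using n_sub[of i "l - rts u" j] by (simp add: algebra_simps)
  have "cas_exp (l - rts (j # u)) (j # u) = d j * (n j (l - rts u) - a j j + n j l + 2) +
      (\<Sum>i\<leftarrow>u. d i * (n i (l - rts u) + n i l + 2) - d i * a i j)"
    by (simp add: cas_exp_def s algebra_simps)
  also have "\<dots> = d j * n j (l - rts u) - d j * a j j + d j * n j l + 2 * d j + cas_exp (l - rts u) u - dw j u"
    by (simp add: sum_list_subtractf cas_exp_def sum_list_dt algebra_simps)
  finally show ?thesis using n_sub_rts[of j l u] by (simp add: dt_a dt_diag algebra_simps)
qed

lemma cas_exp_pos:
  assumes "\<And>i. n i l \<ge> 0" "\<And>i. n i (l + rts w) \<ge> 0" "w \<noteq> []"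
  shows "cas_exp l w > 0"
proof -
  have "0 < d i * (n i l + n i (l + rts w) + 2)" for i
    using assms(1)[of i] assms(2)[of i] d_pos[of i] by simp
  then have pos: "0 < d i * (n i l + n i (l + rts w') + 2)" if "w' = w" for i w' using that by simp
  have "0 \<le> (\<Sum>i\<leftarrow>v. d i * (n i l + n i (l + rts w) + 2))" for v
    using pos by (intro sum_list_nonneg) (auto intro: less_imp_le)
  moreover obtain j v where w: "w = j # v" using assms(3) by (cases w) auto
  ultimately show ?thesis using pos[of w j] unfolding cas_exp_def
    by (subst (2) w) (simp add: add_pos_nonneg)
qed

text \<open>Recording only c^2 removes the signs coming from each letter; the power of
  \<open>q\<close> is all that is compared later.\<close>

lemma Ew_Cas:
  "\<exists>c. c * c = q powi (- 2 * cas_exp l w) \<and>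
    (\<forall>m\<in>V l. Ew w (Cas l m) = c *s Cas (l + rts w) (Ew w m))"
proof (induction w)
  case Nil
  show ?case by (intro exI[of _ 1]) (simp add: cas_exp_def)
next
  case (Cons j w)
  then obtain c where c: "c * c = q powi (- 2 * cas_exp l w)"
    "\<And>m. m \<in> V l \<Longrightarrow> Ew w (Cas l m) = c *s Cas (l + rts w) (Ew w m)" by blast
  let ?e = "ep j powi n j (l + rts w) * q powi (- 2 * d j * (n j (l + rts w) + 2))"
  have "(c * ?e) * (c * ?e) = (c * c) * ((ep j powi n j (l + rts w) * ep j powi n j (l + rts w)) *
      (q powi (- 2 * d j * (n j (l + rts w) + 2)) * q powi (- 2 * d j * (n j (l + rts w) + 2))))"
    by (simp only: ac_simps)
  also have "\<dots> = q powi (- 2 * cas_exp l (j # w))"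
    unfolding c(1) cas_exp_Cons pm1_powi_sq[OF ep2(1)] mult_1
    by (simp only: power_int_add[OF disjI1[OF q0], symmetric]) (simp add: algebra_simps)
  finally have "(c * ?e) * (c * ?e) = q powi (- 2 * cas_exp l (j # w))" .
  moreover have "Ew (j # w) (Cas l m) = (c * ?e) *s Cas (l + rts (j # w)) (Ew (j # w) m)" if m: "m \<in> V l" for m
    using E_Cas[OF Ew_V[OF m], of j w] by (simp add: c(2)[OF m] ac_simps)
  ultimately show ?case by blast
qed

lemma Fw_Cas:
  "\<exists>c. c * c = q powi (- 2 * cas_exp (l - rts u) u) \<and>
    (\<forall>m\<in>V l. Cas (l - rts u) (Fw u m) = c *s Fw u (Cas l m))"
proof (induction u)
  case Nil
  show ?case by (intro exI[of _ 1]) (simp add: cas_exp_def)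
next
  case (Cons j u)
  then obtain c where c: "c * c = q powi (- 2 * cas_exp (l - rts u) u)"
    "\<And>m. m \<in> V l \<Longrightarrow> Cas (l - rts u) (Fw u m) = c *s Fw u (Cas l m)" by blast
  let ?e = "ep j powi n j (l - rts u) * q powi (- 2 * d j * n j (l - rts u))"
  have "(c * ?e) * (c * ?e) = (c * c) * ((ep j powi n j (l - rts u) * ep j powi n j (l - rts u)) *
      (q powi (- 2 * d j * n j (l - rts u)) * q powi (- 2 * d j * n j (l - rts u))))"
    by (simp only: ac_simps)
  also have "\<dots> = q powi (- 2 * cas_exp (l - rts (j # u)) (j # u))"
    unfolding c(1) cas_exp_Cons' pm1_powi_sq[OF ep2(1)] mult_1
    by (simp only: power_int_add[OF disjI1[OF q0], symmetric]) (simp add: distrib_left)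
  finally have "(c * ?e) * (c * ?e) = q powi (- 2 * cas_exp (l - rts (j # u)) (j # u))" .
  moreover have "Cas (l - rts (j # u)) (Fw (j # u) m) = (c * ?e) *s Fw (j # u) (Cas l m)" if m: "m \<in> V l" for m
  proof -
    have e: "l - rts u - rt j = l - rts (j # u)" by (simp add: algebra_simps)
    show ?thesis using F_Cas[OF Fw_V[OF m], of u j] unfolding e by (simp add: c(2)[OF m] ac_simps del: rts_simps)
  qed
  ultimately show ?case by blast
qed

section \<open>Primitive vectors and the submodules generated by them\<close>

lemma top_exists:
  assumes "m \<in> V l" "m \<notin> S l" and S: "\<And>l. 0 \<in> S l"
  shows "\<exists>x. Ew x m \<notin> S (l + rts x) \<and> (\<forall>i. Ew (i # x) m \<in> S (l + rts (i # x)))"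
proof -
  obtain N where N: "bd m N" using bd_ex[OF assms(1)] by blast
  let ?P = "\<lambda>x. Ew x m \<notin> S (l + rts x)"
  have "?P []" using assms(2) by simp
  moreover have "\<forall>y. ?P y \<longrightarrow> length y < Suc N"
    using N S by (metis bd_def less_Suc_eq_le linorder_le_less_linear less_imp_le_nat)
  \<comment> \<open>A longest word leading outside \<open>S\<close>; lengths are bounded because
    long words kill \<open>m\<close> and 0 lies in \<open>S\<close>.\<close>
  ultimately obtain x where x: "?P x" "\<And>y. ?P y \<Longrightarrow> length y \<le> length x"
    using ex_has_greatest_nat[of ?P "[]" length "Suc N"] by (metis less_imp_le_nat)
  have "Ew (i # x) m \<in> S (l + rts (i # x))" for i
    using x(2)[of "i # x"] by fastforce
  then show ?thesis using x(1) by blast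
qed

lemma prim_dominant:
  assumes "prim l v" "v \<noteq> 0" shows "n i l \<ge> 0"
  using string_dominant[of v l "\<lambda>_. {0}" i] assms by (auto simp: prim_def)

text \<open>For primitive \<open>P\<close> the words in the \<open>F\<^sub>i\<close> suffice to generate: \<open>UP P \<mu>\<close> is the whole weight space of
  the submodule generated by \<open>P\<close>.\<close>

definition UP :: "('x \<Rightarrow> 'v \<Rightarrow> bool) \<Rightarrow> 'x \<Rightarrow> 'v set" where
  "UP P \<mu> = span {Fw u v | u l v. P l v \<and> l - rts u = \<mu>}"

lemma UP_subspace: "subspace (UP P \<mu>)"
  by (simp add: UP_def)

lemma UP_gen: "P l v \<Longrightarrow> Fw u v \<in> UP P (l - rts u)"
  unfolding UP_def by (rule span_base) blast

lemma UP_induct: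
  assumes "x \<in> UP P \<mu>" "subspace {x. Q x}" "\<And>u l v. P l v \<Longrightarrow> l - rts u = \<mu> \<Longrightarrow> Q (Fw u v)"
  shows "Q x"
  using assms(1) unfolding UP_def by (rule span_induct) (use assms in auto)

lemma UP_V:
  assumes P: "\<And>l v. P l v \<Longrightarrow> prim l v" and "x \<in> UP P \<mu>"
  shows "x \<in> V \<mu>"
  using assms(2)
proof (rule UP_induct)
  show "subspace {x. x \<in> V \<mu>}" using V_subspace by simp
  fix u l v assume "P l v" "l - rts u = \<mu>"
  then show "Fw u v \<in> V \<mu>" using P Fw_V by (auto simp: prim_def)
qed

lemma UP_F:
  assumes "x \<in> UP P \<mu>" shows "F j x \<in> UP P (\<mu> - rt j)"
  using assms
proof (rule UP_induct)
  show "subspace {x. F j x \<in> UP P (\<mu> - rt j)}"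
    using UP_subspace[of P "\<mu> - rt j"] by (auto simp: subspace_def)
  fix u l v assume "P l v" "l - rts u = \<mu>"
  then show "F j (Fw u v) \<in> UP P (\<mu> - rt j)"
    using UP_gen[of P l v "j # u"] by (auto simp: algebra_simps)
qed

text \<open>On a primitive vector \<open>E_Fw\<close> leaves only the derivation terms, and these
  are again words in the F_i applied to it.\<close>

lemma UP_E:
  assumes P: "\<And>l v. P l v \<Longrightarrow> prim l v" and "x \<in> UP P \<mu>"
  shows "E j x \<in> UP P (\<mu> + rt j)"
  using assms(2)
proof (rule UP_induct)
  show "subspace {x. E j x \<in> UP P (\<mu> + rt j)}"
    using UP_subspace[of P "\<mu> + rt j"] by (auto simp: subspace_def)
  fix u l v assume h: "P l v" "l - rts u = \<mu>"
  have v: "v \<in> V l" "E j v = 0" using P[OF h(1)] by (auto simp: prim_def)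
  have del: "Fw (del k u) v \<in> UP P (\<mu> + rt j)" if "k < length u" "u ! k = j" for k
  proof -
    have "rts u = rt j + rts (del k u)" using rts_mset[of u "u ! k # del k u"] mset_del[of k u] that by simp
    then have "\<mu> + rt j = l - rts (del k u)" unfolding h(2)[symmetric] by simp
    then show ?thesis using UP_gen[where P = P, OF h(1)] by simp
  qed
  have "Lsum j u (\<lambda>z. Fw z v) \<in> UP P (\<mu> + rt j)" "Rsum j u (\<lambda>z. Fw z v) \<in> UP P (\<mu> + rt j)"
    unfolding Lsum_def Rsum_def
  proof -
    have "c *s Fw (del k u) v \<in> UP P (\<mu> + rt j)" if "u ! k \<noteq> j \<Longrightarrow> c = 0" "k < length u" for c k
      using del[of k] that by (cases "u ! k = j") (auto intro: subspace_0[OF UP_subspace] subspace_scale[OF UP_subspace])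
    then show "(\<Sum>k<length u. Lcf j u k *s Fw (del k u) v) \<in> UP P (\<mu> + rt j)"
      "(\<Sum>k<length u. Rcf j u k *s Fw (del k u) v) \<in> UP P (\<mu> + rt j)"
      by (auto intro!: subspace_sum[OF UP_subspace] simp: Lcf_def Rcf_def)
  qed
  then show "E j (Fw u v) \<in> UP P (\<mu> + rt j)"
    unfolding E_Fw[OF v(1)] v(2) using UP_subspace[of P "\<mu> + rt j"]
    by (simp add: subspace_diff subspace_scale)
qed

lemma UP_Ew:
  assumes P: "\<And>l v. P l v \<Longrightarrow> prim l v" and "x \<in> UP P \<mu>"
  shows "Ew w x \<in> UP P (\<mu> + rts w)"
proof (induction w)
  case (Cons i w)
  then show ?case using UP_E[OF P Cons, of i] by (simp add: ac_simps)
qed (use assms in simp)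

lemma UP_Fw:
  assumes "x \<in> UP P \<mu>"
  shows "Fw w x \<in> UP P (\<mu> - rts w)"
proof (induction w)
  case (Cons i w)
  then show ?case using UP_F[OF Cons, of i] by (simp add: algebra_simps)
qed (use assms in simp)

theorem prim_simple:
  assumes v: "prim l v" and w: "w \<in> UP (\<lambda>l' v'. l' = l \<and> v' = v) \<mu>" "w \<noteq> 0"
  shows "\<exists>x c. c \<noteq> 0 \<and> Ew x w = c *s v"
proof -
  let ?P = "\<lambda>l' v'. l' = l \<and> v' = v"
  have P: "?P l' v' \<Longrightarrow> prim l' v'" for l' v' using v by simp
  have wV: "w \<in> V \<mu>" using UP_V[of ?P, OF P w(1)] by simp
  obtain x where x: "Ew x w \<noteq> 0" "\<And>i. Ew (i # x) w = 0"
    using top_exists[OF wV, of "\<lambda>_. {0}"] w(2) by auto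
  define y where "y = Ew x w"
  define \<nu> where "\<nu> = \<mu> + rts x"
  have y: "y \<in> UP ?P \<nu>" unfolding y_def \<nu>_def by (rule UP_Ew[OF P w(1)])
  have py: "prim \<nu> y" using UP_V[of ?P, OF P y] x(2) by (simp add: prim_def y_def)
  have "\<exists>c. y = c *s v"
  proof (cases "\<nu> = l")
    case True
    show ?thesis using y
    proof (rule UP_induct)
      show "subspace {y. \<exists>c. y = c *s v}"
        unfolding subspace_def
        by (auto intro: exI[of _ 0]) (metis scale_left_distrib)
      fix u l' v' assume h: "l' = l \<and> v' = v" "l' - rts u = \<nu>"
      then have "(\<Sum>i\<leftarrow>u. rt i) = (\<Sum>i\<leftarrow>[]. rt i)" using True by (simp add: rts_def)
      \<comment> \<open>By independence of the simple roots, the weight space of weight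
        \<open>l\<close> is the line through \<open>v\<close>.\<close>
      then have "u = []" using rt_inj by fastforce
      then show "\<exists>c. Fw u v' = c *s v" using h by (intro exI[of _ 1]) simp
    qed
  next
    case False
    \<comment> \<open>Otherwise the spanning set of this weight space would be empty and
      \<open>y\<close> would be 0.\<close>
    have "\<exists>u. l - rts u = \<nu>"
    proof (rule ccontr)
      assume h: "\<not> ?thesis"
      have "y = 0" using y
      proof (rule UP_induct)
        show "subspace {y. y = 0}" by simp
      qed (use h in auto)
      then show False using x y_def by simp
    qed
    then obtain u where u: "l - rts u = \<nu>" by blast
    \<comment> \<open>The Casimir operator is applied twice: the scalar from \<open>Fw_Cas\<close>
      may depend on the spanning word through its sign, while its square depends only on the
      weight.\<close>
    have "Cas \<nu> (Cas \<nu> y) = q powi (- 2 * cas_exp \<nu> u) *s y \<and> y \<in> V \<nu>"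
      using y
    proof (rule UP_induct)
      show "subspace {y. Cas \<nu> (Cas \<nu> y) = q powi (- 2 * cas_exp \<nu> u) *s y \<and> y \<in> V \<nu>}"
      proof -
        have "Cas \<nu> 0 = 0" using Cas_lin(2)[of 0 \<nu> 0 0] by simp
        then show ?thesis unfolding subspace_def
          by (auto simp: Cas_lin Cas_V scale_right_distrib mult.commute)
      qed
      fix u' l' v' assume h: "l' = l \<and> v' = v" "l' - rts u' = \<nu>"
      have m: "mset u' = mset u" 
        by (rule rt_inj) (use h u in \<open>simp add: rts_def[symmetric] algebra_simps\<close>)
      obtain c where c: "c * c = q powi (- 2 * cas_exp (l - rts u') u')"
        "\<And>m. m \<in> V l \<Longrightarrow> Cas (l - rts u') (Fw u' m) = c *s Fw u' (Cas l m)"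
        using Fw_Cas by blast
      have g: "Cas \<nu> (Fw u' v) = c *s Fw u' v"
        using c(2)[of v] Cas_prim[OF v] v h by (auto simp: prim_def)
      have gV: "Fw u' v \<in> V \<nu>" using Fw_V[of v l u'] v h by (auto simp: prim_def)
      have "cas_exp \<nu> u' = cas_exp \<nu> u" unfolding cas_exp_def rts_mset[OF m] by (rule sum_list_mset_cong[OF m])
      then have "c * c = q powi (- 2 * cas_exp \<nu> u)" using c(1) h by simp
      then show "Cas \<nu> (Cas \<nu> (Fw u' v')) = q powi (- 2 * cas_exp \<nu> u) *s Fw u' v' \<and> Fw u' v' \<in> V \<nu>"
        using h g gV Cas_lin(2)[OF gV gV] by simp
    qed
    then have "q powi (- 2 * cas_exp \<nu> u) *s y = 1 *s y" by (simp add: Cas_prim[OF py])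
    then have "q powi (- 2 * cas_exp \<nu> u) = 1" using x y_def by (simp only: scale_cancel_right) simp
    then have z: "cas_exp \<nu> u = 0" using q_root by fastforce
    have "v \<noteq> 0"
    proof
      assume v0: "v = 0"
      have "y = 0" using y
      proof (rule UP_induct)
        show "subspace {y. y = 0}" by simp
      qed (use v0 in auto)
      then show False using x y_def by simp
    qed
    moreover have "u \<noteq> []" using u False by auto
    moreover have "\<nu> + rts u = l" using u by auto
    ultimately have "cas_exp \<nu> u > 0"
      using prim_dominant[OF py] prim_dominant[OF v] x y_def by (intro cas_exp_pos) auto
    then show ?thesis using z by simp
  qed
  then obtain c where c: "y = c *s v" by blast
  have "c \<noteq> 0"
  proof
    assume "c = 0"
    then show False using x(1) c by (simp add: y_def)
  qed
  then show ?thesis using c unfolding y_def by (intro exI[of _ x] exI[of _ c] conjI)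
qed

theorem generated_by_prim:
  assumes "m \<in> V \<mu>"
  shows "m \<in> UP prim \<mu>"
proof (rule ccontr)
  assume m0: "m \<notin> UP prim \<mu>"
  have sub: "subspace (UP prim l)" for l by (rule UP_subspace)
  obtain x where x: "Ew x m \<notin> UP prim (\<mu> + rts x)"
      "\<And>i. Ew (i # x) m \<in> UP prim (\<mu> + rts (i # x))"
    using top_exists[OF assms, of "UP prim"] m0 subspace_0[OF sub] by blast
  define m1 where "m1 = Ew x m"
  define l where "l = \<mu> + rts x"
  have m1: "m1 \<in> V l" "m1 \<notin> UP prim l" "\<And>i. E i m1 \<in> UP prim (l + rt i)"
    using x Ew_V[OF assms] by (auto simp: m1_def l_def ac_simps)
  have m1w: "Ew w m1 \<in> UP prim (l + rts w)" if ne: "w \<noteq> []" for w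
  proof -
    obtain w' i where w: "w = w' @ [i]" using ne by (cases w rule: rev_cases) auto
    show ?thesis unfolding w using UP_Ew[where P = prim and w = w', OF _ m1(3)[of i]] by (simp add: wact_append ac_simps)
  qed
  obtain N where N: "bd m1 N" using bd_ex[OF m1(1)] by blast
  \<comment> \<open>All levels but the bottom one involve a nonempty word in the E_i, so the Casimir
    operator is the identity on \<open>m1\<close> modulo the submodule.\<close>
  have level: "level l m1 (Suc k) \<in> UP prim l" for k
    unfolding level_def
  proof (rule tr_in[OF sub])
    fix u w :: "'i list" assume h: "length w = Suc k" "mset u = mset w"
    then have "w \<noteq> []" by auto
    from UP_Fw[OF m1w[OF this], of u] show "sw l w *s Fw u (Ew w m1) \<in> UP prim l"
      using rts_mset[OF h(2)] by (simp add: subspace_scale[OF sub])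
  qed
  have "Cas l m1 = (\<Sum>k<Suc N. level l m1 k)" by (rule Cas_eq) (rule bd_mono[OF N], simp)
  then have "Cas l m1 - m1 = (\<Sum>k<N. level l m1 (Suc k))"
    by (simp add: sum.lessThan_Suc_shift level_at_0 del: sum.lessThan_Suc)
  then have g: "Cas l m1 - m1 \<in> UP prim l" using level by (simp add: subspace_sum[OF sub])
  \<comment> \<open>Each spanning vector F_u v is an eigenvector with some eigenvalue c. For c = 1
    it serves as \<open>e\<close>; otherwise it is divided by c - 1 and serves as
    \<open>y\<close>.\<close>
  have "\<exists>y e. y \<in> UP prim l \<and> e \<in> UP prim l \<and> Cas l e = e \<and> Cas l y - y = g - e"
    if "g \<in> UP prim l" for g
    using that
  proof (rule UP_induct)
    have O0: "Cas l 0 = 0" using Cas_lin(2)[of 0 l 0 0] by simp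
    have V: "y \<in> V l" if "y \<in> UP prim l" for y using UP_V[of prim, OF _ that] by simp
    show "subspace {g. \<exists>y e. y \<in> UP prim l \<and> e \<in> UP prim l \<and> Cas l e = e \<and> Cas l y - y = g - e}"
      unfolding subspace_def
    proof (intro conjI allI ballI; clarify?)
      show "\<exists>y e. y \<in> UP prim l \<and> e \<in> UP prim l \<and> Cas l e = e \<and> Cas l y - y = 0 - e"
        by (intro exI[of _ 0]) (simp add: O0 subspace_0[OF sub])
    next
      fix g g' y y' e e'
      assume h: "y \<in> UP prim l" "e \<in> UP prim l" "Cas l e = e" "Cas l y - y = g - e"
        "y' \<in> UP prim l" "e' \<in> UP prim l" "Cas l e' = e'" "Cas l y' - y' = g' - e'"
      have "(Cas l y - y) + (Cas l y' - y') = (g - e) + (g' - e')" by (simp only: h)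
      then have "Cas l y + Cas l y' - (y + y') = g + g' - (e + e')" by (simp only: add_diff_add)
      note h1 = this
      show "\<exists>y e. y \<in> UP prim l \<and> e \<in> UP prim l \<and> Cas l e = e \<and> Cas l y - y = g + g' - e"
        by (rule exI[of _ "y + y'"], rule exI[of _ "e + e'"])
          (use h h1 in \<open>simp add: Cas_lin V subspace_add[OF sub]\<close>)
    next
      fix c g y e
      assume h: "y \<in> UP prim l" "e \<in> UP prim l" "Cas l e = e" "Cas l y - y = g - e"
      have "c *s (Cas l y - y) = c *s (g - e)" by (simp only: h)
      then have "c *s Cas l y - c *s y = c *s g - c *s e" by (simp only: scale_right_diff_distrib)
      note h1 = this
      show "\<exists>y e. y \<in> UP prim l \<and> e \<in> UP prim l \<and> Cas l e = e \<and> Cas l y - y = c *s g - e"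
        by (rule exI[of _ "c *s y"], rule exI[of _ "c *s e"])
          (use h h1 in \<open>simp add: Cas_lin(2)[OF V V] subspace_scale[OF sub]\<close>)
    qed
    fix u l' v assume h: "prim l' v" "l' - rts u = l"
    obtain c where "\<And>m. m \<in> V l' \<Longrightarrow> Cas (l' - rts u) (Fw u m) = c *s Fw u (Cas l' m)"
      using Fw_Cas by blast
    then have c: "Cas l (Fw u v) = c *s Fw u v"
      using Cas_prim[OF h(1)] h by (auto simp: prim_def)
    have gU: "Fw u v \<in> UP prim l" using UP_gen[where P = prim, OF h(1)] h(2) by auto
    show "\<exists>y e. y \<in> UP prim l \<and> e \<in> UP prim l \<and> Cas l e = e \<and> Cas l y - y = Fw u v - e"
    proof (cases "c = 1")
      case True
      show ?thesis
        by (rule exI[of _ 0], rule exI[of _ "Fw u v"]) (use True gU c in \<open>simp add: O0 subspace_0[OF sub]\<close>)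
    next
      case False
      have "Cas l (inverse (c - 1) *s Fw u v) - inverse (c - 1) *s Fw u v = (inverse (c - 1) * (c - 1)) *s Fw u v"
        by (simp add: Cas_lin(2)[OF V[OF gU] V[OF gU]] c scale_left_diff_distrib scale_right_diff_distrib algebra_simps
            flip: scale_left_diff_distrib)
      then have eq1: "Cas l (inverse (c - 1) *s Fw u v) - inverse (c - 1) *s Fw u v = Fw u v"
        using False by simp
      show ?thesis
        by (rule exI[of _ "inverse (c - 1) *s Fw u v"], rule exI[of _ 0])
          (use gU eq1 in \<open>simp add: O0 subspace_0[OF sub] subspace_scale[OF sub]\<close>)
    qed
  qed
  from this[OF g] obtain y e where y: "y \<in> UP prim l" and e: "e \<in> UP prim l" "Cas l e = e"
    and ye: "Cas l y - y = Cas l m1 - m1 - e" by blast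
  have yV: "y \<in> V l" "e \<in> V l" using UP_V[of prim] y e by auto
  define m2 where "m2 = m1 - y"
  have m2: "m2 \<in> V l" "m2 \<notin> UP prim l"
    using m1 yV y subspace_add[OF sub, of m2 l y] by (auto simp: m2_def)
  have "Cas l m2 = Cas l m1 - Cas l y"
    using Cas_lin(1)[OF m2(1) yV(1)] by (simp add: m2_def)
  moreover have "Cas l m1 - Cas l y = m1 - y + e" using ye[symmetric] by (simp add: algebra_simps)
  \<comment> \<open>Since \<open>e\<close> is fixed by the Casimir operator, this says that (Omega -
    1)^2 kills \<open>m2\<close>.\<close>
  ultimately have Om2: "Cas l m2 = m2 + e" by (simp only: m2_def)
  have E2: "E i m2 \<in> UP prim (l + rt i)" for i
    using m1(3)[of i] UP_E[of prim, OF _ y, of i] by (simp add: m2_def subspace_diff[OF sub])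
  \<comment> \<open>Dominance is obtained although \<open>m2\<close> is primitive only modulo the
    submodule.\<close>
  have dom: "n i l \<ge> 0" for i
    using string_dominant[of m2 l "UP prim" i, OF m2 E2 sub] UP_E[of prim] UP_F[of _ prim] by blast
  have "m2 \<noteq> 0" using m2 subspace_0[OF sub] by auto
  then obtain w where w: "Ew w m2 \<noteq> 0" "\<And>i. Ew (i # w) m2 = 0"
    using top_exists[OF m2(1), of "\<lambda>_. {0}"] by auto
  define t where "t = Ew w m2"
  have t: "prim (l + rts w) t" "t \<noteq> 0"
    using w Ew_V[OF m2(1)] by (auto simp: t_def prim_def)
  have "w \<noteq> []"
  proof
    assume "w = []"
    then have "prim l m2" using t by (simp add: t_def)
    then show False using UP_gen[of prim l m2 "[]"] m2 by simp
  qed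
  then have z: "cas_exp l w > 0" using dom prim_dominant[OF t] by (intro cas_exp_pos) auto
  obtain c where c: "c * c = q powi (- 2 * cas_exp l w)"
    "\<And>m. m \<in> V l \<Longrightarrow> Ew w (Cas l m) = c *s Cas (l + rts w) (Ew w m)"
    using Ew_Cas by blast
  \<comment> \<open>Two evaluations of E_w e, one from Omega m2 = m2 + e and one from Omega e = e,
    give c - 1 = c (c - 1), hence c = 1.\<close>
  have 1: "Ew w e = (c - 1) *s t"
    using c(2)[OF m2(1)] Cas_prim[OF t(1)] by (simp add: Om2 t_def scale_left_diff_distrib algebra_simps)
  have tV: "t \<in> V (l + rts w)" using t by (simp add: prim_def)
  have "Ew w e = c *s Cas (l + rts w) (Ew w e)" using c(2)[OF yV(2)] e(2) by simp
  then have "(c - 1) *s t = c *s (c - 1) *s t" unfolding 1 Cas_lin(2)[OF tV tV] Cas_prim[OF t(1)] .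
  then have "(c - 1 - c * (c - 1)) *s t = 0" by (simp only: scale_left_diff_distrib[of "c - 1"] scale_scale) simp
  then have "c - 1 - c * (c - 1) = 0" using t(2) by (simp only: scale_eq_0_iff) simp
  moreover have "(c - 1) * (c - 1) = - (c - 1 - c * (c - 1))" by (simp add: algebra_simps)
  ultimately have "(c - 1) * (c - 1) = 0" by simp
  then have "c = 1" by simp
  then have "q powi (- 2 * cas_exp l w) = 1" using c(1) by simp
  then show False using q_root z by fastforce
qed

end

section \<open>Evaluation of the coefficients at \<open>\<pi> = \<plusminus>1\<close>\<close>

definition ev :: "rat poly fract \<Rightarrow> qpi \<Rightarrow> rat poly fract" where
  "ev s x = qpi_fst x + s * qpi_snd x"

lemma ev_simps [simp]: "ev s (x + y) = ev s x + ev s y" "ev s (x - y) = ev s x - ev s y"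
    "ev s (- x) = - ev s x" "ev s 0 = 0" "ev s 1 = 1" "ev s (QPi a b) = a + s * b"
  by (simp_all add: ev_def plus_qpi_def minus_qpi_def uminus_qpi_def zero_qpi_def one_qpi_def algebra_simps)

lemma ev_mult:
  assumes "s * s = 1" shows "ev s (x * y) = ev s x * ev s y"
proof -
  have "ev s x * ev s y = qpi_fst x * qpi_fst y + (s * s) * (qpi_snd x * qpi_snd y) +
      s * (qpi_fst x * qpi_snd y + qpi_snd x * qpi_fst y)"
    by (simp add: ev_def algebra_simps)
  then show ?thesis by (simp add: assms ev_def times_qpi_def)
qed

text \<open>The values at 1 and -1 are a + b and a - b, which determine a and b because 2 is
  invertible.\<close>

lemma qpi_eqI:
  assumes "\<And>s. s * s = 1 \<Longrightarrow> ev s x = ev s y" shows "x = y"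
proof -
  have "ev 1 x = ev 1 y" "ev (-1) x = ev (-1) y" using assms by simp_all
  then have "qpi_fst x + qpi_snd x = qpi_fst y + qpi_snd y" "qpi_fst x - qpi_snd x = qpi_fst y - qpi_snd y"
    by (simp_all add: ev_def)
  then have "(qpi_fst x + qpi_snd x) + (qpi_fst x - qpi_snd x) = (qpi_fst y + qpi_snd y) + (qpi_fst y - qpi_snd y)"
    "(qpi_fst x + qpi_snd x) - (qpi_fst x - qpi_snd x) = (qpi_fst y + qpi_snd y) - (qpi_fst y - qpi_snd y)"
    by (simp_all only:)
  then have "2 * qpi_fst x = 2 * qpi_fst y" "2 * qpi_snd x = 2 * qpi_snd y" by simp_all
  then show ?thesis by (simp add: qpi_eq_iff)
qed

lemma ev_power: "s * s = 1 \<Longrightarrow> ev s (x ^ k) = ev s x ^ k"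
  by (induction k) (simp_all add: ev_mult)

text \<open>The denominator a^2 - b^2 of the inverse is the product of the two evaluations.\<close>

lemma qpi_unit:
  assumes "\<And>s. s * s = 1 \<Longrightarrow> ev s x \<noteq> 0"
  shows "x * inverse x = 1"
proof -
  have "ev 1 x * ev (-1) x \<noteq> 0" using assms[of 1] assms[of "-1"] by simp
  moreover have "ev 1 x * ev (-1) x = qpi_fst x ^ 2 - qpi_snd x ^ 2"
    by (simp add: ev_def algebra_simps power2_eq_square)
  ultimately have N: "qpi_fst x ^ 2 - qpi_snd x ^ 2 \<noteq> 0" by simp
  obtain N where "N = qpi_fst x ^ 2 - qpi_snd x ^ 2" by blast
  note N' = this
  have "qpi_fst x * (qpi_fst x / N) + qpi_snd x * (- qpi_snd x / N) = N / N"
    by (simp add: N' power2_eq_square flip: diff_divide_distrib)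
  then show ?thesis
    using N by (simp add: inverse_qpi_def times_qpi_def one_qpi_def flip: N')
qed

lemma ev_inverse:
  assumes "s * s = 1" "\<And>s. s * s = 1 \<Longrightarrow> ev s x \<noteq> 0"
  shows "ev s (inverse x) = inverse (ev s x)"
proof -
  have "ev s x * ev s (inverse x) = 1"
    using qpi_unit[OF assms(2)] ev_mult[OF assms(1), of x "inverse x"] by simp
  then show ?thesis by (simp add: inverse_unique)
qed

lemma ev_powi:
  assumes "s * s = 1" "\<And>s. s * s = 1 \<Longrightarrow> ev s x \<noteq> 0"
  shows "ev s (x powi z) = ev s x powi z"
  using assms by (simp add: power_int_def ev_power ev_inverse)

definition qf :: "rat poly fract" where "qf = Fract [:0, 1:] 1"

lemma qf_nz [simp]: "qf \<noteq> 0"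
  by (simp add: qf_def Zero_fract_def eq_fract)

lemma qf_pow: "qf ^ k = Fract (monom 1 k) 1"
  by (induction k) (simp_all add: qf_def One_fract_def monom_altdef flip: one_pCons)

lemma qf_root: "qf powi z = 1 \<Longrightarrow> z = 0"
proof -
  have pos: "k = 0" if "qf ^ k = 1" for k
  proof -
    have "monom 1 k = (1 :: rat poly)" using that by (simp add: qf_pow One_fract_def eq_fract)
    then have "degree (monom (1 :: rat) k) = 0" by simp
    then show ?thesis by (simp add: degree_monom_eq)
  qed
  assume "qf powi z = 1"
  then have "qf ^ nat \<bar>z\<bar> = 1"
    by (cases "z \<ge> 0") (simp_all add: power_int_def power_inverse)
  then show "z = 0" using pos by fastforce
qed

lemma ev_qq [simp]: "ev s qq = qf" and ev_pp [simp]: "ev s pp = s"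
  by (simp_all add: qq_def pp_def qf_def)

lemma sq_nz: "s * s = 1 \<Longrightarrow> s \<noteq> (0 :: rat poly fract)"
  by auto

lemma ev_qq_powi: "s * s = 1 \<Longrightarrow> ev s (qq powi z) = qf powi z"
  by (subst ev_powi) simp_all

lemma ev_pp_powi: "s * s = 1 \<Longrightarrow> ev s (pp powi z) = s powi z"
  by (subst ev_powi) (simp_all add: sq_nz)

lemma qq_powi_add: "qq powi (y + z) = qq powi y * qq powi z"
  by (rule qpi_eqI) (simp add: ev_mult ev_qq_powi power_int_add)

lemma pp_powi_add: "pp powi (y + z) = pp powi y * pp powi z"
  by (rule qpi_eqI) (simp add: ev_mult ev_pp_powi power_int_add sq_nz)

section \<open>Linear functionals on finitely supported functions\<close>

text \<open>The value at \<open>x\<close> of the linear functional that takes the values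
  \<open>f\<close> on the basis. Sums over \<open>keys\<close> are brought to this form because it
  is additive in \<open>x\<close> even when coefficients cancel.\<close>

definition pair :: "('a \<Rightarrow>\<^sub>0 qpi) \<Rightarrow> ('a \<Rightarrow> qpi) \<Rightarrow> qpi" where
  "pair x f = (\<Sum>k\<in>Poly_Mapping.keys x. Poly_Mapping.lookup x k * f k)"

lemma pair_superset:
  assumes "finite S" "Poly_Mapping.keys x \<subseteq> S"
  shows "pair x f = (\<Sum>k\<in>S. Poly_Mapping.lookup x k * f k)"
  unfolding pair_def by (rule sum.mono_neutral_left) (use assms in \<open>auto simp: in_keys_iff\<close>)

lemma pair_add [simp]: "pair (x + y) f = pair x f + pair y f"
proof -
  let ?S = "Poly_Mapping.keys x \<union> Poly_Mapping.keys y"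
  have "Poly_Mapping.keys (x + y) \<subseteq> ?S" by (rule keys_add)
  then show ?thesis
    by (simp add: pair_superset[of ?S] lookup_add distrib_right sum.distrib)
qed

lemma pair_0 [simp]: "pair 0 f = 0"
  by (simp add: pair_def)

lemma pair_single [simp]: "pair (Poly_Mapping.single k c) f = c * f k"
  by (simp add: pair_def lookup_single)

lemma pair_sum [simp]: "pair (sum g S) f = (\<Sum>s\<in>S. pair (g s) f)"
  by (induction S rule: infinite_finite_induct) simp_all

lemma lookup_csmult [simp]: "Poly_Mapping.lookup (c *c x) k = c * Poly_Mapping.lookup x k"
  by (simp add: csmult_def Poly_Mapping.map.rep_eq when_def)

lemma pair_csmult [simp]: "pair (c *c x) f = c * pair x f"
proof -
  have "Poly_Mapping.keys (c *c x) \<subseteq> Poly_Mapping.keys x" by (auto simp: in_keys_iff)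
  then have "pair (c *c x) f = (\<Sum>k\<in>Poly_Mapping.keys x. Poly_Mapping.lookup (c *c x) k * f k)"
    by (intro pair_superset) auto
  then show ?thesis by (simp add: pair_def sum_distrib_left mult.assoc)
qed

lemma pair_lin: "pair x (\<lambda>k. f k + g k) = pair x f + pair x g" "pair x (\<lambda>k. c * f k) = c * pair x f"
    "pair x (\<lambda>k. f k * c) = pair x f * c" "pair x (\<lambda>k. 0) = 0"
  by (simp_all add: pair_def algebra_simps sum.distrib sum_distrib_left)

lemma pair_swap: "pair x (\<lambda>u. pair y (\<lambda>v. f u v)) = pair y (\<lambda>v. pair x (\<lambda>u. f u v))"
  unfolding pair_def sum_distrib_left by (subst sum.swap) (simp add: mult.left_commute)

lemma csmult_simps [simp]: "c *c (x + y) = c *c x + c *c y" "(c + e) *c x = c *c x + e *c x"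
  "c *c e *c x = (c * e) *c x" "1 *c x = x" "0 *c x = 0" "c *c (0 :: 'a \<Rightarrow>\<^sub>0 qpi) = 0"
  by (rule poly_mapping_eqI, simp add: lookup_add algebra_simps)+

lemma csmult_single [simp]: "c *c Poly_Mapping.single k e = Poly_Mapping.single k (c * e)"
  by (rule poly_mapping_eqI) (simp add: lookup_single when_def)

lemma poly_mapping_single_sum: "x = (\<Sum>k\<in>Poly_Mapping.keys x. Poly_Mapping.single k (Poly_Mapping.lookup x k))"
  by (rule poly_mapping_eqI)
    (simp add: lookup_sum lookup_single when_def in_keys_iff sum.delta)

lemma free_induct [case_names zero add single]:
  assumes "P 0" "\<And>x y. P x \<Longrightarrow> P y \<Longrightarrow> P (x + y)" "\<And>k c. P (Poly_Mapping.single k c)"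
  shows "P (x :: 'a \<Rightarrow>\<^sub>0 qpi)"
proof -
  have "P (\<Sum>k\<in>S. Poly_Mapping.single k (Poly_Mapping.lookup x k))" for S
    by (induction S rule: infinite_finite_induct) (auto intro: assms)
  then show ?thesis by (subst poly_mapping_single_sum)
qed

lemma one_word: "1 = word []"
  by (simp add: word_def zero_list_def[symmetric])

lemma word_mult: "word u * word v = word (u @ v)"
  by (simp add: word_def mult_single plus_list_def)

lemma single_word: "Poly_Mapping.single u c = c *c word u"
  by (simp add: word_def)

lemma pair_word [simp]: "pair (word u) f = f u"
  by (simp add: word_def)

lemma pair_mult: "pair (x * y) f = pair x (\<lambda>u. pair y (\<lambda>v. f (u @ v)))"
proof (induction x rule: free_induct)
  case (single u c)
  show ?case
  proof (induction y rule: free_induct)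
    case (single v e)
    then show ?case by (simp add: mult_single plus_list_def)
  qed (simp_all add: distrib_left)
qed (simp_all add: distrib_right)

lemma bilinear_pair:
  assumes "bilinear_form B"
  shows "B x y = pair x (\<lambda>u. pair y (\<lambda>v. B (word u) (word v)))"
proof -
  have add: "B (x + x') y = B x y + B x' y" "B x (y + y') = B x y + B x y'"
    and sc: "B (c *c x) y = c * B x y" "B x (c *c y) = c * B x y" for x x' y y' c
    using assms by (auto simp: bilinear_form_def)
  have z: "B 0 y = 0" "B x 0 = 0" for x y
    using sc(1)[of 0 0 y] sc(2)[of x 0 0] by simp_all
  show ?thesis
  proof (induction x rule: free_induct)
    case (single u c)
    show ?case
    proof (induction y rule: free_induct)
      case (single v e)
      show ?case by (simp add: single_word sc)
    qed (simp_all add: add z distrib_left)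
  qed (simp_all add: add z pair_lin)
qed

section \<open>The bilinear form on words\<close>

lemma pair_tensor: "pair (tensor x y) f = pair x (\<lambda>u. pair y (\<lambda>v. f (u, v)))"
  by (simp add: tensor_def) (simp add: pair_def sum_distrib_left mult.assoc)

definition twist :: "('i::finite, 'y, 'x) root_data \<Rightarrow> 'i list \<Rightarrow> 'i list \<Rightarrow> qpi" where
  "twist D u v = qq powi dotZ D (wt u) (wt v) * pp powi (par D (wt u) * par D (wt v))"

lemma wt_simps [simp]: "wt [] i = 0" "wt (j # u) i = (if j = i then 1 else 0) + wt u i"
  "wt (u @ v) i = wt u i + wt v i"
  by (simp_all add: wt_def)

lemma dotZ_wt: "dotZ D (wt (u @ v)) \<mu> = dotZ D (wt u) \<mu> + dotZ D (wt v) \<mu>"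
    "dotZ D \<mu> (wt (u @ v)) = dotZ D \<mu> (wt u) + dotZ D \<mu> (wt v)"
    "dotZ D (wt []) \<mu> = 0" "dotZ D \<mu> (wt []) = 0"
  by (simp_all add: dotZ_def algebra_simps sum.distrib)

lemma par_wt: "par D (wt (u @ v)) = par D (wt u) + par D (wt v)" "par D (wt []) = 0"
  by (simp_all add: par_def sum.distrib)

lemma twist_append: "twist D (u @ v) w = twist D u w * twist D v w" "twist D w (u @ v) = twist D w u * twist D w v"
  by (simp_all add: twist_def dotZ_wt par_wt qq_powi_add pp_powi_add distrib_left distrib_right ac_simps)

lemma twist_Nil [simp]: "twist D [] w = 1" "twist D w [] = 1"
  by (simp_all add: twist_def dotZ_wt par_wt)

lemma twist_Cons: "twist D w (i # u) = twist D w [i] * twist D w u"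
  using twist_append(2)[of D w "[i]" u] by simp

lemma twist_mset:
  assumes "mset u = mset v" shows "twist D w u = twist D w v"
proof -
  have "wt u = wt v" using assms by (simp add: wt_def fun_eq_iff flip: count_mset)
  then show ?thesis by (simp add: twist_def)
qed

lemma pair_tmult: "pair (tmult D s t) f =
  pair s (\<lambda>x. pair t (\<lambda>y. twist D (snd x) (fst y) * f (fst x @ fst y, snd x @ snd y)))"
proof -
  have "pair (tmult D s t) f = (\<Sum>x\<in>Poly_Mapping.keys s. \<Sum>y\<in>Poly_Mapping.keys t.
      Poly_Mapping.lookup s x * Poly_Mapping.lookup t y * twist D (snd x) (fst y) *
      f (fst x @ fst y, snd x @ snd y))"
    by (simp add: tmult_def case_prod_unfold twist_def mult.assoc)
  then show ?thesis by (simp add: pair_def sum_distrib_left mult.assoc)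
qed

lemma pair_gen [simp]: "pair (gen i) f = f [i]" and pair_one [simp]: "pair 1 f = f []"
  by (simp_all add: gen_def one_word)

lemma coprod_Nil [simp]: "pair (coprod_word D []) f = f ([], [])"
  by (simp add: pair_tensor)

text \<open>The left factor of r(theta_j) prepends j directly, the right factor first passes the
  left word. This recursion stands in for \<open>tmult\<close> from here on.\<close>

lemma coprod_Cons [simp]: "pair (coprod_word D (j # w)) f =
    pair (coprod_word D w) (\<lambda>x. f (j # fst x, snd x) + twist D [j] (fst x) * f (fst x, j # snd x))"
  by (simp add: pair_tmult pair_tensor pair_lin(1))

declare coprod_word.simps [simp del]

lemma pair_coprod: "pair (coprod D x) f = pair x (\<lambda>w. pair (coprod_word D w) f)"
  by (simp add: coprod_def) (simp add: pair_def)

text \<open>The coproduct preserves the weight, so only pairs of words with the letters of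
  \<open>w\<close> occur.\<close>

lemma pair_coprod_cong:
  assumes "\<And>a c. mset a + mset c = mset w \<Longrightarrow> f (a, c) = g (a, c)"
  shows "pair (coprod_word D w) f = pair (coprod_word D w) g"
  using assms
proof (induction w arbitrary: f g)
  case (Cons j w)
  show ?case unfolding coprod_Cons
    by (rule Cons.IH) (simp add: Cons.prems)
qed simp

text \<open>By induction on \<open>w\<close>, both sides reduce to inserting j into one of three
  factors. The twists agree because the twist past a word depends only on its letters.\<close>

lemma coprod_coassoc:
  "pair (coprod_word D w) (\<lambda>x. pair (coprod_word D (snd x)) (\<lambda>y. g (fst x) (fst y) (snd y))) =
   pair (coprod_word D w) (\<lambda>x. pair (coprod_word D (fst x)) (\<lambda>y. g (fst y) (snd y) (snd x)))"
proof (induction w arbitrary: g)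
  case (Cons j w)
  \<comment> \<open>The three ways of inserting j into a threefold tensor, as seen by
    \<open>g\<close>.\<close>
  define h where "h = (\<lambda>a c e. g (j # a) c e + twist D [j] a * g a (j # c) e + twist D [j] (a @ c) * g a c (j # e))"
  have "pair (coprod_word D (j # w)) (\<lambda>x. pair (coprod_word D (snd x)) (\<lambda>y. g (fst x) (fst y) (snd y))) =
      pair (coprod_word D w) (\<lambda>x. pair (coprod_word D (snd x)) (\<lambda>y. h (fst x) (fst y) (snd y)))"
    by (simp add: h_def twist_append mult.assoc distrib_left add.assoc flip: pair_lin(1,2))
  also have "\<dots> = pair (coprod_word D w) (\<lambda>x. pair (coprod_word D (fst x)) (\<lambda>y. h (fst y) (snd y) (snd x)))"
    by (rule Cons.IH)
  also have "\<dots> = pair (coprod_word D w) (\<lambda>x. pair (coprod_word D (fst x))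
      (\<lambda>y. g (j # fst y) (snd y) (snd x) + twist D [j] (fst y) * g (fst y) (j # snd y) (snd x) +
        twist D [j] (fst x) * g (fst y) (snd y) (j # snd x)))"
  proof (rule pair_coprod_cong)
    fix a c :: "'a list"
    show "pair (coprod_word D (fst (a, c))) (\<lambda>y. h (fst y) (snd y) (snd (a, c))) =
      pair (coprod_word D (fst (a, c))) (\<lambda>y. g (j # fst y) (snd y) (snd (a, c)) +
        twist D [j] (fst y) * g (fst y) (j # snd y) (snd (a, c)) +
        twist D [j] (fst (a, c)) * g (fst y) (snd y) (j # snd (a, c)))"
    proof (rule pair_coprod_cong)
      fix y z :: "'a list" assume "mset y + mset z = mset (fst (a, c))"
      then have "twist D [j] (y @ z) = twist D [j] a" by (intro twist_mset) simp
      then show "h (fst (y, z)) (snd (y, z)) (snd (a, c)) = g (j # fst (y, z)) (snd (y, z)) (snd (a, c)) +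
        twist D [j] (fst (y, z)) * g (fst (y, z)) (j # snd (y, z)) (snd (a, c)) +
        twist D [j] (fst (a, c)) * g (fst (y, z)) (snd (y, z)) (j # snd (a, c))"
        by (simp add: h_def)
    qed
  qed
  also have "\<dots> = pair (coprod_word D (j # w)) (\<lambda>x. pair (coprod_word D (fst x)) (\<lambda>y. g (fst y) (snd y) (snd x)))"
    by (simp add: mult.assoc flip: pair_lin(1,2))
  finally show ?case .
qed simp

definition ciq :: "('i, 'y, 'x) root_data \<Rightarrow> 'i \<Rightarrow> qpi" where
  "ciq D i = inverse (1 - ppi D i * qi D i powi (- 2))"

text \<open>The axioms of \<open>is_form\<close> restricted to basis words; there they can be solved
  by recursion, and \<open>wform_is_form\<close> extends a solution bilinearly.\<close>

definition wform :: "('i::finite, 'y, 'x) root_data \<Rightarrow> ('i list \<Rightarrow> 'i list \<Rightarrow> qpi) \<Rightarrow> bool" where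
  "wform D b \<longleftrightarrow> b [] [] = 1 \<and> (\<forall>i j. b [i] [j] = (if i = j then ciq D i else 0)) \<and>
     (\<forall>u v w. b u (v @ w) = pair (coprod_word D u) (\<lambda>x. b (fst x) v * b (snd x) w)) \<and>
     (\<forall>u v w. b (u @ v) w = pair (coprod_word D w) (\<lambda>x. b u (fst x) * b v (snd x)))"

lemma tform_pair: "tform B s t =
    pair s (\<lambda>x. pair t (\<lambda>y. B (word (fst x)) (word (fst y)) * B (word (snd x)) (word (snd y))))"
  by (simp add: tform_def pair_def case_prod_unfold sum_distrib_left mult.assoc)

lemma is_form_wform:
  assumes "is_form D B" shows "wform D (\<lambda>u v. B (word u) (word v))"
  unfolding wform_def
proof (intro conjI allI)
  note h = assms[unfolded is_form_def]
  show "B (word []) (word []) = 1" using h by (simp add: one_word)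
  show "B (word [i]) (word [j]) = (if i = j then ciq D i else 0)" for i j
    using h by (simp add: gen_def ciq_def)
  show "B (word u) (word (v @ w)) = pair (coprod_word D u) (\<lambda>x. B (word (fst x)) (word v) * B (word (snd x)) (word w))" for u v w
  proof -
    have "B (word u) (word v * word w) = tform B (coprod D (word u)) (tensor (word v) (word w))" using h by blast
    then show ?thesis by (simp add: word_mult tform_pair pair_coprod pair_tensor)
  qed
  show "B (word (u @ v)) (word w) = pair (coprod_word D w) (\<lambda>x. B (word u) (word (fst x)) * B (word v) (word (snd x)))" for u v w
  proof -
    have "B (word u * word v) (word w) = tform B (tensor (word u) (word v)) (coprod D (word w))" using h by blast
    then show ?thesis by (simp add: word_mult tform_pair pair_coprod pair_tensor)
  qed
qed

lemma wform_is_form: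
  assumes "wform D b" shows "is_form D (\<lambda>x y. pair x (\<lambda>u. pair y (b u)))"
proof -
  have b: "b [] [] = 1" "b [i] [j] = (if i = j then ciq D i else 0)"
      "b u (v @ w) = pair (coprod_word D u) (\<lambda>x. b (fst x) v * b (snd x) w)"
      "b (u @ v) w = pair (coprod_word D w) (\<lambda>x. b u (fst x) * b v (snd x))" for i j u v w
    using assms unfolding wform_def by blast+
  have "bilinear_form (\<lambda>x y. pair x (\<lambda>u. pair y (b u)))"
    by (simp add: bilinear_form_def pair_lin)
  moreover have "pair x (\<lambda>u. pair (y' * y'') (b u)) =
      tform (\<lambda>x y. pair x (\<lambda>u. pair y (b u))) (coprod D x) (tensor y' y'')" for x y' y''
  proof -
    have "pair x (\<lambda>u. pair (y' * y'') (b u)) = pair x (\<lambda>u. pair y' (\<lambda>v. pair y'' (\<lambda>w.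
        pair (coprod_word D u) (\<lambda>z. b (fst z) v * b (snd z) w))))"
      by (simp only: pair_mult b(3))
    also have "\<dots> = pair x (\<lambda>u. pair (coprod_word D u) (\<lambda>z. pair y' (\<lambda>v. pair y'' (\<lambda>w. b (fst z) v * b (snd z) w))))"
      by (simp only: pair_swap[of _ "coprod_word D _"])
    finally show ?thesis by (simp add: tform_pair pair_coprod pair_tensor)
  qed
  moreover have "pair (x * x') (\<lambda>u. pair y (b u)) =
      tform (\<lambda>x y. pair x (\<lambda>u. pair y (b u))) (tensor x x') (coprod D y)" for x x' y
    unfolding pair_mult tform_pair pair_coprod pair_tensor
    by (rule arg_cong[where f = "pair x"], rule ext, rule arg_cong[where f = "pair x'"], rule ext,
        rule arg_cong[where f = "pair y"], rule ext) (simp add: b(4))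
  moreover have "(if i = j then ciq D i else 0) = (if i = j then inverse (1 - ppi D i * qi D i powi - 2) else 0)" for i j
    by (simp add: ciq_def)
  ultimately show ?thesis
    unfolding is_form_def using b(1,2) by simp
qed

section \<open>Uniqueness and symmetry of the form on words\<close>

lemma wform_swap: "wform D b \<Longrightarrow> wform D (\<lambda>u v. b v u)"
  unfolding wform_def by (auto simp: mult.commute)

lemma wform_Nil:
  assumes "wform D b"
  shows "b [] v = (if v = [] then 1 else 0)"
proof (cases v)
  case Nil
  then show ?thesis using assms by (simp add: wform_def)
next
  case (Cons j w)
  have b: "b [] [] = 1" "b u (v @ w) = pair (coprod_word D u) (\<lambda>x. b (fst x) v * b (snd x) w)"
      "b (u @ v) w = pair (coprod_word D w) (\<lambda>x. b u (fst x) * b v (snd x))" for u v w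
    using assms unfolding wform_def by blast+
  \<comment> \<open>The empty word is split as a product of two empty words, and the coproduct of
    theta_j has two terms.\<close>
  have "b [] [j] = b [] [j] + b [] [j]" using b(3)[of "[]" "[]" "[j]"] by (simp add: b(1))
  then have "b [] [j] = 0" by simp
  then show ?thesis using b(2)[of "[]" "[j]" w] Cons by simp
qed

lemma wform_single:
  assumes "wform D b"
  shows "b [i] v = (if v = [i] then ciq D i else 0)"
proof (cases v)
  case Nil
  then show ?thesis using wform_Nil[OF wform_swap[OF assms], of "[i]"] by simp
next
  case (Cons j w)
  have b: "b [i] [j] = (if i = j then ciq D i else 0)"
    "b [i] ([j] @ w) = pair (coprod_word D [i]) (\<lambda>x. b (fst x) [j] * b (snd x) w)"
    using assms unfolding wform_def by blast+
  show ?thesis using b wform_Nil[OF assms] Cons by auto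
qed

lemma wform_Cons:
  assumes "wform D b"
  shows "b (i # u) v = ciq D i * pair (coprod_word D v) (\<lambda>x. if fst x = [i] then b u (snd x) else 0)"
proof -
  have "b ([i] @ u) v = pair (coprod_word D v) (\<lambda>x. b [i] (fst x) * b u (snd x))"
    using assms unfolding wform_def by blast
  also have "\<dots> = pair (coprod_word D v) (\<lambda>x. ciq D i * (if fst x = [i] then b u (snd x) else 0))"
    by (rule pair_coprod_cong) (simp add: wform_single[OF assms])
  finally show ?thesis by (simp add: pair_lin)
qed

lemma wform_snoc:
  assumes "wform D b"
  shows "b (u @ [i]) v = ciq D i * pair (coprod_word D v) (\<lambda>x. if snd x = [i] then b u (fst x) else 0)"
proof -
  have "b (u @ [i]) v = pair (coprod_word D v) (\<lambda>x. b u (fst x) * b [i] (snd x))"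
    using assms unfolding wform_def by blast
  also have "\<dots> = pair (coprod_word D v) (\<lambda>x. ciq D i * (if snd x = [i] then b u (fst x) else 0))"
    by (rule pair_coprod_cong) (simp add: wform_single[OF assms])
  finally show ?thesis by (simp add: pair_lin)
qed

lemma wform_unique:
  assumes "wform D b" "wform D b'" shows "b u v = b' u v"
proof (induction u arbitrary: v)
  case Nil
  show ?case by (simp add: wform_Nil[OF assms(1)] wform_Nil[OF assms(2)])
next
  case (Cons i u)
  show ?case by (simp add: wform_Cons[OF assms(1)] wform_Cons[OF assms(2)] Cons cong: if_cong)
qed

text \<open>The axioms are invariant under exchanging the arguments, so uniqueness forces
  symmetry.\<close>

lemma wform_sym: "wform D b \<Longrightarrow> b u v = b v u"
  by (rule wform_unique[of D b "\<lambda>u v. b v u"]) (simp_all only: wform_swap)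

locale super_datum =
  fixes D :: "('i::finite, 'y, 'x) root_data"
  assumes scd: "super_cartan_datum D"
begin

section \<open>Existence of the form on words\<close>

lemma dot_sym: "dot D i j = dot D j i"
  using scd by (auto simp: super_cartan_datum_def)

lemma twist_sym: "twist D [i] [j] = twist D [j] [i]"
proof -
  have "dotZ D (wt [i]) (wt [j]) = dotZ D (wt [j]) (wt [i])"
    unfolding dotZ_def by (subst sum.swap) (simp add: dot_sym mult.commute mult.left_commute)
  then show ?thesis by (simp add: twist_def mult.commute)
qed

text \<open>The left skew derivation, dualized: the part of the coproduct whose first factor is
  theta_i.\<close>

definition dl :: "'i \<Rightarrow> 'i list \<Rightarrow> ('i list \<Rightarrow> qpi) \<Rightarrow> qpi" where
  "dl i w g = pair (coprod_word D w) (\<lambda>x. if fst x = [i] then g (snd x) else 0)"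

lemma pair_Nil_left: "pair (coprod_word D w) (\<lambda>x. if fst x = [] then g (snd x) else 0) = g w"
  by (induction w arbitrary: g) (simp_all add: if_distrib[of "\<lambda>x. _ * x"] cong: if_cong)

lemma pair_Nil_right: "pair (coprod_word D w) (\<lambda>x. if snd x = [] then g (fst x) else 0) = g w"
  by (induction w arbitrary: g) (simp_all cong: if_cong)

lemma dl_Nil [simp]: "dl i [] g = 0"
  by (simp add: dl_def)

lemma dl_Cons: "dl i (j # w) g = (if i = j then g w else 0) + twist D [i] [j] * dl i w (\<lambda>v. g (j # v))"
proof -
  have "dl i (j # w) g = pair (coprod_word D w) (\<lambda>x. (if fst x = [] then (if i = j then g (snd x) else 0) else 0) +
      twist D [i] [j] * (if fst x = [i] then g (j # snd x) else 0))"
    unfolding dl_def coprod_Cons by (rule pair_coprod_cong) (auto simp: twist_sym)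
  also have "\<dots> = (if i = j then g w else 0) + twist D [i] [j] * dl i w (\<lambda>v. g (j # v))"
    unfolding pair_lin(1,2) pair_Nil_left[of w "\<lambda>v. if i = j then g v else 0"] dl_def ..
  finally show ?thesis .
qed

text \<open>The twisted Leibniz rule; it makes \<open>b0\<close> compatible with products in its
  second argument.\<close>

lemma dl_append: "dl i (v @ w) g = dl i v (\<lambda>c. g (c @ w)) + twist D [i] v * dl i w (\<lambda>c. g (v @ c))"
proof (induction v arbitrary: g)
  case (Cons j v)
  show ?case
    unfolding append_Cons dl_Cons Cons.IH twist_Cons[of D "[i]" j v] by (simp add: algebra_simps)
qed simp

lemma dl_lin: "dl i w (\<lambda>c. pair x (\<lambda>z. f z c)) = pair x (\<lambda>z. dl i w (f z))"
    "dl i w (\<lambda>c. t * h c) = t * dl i w h" "dl i w (\<lambda>c. h c * t) = dl i w h * t"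
proof -
  have z: "(if P then pair x f' else 0) = pair x (\<lambda>z. if P then f' z else 0)" for P x and f' :: "'z \<Rightarrow> qpi"
    by (simp add: pair_lin)
  show "dl i w (\<lambda>c. pair x (\<lambda>z. f z c)) = pair x (\<lambda>z. dl i w (f z))"
    unfolding dl_def z by (rule pair_swap)
  show "dl i w (\<lambda>c. t * h c) = t * dl i w h"
    unfolding dl_def by (simp add: if_distrib[of "\<lambda>x. _ * x"] cong: if_cong flip: pair_lin(2))
  show "dl i w (\<lambda>c. h c * t) = dl i w h * t"
    unfolding dl_def by (simp add: if_distrib[of "\<lambda>x. x * _"] cong: if_cong flip: pair_lin(3))
qed

text \<open>The only possible form: \<open>wform_Cons\<close> prescribes this recursion.\<close>

primrec b0 :: "'i list \<Rightarrow> 'i list \<Rightarrow> qpi" where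
  "b0 [] v = (if v = [] then 1 else 0)"
| "b0 (i # u) v = ciq D i * dl i v (b0 u)"

lemma dl_mset: "(\<And>c. mset v = add_mset i (mset c) \<Longrightarrow> g c = 0) \<Longrightarrow> dl i v g = 0"
proof -
  assume h: "\<And>c. mset v = add_mset i (mset c) \<Longrightarrow> g c = 0"
  have "dl i v g = pair (coprod_word D v) (\<lambda>x. 0)"
    unfolding dl_def by (rule pair_coprod_cong) (use h in auto)
  then show ?thesis by (simp add: pair_lin)
qed

lemma b0_mset: "mset u \<noteq> mset v \<Longrightarrow> b0 u v = 0"
proof (induction u arbitrary: v)
  case (Cons i u)
  have "dl i v (b0 u) = 0"
    by (rule dl_mset) (use Cons in auto)
  then show ?case by simp
qed auto

text \<open>Prepending a letter to \<open>u\<close> differentiates \<open>w\<close>, so the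
  induction step is coassociativity of the coproduct.\<close>

lemma b0_append_left: "b0 (u @ v) w = pair (coprod_word D w) (\<lambda>x. b0 u (fst x) * b0 v (snd x))"
proof (induction u arbitrary: w)
  case Nil
  have "pair (coprod_word D w) (\<lambda>x. b0 [] (fst x) * b0 v (snd x)) =
      pair (coprod_word D w) (\<lambda>x. if fst x = [] then b0 v (snd x) else 0)"
    by (rule pair_coprod_cong) simp
  then show ?case by (simp add: pair_Nil_left)
next
  case (Cons i u)
  define g where "g = (\<lambda>a c e. (if a = [i] then b0 u c else 0) * b0 v e)"
  have "dl i w (b0 (u @ v)) = pair (coprod_word D w) (\<lambda>x. pair (coprod_word D (snd x)) (\<lambda>y. g (fst x) (fst y) (snd y)))"
    unfolding dl_def Cons by (rule pair_coprod_cong) (simp add: g_def pair_lin)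
  also have "\<dots> = pair (coprod_word D w) (\<lambda>x. pair (coprod_word D (fst x)) (\<lambda>y. g (fst y) (snd y) (snd x)))"
    by (rule coprod_coassoc)
  also have "\<dots> = pair (coprod_word D w) (\<lambda>x. dl i (fst x) (b0 u) * b0 v (snd x))"
    by (simp add: g_def dl_def pair_lin)
  finally show ?case by (simp add: pair_lin mult.assoc)
qed

text \<open>Induction on \<open>u\<close>: the derivation of a product splits by the Leibniz rule,
  matching the two terms in the coproduct of i # u.\<close>

lemma b0_append_right: "b0 u (v @ w) = pair (coprod_word D u) (\<lambda>x. b0 (fst x) v * b0 (snd x) w)"
proof (induction u arbitrary: v w)
  case Nil
  show ?case by simp
next
  case (Cons i u)
  have "b0 (i # u) (v @ w) = ciq D i * (pair (coprod_word D u) (\<lambda>z. dl i v (b0 (fst z)) * b0 (snd z) w) +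
      pair (coprod_word D u) (\<lambda>z. twist D [i] v * (b0 (fst z) v * dl i w (b0 (snd z)))))"
    by (simp add: dl_append Cons dl_lin pair_lin)
  also have "\<dots> = pair (coprod_word D u) (\<lambda>z. b0 (i # fst z) v * b0 (snd z) w + twist D [i] v * (b0 (fst z) v * b0 (i # snd z) w))"
    by (simp add: distrib_left mult.assoc mult.left_commute flip: pair_lin(1,2))
  also have "\<dots> = pair (coprod_word D u) (\<lambda>z. b0 (i # fst z) v * b0 (snd z) w + twist D [i] (fst z) * (b0 (fst z) v * b0 (i # snd z) w))"
  proof (rule pair_coprod_cong)
    fix a c :: "'i list"
    \<comment> \<open>The Leibniz rule twists past \<open>v\<close>, the coproduct past
      \<open>a\<close>; the two agree wherever \<open>b0 a v\<close> is not 0, as the words then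
      have equal letters.\<close>
    have "twist D [i] v * b0 a v = twist D [i] a * b0 a v"
      using twist_mset[of v a D "[i]"] b0_mset[of a v] by (cases "mset a = mset v") auto
    then show "b0 (i # fst (a, c)) v * b0 (snd (a, c)) w + twist D [i] v * (b0 (fst (a, c)) v * b0 (i # snd (a, c)) w) =
      b0 (i # fst (a, c)) v * b0 (snd (a, c)) w + twist D [i] (fst (a, c)) * (b0 (fst (a, c)) v * b0 (i # snd (a, c)) w)"
      by (simp add: mult.assoc[symmetric])
  qed
  finally show ?case by simp
qed

lemma wform_b0: "wform D b0"
  unfolding wform_def
proof (intro conjI allI b0_append_left b0_append_right)
  show "b0 [i] [j] = (if i = j then ciq D i else 0)" for i j
    by (simp add: dl_Cons)
qed simp

lemma the_form: "is_form D (the_form D)"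
proof -
  have "\<exists>!B. is_form D B"
  proof (rule ex_ex1I)
    show "\<exists>B. is_form D B" using wform_is_form[OF wform_b0] by blast
    fix B B' assume h: "is_form D B" "is_form D B'"
    have "bilinear_form B" "bilinear_form B'" using h by (auto simp: is_form_def)
    then show "B = B'"
      using wform_unique[OF is_form_wform[OF h(1)] is_form_wform[OF h(2)]]
      by (intro ext) (subst (1 2) bilinear_pair; simp)
  qed
  then show ?thesis unfolding the_form_def by (rule theI')
qed

definition fb :: "'i list \<Rightarrow> 'i list \<Rightarrow> qpi" where
  "fb u v = the_form D (word u) (word v)"

lemma wform_fb: "wform D fb"
  using is_form_wform[OF the_form] by (simp add: fb_def[abs_def])

lemma the_form_pair: "the_form D x y = pair x (\<lambda>u. pair y (\<lambda>v. fb u v))"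
  unfolding fb_def by (rule bilinear_pair) (use the_form in \<open>simp add: is_form_def\<close>)

lemma radical_iff: "x \<in> radical D \<longleftrightarrow> (\<forall>v. pair x (\<lambda>u. fb u v) = 0)"
proof
  assume "x \<in> radical D"
  then have "the_form D x (word v) = 0" for v by (simp add: radical_def)
  then show "\<forall>v. pair x (\<lambda>u. fb u v) = 0" by (simp add: the_form_pair)
next
  assume "\<forall>v. pair x (\<lambda>u. fb u v) = 0"
  then show "x \<in> radical D"
    by (simp add: radical_def the_form_pair pair_swap[of x] pair_lin)
qed

lemma dl_sum: "dl i w g = (\<Sum>k<length w. (if w ! k = i then twist D [i] (take k w) else 0) * g (del k w))"
proof (induction w arbitrary: g)
  case (Cons j w)
  have "(\<Sum>k<length w. (if w ! k = i then twist D [i] (j # take k w) else 0) * g (j # del k w)) =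
      twist D [i] [j] * (\<Sum>k<length w. (if w ! k = i then twist D [i] (take k w) else 0) * g (j # del k w))"
    unfolding sum_distrib_left
    by (rule sum.cong[OF refl]) (simp only: twist_Cons[of D "[i]" j "take k w" for k] split: if_split, simp add: mult.assoc)
  then show ?case
    unfolding dl_Cons Cons.IH by (simp add: sum.lessThan_Suc_shift del: sum.lessThan_Suc cong: if_cong)
qed simp

definition dr :: "'i \<Rightarrow> 'i list \<Rightarrow> ('i list \<Rightarrow> qpi) \<Rightarrow> qpi" where
  "dr i w g = pair (coprod_word D w) (\<lambda>x. if snd x = [i] then g (fst x) else 0)"

lemma dr_Cons: "dr i (j # w) g = (if i = j then twist D [i] w * g w else 0) + dr i w (\<lambda>v. g (j # v))"
proof -
  have "dr i (j # w) g = pair (coprod_word D w) (\<lambda>x. (if snd x = [] then (if i = j then twist D [i] (fst x) * g (fst x) else 0) else 0) +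
      (if snd x = [i] then g (j # fst x) else 0))"
    unfolding dr_def coprod_Cons by (rule pair_coprod_cong) auto
  also have "\<dots> = (if i = j then twist D [i] w * g w else 0) + dr i w (\<lambda>v. g (j # v))"
    unfolding pair_lin(1) pair_Nil_right[of w "\<lambda>v. if i = j then twist D [i] v * g v else 0"] dr_def ..
  finally show ?thesis .
qed

lemma dr_sum: "dr i w g = (\<Sum>k<length w. (if w ! k = i then twist D [i] (drop (Suc k) w) else 0) * g (del k w))"
proof (induction w arbitrary: g)
  case Nil
  show ?case by (simp add: dr_def)
next
  case (Cons j w)
  show ?case
    unfolding dr_Cons Cons.IH by (simp add: sum.lessThan_Suc_shift del: sum.lessThan_Suc cong: if_cong)
qed

section \<open>Specialization of the datum and of the form at pi = s\<close>

definition cartan :: "'i \<Rightarrow> 'i \<Rightarrow> int" where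
  "cartan i j = 2 * dot D i j div dot D i i"

lemma dot_diag: "dot D i i = 2 * dd D i" "dd D i > 0"
proof -
  obtain d where "d > 0" "dot D i i = 2 * d" using scd unfolding super_cartan_datum_def by blast
  then show "dot D i i = 2 * dd D i" "dd D i > 0" by (simp_all add: dd_def)
qed

lemma cartan_mult: "cartan i j * dot D i i = 2 * dot D i j"
proof (cases "i = j")
  case True
  then show ?thesis using dot_diag[of i] by (simp add: cartan_def)
next
  case False
  then obtain n :: nat where "2 * dot D i j = - int n * dot D i i"
    using scd unfolding super_cartan_datum_def by blast
  then show ?thesis using dot_diag[of i] by (simp add: cartan_def)
qed

lemma dd_cartan: "dd D i * cartan i j = dot D i j"
  using cartan_mult[of i j] dot_diag[of i] by (simp add: mult.commute)

lemma cartan_even: "i \<in> odds D \<Longrightarrow> even (cartan i j)"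
proof -
  assume "i \<in> odds D"
  then obtain k where "2 * dot D i j = (2 * k) * dot D i i"
    using scd unfolding super_cartan_datum_def by blast
  then have "cartan i j * dot D i i = (2 * k) * dot D i i" using cartan_mult by simp
  then have "cartan i j = 2 * k" using dot_diag[of i] by simp
  then show ?thesis by simp
qed

abbreviation pn :: "'i \<Rightarrow> nat" where "pn i \<equiv> if i \<in> odds D then 1 else 0"

lemma pari_pn: "pari D i = int (pn i)"
  by (simp add: pari_def)

lemma qdatum_s: "s * s = 1 \<Longrightarrow> qdatum qf s (dot D) (dd D) pn cartan"
  by unfold_locales (auto simp: qf_root dot_diag dot_sym dd_cartan cartan_even split: if_splits)

lemma dotZ_single: "dotZ D (wt [j]) (wt [i]) = dot D j i"
proof -
  have "(\<Sum>b\<in>UNIV. wt [j] a * wt [i] b * dot D a b) = wt [j] a * dot D a i" for a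
    by (simp add: if_distrib[of "\<lambda>x. _ * x"] if_distrib[of "\<lambda>x. x * _"] cong: if_cong)
  then show ?thesis by (simp add: dotZ_def if_distrib[of "\<lambda>x. x * _"] cong: if_cong)
qed

lemma ev_twist:
  assumes s: "s * s = 1" shows "ev s (twist D [j] w) = qdatum.chi qf s (dot D) pn j w"
proof -
  interpret qdatum qf s "dot D" "dd D" pn cartan by (rule qdatum_s[OF s])
  have par1: "par D (wt [i]) = int (pn i)" for i
    by (simp add: par_def)
  have pw: "par D (wt w) = int (pw w)"
  proof (induction w)
    case (Cons i w)
    then show ?case using par_wt(1)[of D "[i]" w] by (simp only: append_Cons append_Nil par1 pw_simps of_nat_add)
  qed (simp add: par_def)
  have dw: "dotZ D (wt [j]) (wt w) = dw j w"
  proof (induction w)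
    case (Cons i w)
    then show ?case using dotZ_wt(2)[of D "wt [j]" "[i]" w] by (simp only: append_Cons append_Nil dotZ_single dw_simps)
  qed (simp add: dotZ_def)
  have "s powi (int (pn j) * int (pw w)) = s ^ (pn j * pw w)"
    by (simp only: power_int_of_nat flip: of_nat_mult)
  then show ?thesis
    by (simp only: twist_def ev_mult[OF s] ev_qq_powi[OF s] ev_pp_powi[OF s] dw pw par1 chi_def)
qed

lemma ev_qi: "s * s = 1 \<Longrightarrow> ev s (qi D i) = qf powi dd D i"
  by (simp add: qi_def ev_qq_powi)

lemma ev_ppi: "s * s = 1 \<Longrightarrow> ev s (ppi D i) = s ^ pn i"
  by (simp add: ppi_def pari_pn ev_pp_powi)

lemma ev_qi_nz: "s * s = 1 \<Longrightarrow> ev s (qi D i) \<noteq> 0"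
  by (simp add: ev_qi)

lemma ev_ciq:
  assumes s: "s * s = 1" shows "ev s (ciq D i) = qdatum.cc qf s (dd D) pn i"
proof -
  have e: "ev s (1 - ppi D i * qi D i powi - 2) = 1 - s ^ pn i * qf powi (- 2 * dd D i)" if s: "s * s = 1" for s
  proof -
    have "ev s (qi D i powi - 2) = (qf powi dd D i) powi - 2"
      by (subst ev_powi[OF s ev_qi_nz]) (simp_all only: ev_qi[OF s])
    also have "\<dots> = qf powi (- 2 * dd D i)"
      by (simp only: power_int_mult[symmetric] mult.commute)
    finally show ?thesis by (simp only: ev_simps ev_mult[OF s] ev_ppi[OF s])
  qed
  have nz: "ev s (1 - ppi D i * qi D i powi - 2) \<noteq> 0" if s: "s * s = 1" for s
  proof -
    interpret qdatum qf s "dot D" "dd D" pn cartan by (rule qdatum_s[OF s])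
    show ?thesis unfolding e[OF s] using cc_denom_nz[of i] by (simp only: ep_def) simp
  qed
  interpret qdatum qf s "dot D" "dd D" pn cartan by (rule qdatum_s[OF s])
  have "ev s (ciq D i) = inverse (ev s (1 - ppi D i * qi D i powi - 2))"
    unfolding ciq_def by (rule ev_inverse[OF s]) (rule nz)
  then show ?thesis unfolding e[OF s] by (simp only: cc_def ep_def)
qed

lemma ev_sum: "ev s (sum f A) = (\<Sum>x\<in>A. ev s (f x))"
  by (induction A rule: infinite_finite_induct) simp_all

lemma qform_s:
  assumes s: "s * s = 1" shows "qform qf s (dot D) (dd D) pn cartan (\<lambda>u v. ev s (fb u v))"
proof -
  interpret qdatum qf s "dot D" "dd D" pn cartan "\<lambda>u v. ev s (fb u v)" by (rule qdatum_s[OF s])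
  have sym: "fb u v = fb v u" for u v using wform_sym[OF wform_fb] .
  show ?thesis
  proof
    fix u w :: "'i list" and j :: 'i
    show "ev s (fb u w) = ev s (fb w u)" by (simp only: sym)
    show "ev s (fb u []) = (if u = [] then 1 else 0)"
      using wform_Nil[OF wform_fb, of u] sym[of u "[]"] by simp
    have "fb (j # w) u = ciq D j * dl j u (fb w)"
      using wform_Cons[OF wform_fb, of j w u] by (simp only: dl_def)
    then have "ev s (fb u (j # w)) = cc j * ev s (dl j u (fb w))"
      by (simp only: sym[of u] ev_mult[OF s] ev_ciq[OF s])
    also have "ev s (dl j u (fb w)) = (\<Sum>k<length u. Lcf j u k * ev s (fb (del k u) w))"
      unfolding dl_sum ev_sum
      by (rule sum.cong) (auto simp: ev_mult[OF s] ev_twist[OF s] Lcf_def sym[of w])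
    finally show "ev s (fb u (j # w)) = cc j * (\<Sum>k<length u. Lcf j u k * ev s (fb (del k u) w))" .
    have "fb (w @ [j]) u = ciq D j * dr j u (fb w)"
      using wform_snoc[OF wform_fb, of w j u] by (simp only: dr_def)
    then have "ev s (fb u (w @ [j])) = cc j * ev s (dr j u (fb w))"
      by (simp only: sym[of u] ev_mult[OF s] ev_ciq[OF s])
    also have "ev s (dr j u (fb w)) = (\<Sum>k<length u. Rcf j u k * ev s (fb (del k u) w))"
      unfolding dr_sum ev_sum
      by (rule sum.cong) (auto simp: ev_mult[OF s] ev_twist[OF s] Rcf_def sym[of w])
    finally show "ev s (fb u (w @ [j])) = cc j * (\<Sum>k<length u. Rcf j u k * ev s (fb (del k u) w))" .
  qed
qed

text \<open>Both numerator and denominator survive the evaluation: squaring removes the sign, and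
  \<open>qf\<close> is not a root of unity.\<close>

lemma qint_unit:
  assumes s: "s * s = 1" "k > 0" shows "ev s (qint D i k) \<noteq> 0"
proof -
  have t: "ev t (ppi D i * qi D i) = t ^ pn i * qf powi dd D i"
    "ev t (inverse (qi D i)) = qf powi (- dd D i)" if "t * t = 1" for t
    using that ev_inverse[OF that ev_qi_nz, of i]
    by (simp_all only: ev_mult[OF that] ev_ppi[OF that] ev_qi[OF that] power_int_minus)
  have den: "ev t (ppi D i * qi D i - inverse (qi D i)) \<noteq> 0" if "t * t = 1" for t
  proof -
    interpret qdatum qf t "dot D" "dd D" pn cartan by (rule qdatum_s[OF that])
    show ?thesis using denom_nz[of i] by (simp only: ev_simps t[OF that] ep_def) simp
  qed
  have "ev s ((ppi D i * qi D i) ^ k - inverse (qi D i) ^ k) \<noteq> 0"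
  proof
    assume "ev s ((ppi D i * qi D i) ^ k - inverse (qi D i) ^ k) = 0"
    then have h: "(s ^ pn i * qf powi dd D i) ^ k = (qf powi (- dd D i)) ^ k"
      by (simp only: ev_simps ev_power[OF s(1)] t[OF s(1)] right_minus_eq)
    have "(s ^ pn i * s ^ pn i) = 1" using s(1) by auto
    moreover have "(s ^ pn i * qf powi dd D i) ^ k * (s ^ pn i * qf powi dd D i) ^ k =
        (s ^ pn i * s ^ pn i) ^ k * (qf powi dd D i * qf powi dd D i) ^ k"
      by (simp only: power_mult_distrib ac_simps)
    ultimately have "(qf powi dd D i * qf powi dd D i) ^ k = (qf powi (- dd D i) * qf powi (- dd D i)) ^ k"
      unfolding h by (simp add: power_mult_distrib)
    then have "(qf powi (2 * dd D i)) ^ k = (qf powi (- 2 * dd D i)) ^ k"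
      by (simp flip: power_int_add)
    then have "qf powi (2 * dd D i * int k) = qf powi (- 2 * dd D i * int k)"
      by (simp only: power_int_mult power_int_of_nat)
    then have "qf powi (4 * dd D i * int k) = 1"
      by (simp add: power_int_minus field_simps flip: power_int_add)
    then have "4 * dd D i * int k = 0" by (rule qf_root)
    then show False using dot_diag(2)[of i] s(2) by simp
  qed
  moreover have "ev s (inverse (ppi D i * qi D i - inverse (qi D i))) \<noteq> 0"
  proof -
    have "ev s (inverse (ppi D i * qi D i - inverse (qi D i))) = inverse (ev s (ppi D i * qi D i - inverse (qi D i)))"
      by (rule ev_inverse[OF s(1)]) (rule den)
    then show ?thesis using den[OF s(1)] by (simp only: inverse_nonzero_iff_nonzero) simp
  qed
  ultimately show ?thesis by (simp only: qint_def divide_qpi_def ev_mult[OF s(1)] mult_eq_0_iff) simp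
qed

text \<open>Lets the integrability condition, stated for divided powers, be read for F_i^N: the
  inverse of the factorial is a genuine inverse and not the default value 0.\<close>

lemma qfact_unit: "s * s = 1 \<Longrightarrow> ev s (qfact D i k) \<noteq> 0"
proof -
  assume s: "s * s = 1"
  have "ev s (prod f A) = (\<Prod>x\<in>A. ev s (f x))" for f and A :: "nat set"
    by (induction A rule: infinite_finite_induct) (simp_all add: ev_mult[OF s])
  then show ?thesis by (auto simp: qfact_def qint_unit[OF s])
qed

end

section \<open>Modules over a field as subspaces of a free vector space\<close>

definition psc :: "'k::field \<Rightarrow> ('m \<Rightarrow>\<^sub>0 'k) \<Rightarrow> ('m \<Rightarrow>\<^sub>0 'k)" where
  "psc c f = Poly_Mapping.map ((*) c) f"

lemma lookup_psc [simp]: "Poly_Mapping.lookup (psc c f) x = c * Poly_Mapping.lookup f x"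
  by (simp add: psc_def Poly_Mapping.map.rep_eq when_def)

lemma vector_space_psc: "vector_space (psc :: 'k::field \<Rightarrow> ('m \<Rightarrow>\<^sub>0 'k) \<Rightarrow> _)"
  by unfold_locales (rule poly_mapping_eqI, simp add: lookup_add algebra_simps)+

text \<open>A vector space carried by a subset of a type. It is embedded below in the space of
  finitely supported functions on that type.\<close>

locale field_module = abelian_group M for M :: "('m, 'b) ring_scheme" (structure) +
  fixes sm :: "'k::field \<Rightarrow> 'm \<Rightarrow> 'm"
  assumes sm_closed [simp]: "x \<in> carrier M \<Longrightarrow> sm c x \<in> carrier M"
    and sm_add: "\<lbrakk>x \<in> carrier M; y \<in> carrier M\<rbrakk> \<Longrightarrow> sm c (x \<oplus> y) = sm c x \<oplus> sm c y"
    and sm_add_left: "x \<in> carrier M \<Longrightarrow> sm (c + d) x = sm c x \<oplus> sm d x"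
    and sm_mult: "x \<in> carrier M \<Longrightarrow> sm (c * d) x = sm c (sm d x)"
    and sm_one: "x \<in> carrier M \<Longrightarrow> sm 1 x = x"
begin

lemma double_zero: "x \<in> carrier M \<Longrightarrow> x = x \<oplus> x \<Longrightarrow> x = \<zero>"
  by (metis add.l_cancel_one')

lemma sm_zero: "x \<in> carrier M \<Longrightarrow> sm 0 x = \<zero>" "sm c \<zero> = \<zero>"
proof -
  show "sm 0 x = \<zero>" if x: "x \<in> carrier M"
    using sm_add_left[OF x, of 0 0] by (intro double_zero) (simp_all add: x)
  show "sm c \<zero> = \<zero>"
    using sm_add[of \<zero> \<zero> c] by (intro double_zero) simp_all
qed

text \<open>The canonical surjection from the free vector space; basis elements outside the carrier
  go to zero.\<close>

definition rho :: "('m \<Rightarrow>\<^sub>0 'k) \<Rightarrow> 'm" where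
  "rho f = (\<Oplus>x\<in>Poly_Mapping.keys f \<inter> carrier M. sm (Poly_Mapping.lookup f x) x)"

lemma rho_superset:
  assumes "finite S" "Poly_Mapping.keys f \<inter> carrier M \<subseteq> S" "S \<subseteq> carrier M"
  shows "rho f = (\<Oplus>x\<in>S. sm (Poly_Mapping.lookup f x) x)"
  unfolding rho_def
  by (rule add.finprod_mono_neutral_cong_left) (use assms in \<open>auto simp: in_keys_iff sm_zero\<close>)

lemma rho_closed [simp]: "rho f \<in> carrier M"
  unfolding rho_def by (rule finsum_closed) auto

lemma rho_add: "rho (f + g) = rho f \<oplus> rho g"
proof -
  let ?S = "(Poly_Mapping.keys f \<union> Poly_Mapping.keys g) \<inter> carrier M"
  have S: "finite ?S" "?S \<subseteq> carrier M" by auto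
  have "rho (f + g) = (\<Oplus>x\<in>?S. sm (Poly_Mapping.lookup (f + g) x) x)"
    using keys_add[of f g] by (intro rho_superset) auto
  also have "\<dots> = (\<Oplus>x\<in>?S. sm (Poly_Mapping.lookup f x) x \<oplus> sm (Poly_Mapping.lookup g x) x)"
    by (rule finsum_cong') (auto simp: lookup_add sm_add_left)
  also have "\<dots> = (\<Oplus>x\<in>?S. sm (Poly_Mapping.lookup f x) x) \<oplus> (\<Oplus>x\<in>?S. sm (Poly_Mapping.lookup g x) x)"
    by (rule finsum_addf) auto
  also have "\<dots> = rho f \<oplus> rho g"
    by (subst (1 2) rho_superset[where S = ?S]) auto
  finally show ?thesis .
qed

lemma sm_finsum: "(\<And>x. x \<in> S \<Longrightarrow> h x \<in> carrier M) \<Longrightarrow> sm c (\<Oplus>x\<in>S. h x) = (\<Oplus>x\<in>S. sm c (h x))"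
proof (induction S rule: infinite_finite_induct)
  case (insert x S)
  then show ?case
    by (subst (1 2) finsum_insert) (auto simp: sm_add)
qed (simp_all add: sm_zero)

lemma rho_psc: "rho (psc c f) = sm c (rho f)"
proof -
  let ?S = "Poly_Mapping.keys f \<inter> carrier M"
  have "rho (psc c f) = (\<Oplus>x\<in>?S. sm (Poly_Mapping.lookup (psc c f) x) x)"
    by (rule rho_superset) (auto simp: in_keys_iff)
  also have "\<dots> = (\<Oplus>x\<in>?S. sm c (sm (Poly_Mapping.lookup f x) x))"
    by (rule finsum_cong') (auto simp: sm_mult)
  also have "\<dots> = sm c (rho f)"
    unfolding rho_def by (rule sm_finsum[symmetric]) auto
  finally show ?thesis .
qed

lemma rho_single: "m \<in> carrier M \<Longrightarrow> rho (Poly_Mapping.single m 1) = m"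
  by (simp add: rho_def sm_one lookup_single)

text \<open>A linear projection \<open>g\<close> onto the kernel \<open>R\<close> exists, and f - g
  f depends only on the image of f, so it descends to a linear section.\<close>

lemma section_exists:
  "\<exists>\<sigma>. (\<forall>m\<in>carrier M. rho (\<sigma> m) = m) \<and>
     (\<forall>x\<in>carrier M. \<forall>y\<in>carrier M. \<sigma> (x \<oplus> y) = \<sigma> x + \<sigma> y) \<and>
     (\<forall>c. \<forall>x\<in>carrier M. \<sigma> (sm c x) = psc c (\<sigma> x))"
proof -
  interpret vs: vector_space "psc :: 'k \<Rightarrow> ('m \<Rightarrow>\<^sub>0 'k) \<Rightarrow> _" by (rule vector_space_psc)
  interpret vp: vector_space_pair "psc :: 'k \<Rightarrow> ('m \<Rightarrow>\<^sub>0 'k) \<Rightarrow> _" psc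
    by (intro vector_space_pair.intro vector_space_psc)
  define R where "R = {f. rho f = \<zero>}"
  have rho0: "rho 0 = \<zero>" by (simp add: rho_def)
  have R: "vs.subspace R"
    by (simp add: vs.subspace_def R_def rho0 rho_add rho_psc sm_zero)
  obtain g where g: "range g \<subseteq> R" "Vector_Spaces.linear psc psc g" "\<And>v. v \<in> R \<Longrightarrow> g v = v"
    using vp.linear_exists_left_inverse_on[OF vs.linear_id R] by auto
  interpret g: Vector_Spaces.linear psc psc g by (rule g(2))
  define \<pi> where "\<pi> = (\<lambda>f. f - g f)"
  have pR: "\<pi> f = \<pi> f'" if "f - f' \<in> R" for f f'
    using g(3)[OF that] by (simp add: \<pi>_def g.diff algebra_simps)
  have rho_diff: "rho f = rho (f - f') \<oplus> rho f'" for f f'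
    using rho_add[of "f - f'" f'] by simp
  have diffR: "f - f' \<in> R" if "rho f = rho f'" for f f'
    using rho_diff[of f f'] that
    by (simp add: R_def)
  have rho_\<pi>: "rho (\<pi> f) = rho f" for f
  proof -
    have "rho (g f) = \<zero>" using g(1) by (auto simp: R_def)
    then show ?thesis using rho_diff[of f "g f"] by (simp add: \<pi>_def)
  qed
  define \<sigma> where "\<sigma> = (\<lambda>m. \<pi> (Poly_Mapping.single m 1))"
  have s: "\<sigma> m = \<pi> f" if "m \<in> carrier M" "rho f = m" for m f
    unfolding \<sigma>_def by (rule pR, rule diffR) (simp add: rho_single that)
  show ?thesis
  proof (intro exI[of _ \<sigma>] conjI ballI allI)
    fix m assume "m \<in> carrier M"
    then show "rho (\<sigma> m) = m" by (simp add: \<sigma>_def rho_\<pi> rho_single)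
  next
    fix x y assume xy: "x \<in> carrier M" "y \<in> carrier M"
    have "\<sigma> (x \<oplus> y) = \<pi> (Poly_Mapping.single x 1 + Poly_Mapping.single y 1)"
      by (rule s) (simp_all add: xy rho_add rho_single)
    then show "\<sigma> (x \<oplus> y) = \<sigma> x + \<sigma> y" by (simp add: \<pi>_def \<sigma>_def g.add)
  next
    fix c x assume x: "x \<in> carrier M"
    have "\<sigma> (sm c x) = \<pi> (psc c (Poly_Mapping.single x 1))"
      by (rule s) (simp_all add: x rho_psc rho_single)
    then show "\<sigma> (sm c x) = psc c (\<sigma> x)"
      by (simp add: \<pi>_def \<sigma>_def g.scale vs.scale_right_diff_distrib)
  qed
qed

end

section \<open>The quantum covering group as a quotient ring\<close>

lemma rta_simps [simp]:
  "carrier ring_of_type_algebra = UNIV" "x \<oplus>\<^bsub>ring_of_type_algebra\<^esub> y = x + y"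
  "x \<otimes>\<^bsub>ring_of_type_algebra\<^esub> y = x * y" "\<one>\<^bsub>ring_of_type_algebra\<^esub> = 1" "\<zero>\<^bsub>ring_of_type_algebra\<^esub> = 0"
  by (simp_all add: ring_of_type_algebra_def)

lemma ring_rta: "ring (ring_of_type_algebra :: 'a::ring_1 ring)"
proof (rule ringI)
  show "abelian_group (ring_of_type_algebra :: 'a ring)"
  proof (rule abelian_groupI)
    fix x :: 'a
    show "\<exists>y\<in>carrier ring_of_type_algebra. y \<oplus>\<^bsub>ring_of_type_algebra\<^esub> x = \<zero>\<^bsub>ring_of_type_algebra\<^esub>"
      by (intro bexI[of _ "- x"]) simp_all
  qed (simp_all add: algebra_simps)
  show "monoid (ring_of_type_algebra :: 'a ring)"
    by (rule monoidI) (simp_all add: mult.assoc)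
qed (simp_all add: algebra_simps)

lemma uideal_ideal: "ideal (uideal D) ring_of_type_algebra"
  unfolding uideal_def by (rule ring.genideal_ideal[OF ring_rta]) simp

lemma ring_UU: "ring (UU D)"
  unfolding UU_def by (rule ideal.quotient_is_ring[OF uideal_ideal])

lemma ucls_hom: "ucls D \<in> ring_hom ring_of_type_algebra (UU D)"
proof -
  have "ucls D = (+>\<^bsub>ring_of_type_algebra\<^esub>) (uideal D)" by (simp add: fun_eq_iff ucls_def)
  then show ?thesis unfolding UU_def using ideal.rcos_ring_hom[OF uideal_ideal] by simp
qed

lemma ucls_simps: "ucls D x \<in> carrier (UU D)" "ucls D (x * y) = ucls D x \<otimes>\<^bsub>UU D\<^esub> ucls D y"
    "ucls D (x + y) = ucls D x \<oplus>\<^bsub>UU D\<^esub> ucls D y" "ucls D 1 = \<one>\<^bsub>UU D\<^esub>"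
  using ring_hom_closed[OF ucls_hom] ring_hom_mult[OF ucls_hom] ring_hom_add[OF ucls_hom] ring_hom_one[OF ucls_hom]
  by simp_all

lemma carrier_UU: "carrier (UU D) = range (ucls D)"
  by (auto simp: UU_def FactRing_def A_RCOSETS_def' ucls_def)

lemma ucls_rel: "r \<in> urels D \<Longrightarrow> ucls D r = \<zero>\<^bsub>UU D\<^esub>"
proof -
  assume "r \<in> urels D"
  then have "r \<in> uideal D"
    unfolding uideal_def using ring.genideal_self[OF ring_rta, of "urels D"] by auto
  then have "uideal D +>\<^bsub>ring_of_type_algebra\<^esub> r = uideal D"
    using ring.a_rcos_zero[OF ring_rta uideal_ideal] by blast
  then show ?thesis by (simp add: ucls_def UU_def FactRing_def)
qed

section \<open>Operators on the ambient vector space\<close>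

lemma csmult_mult: "c *c x * y = c *c (x * y)" "x * (c *c y) = c *c (x * y)"
  for x y :: "'a free_alg"
proof -
  show "c *c x * y = c *c (x * y)"
  proof (induction x rule: free_induct)
    case (single u a)
    show ?case
    proof (induction y rule: free_induct)
      case (single v b)
      show ?case by (simp add: mult_single mult.assoc)
    qed (simp_all add: distrib_left)
  qed (simp_all add: distrib_right)
  show "x * (c *c y) = c *c (x * y)"
  proof (induction x rule: free_induct)
    case (single u a)
    show ?case
    proof (induction y rule: free_induct)
      case (single v b)
      show ?case by (simp add: mult_single mult.left_commute)
    qed (simp_all add: distrib_left)
  qed (simp_all add: distrib_right)
qed

lemma substitute_word: "substitute h (word w) = prod_list (map h w)"
  by (simp add: substitute_def word_def)

lemma substitute_add: "substitute h (x + y) = substitute h x + substitute h y"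
proof -
  let ?S = "Poly_Mapping.keys x \<union> Poly_Mapping.keys y"
  have s: "substitute h z = (\<Sum>w\<in>?S. Poly_Mapping.lookup z w *c prod_list (map h w))"
    if "Poly_Mapping.keys z \<subseteq> ?S" for z
    unfolding substitute_def by (rule sum.mono_neutral_left) (use that in \<open>auto simp: in_keys_iff\<close>)
  show ?thesis
    using keys_add[of x y] by (simp add: s lookup_add sum.distrib)
qed

lemma substitute_sum: "substitute h (sum g S) = (\<Sum>k\<in>S. substitute h (g k))"
proof (induction S rule: infinite_finite_induct)
  case (insert x S)
  then show ?case by (simp add: substitute_add)
qed (simp_all add: substitute_def)

lemma csmult_sum: "c *c sum f S = (\<Sum>w\<in>S. c *c f w)"
  by (induction S rule: infinite_finite_induct) simp_all

lemma substitute_csmult: "substitute h (c *c x) = c *c substitute h x"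
proof -
  have "Poly_Mapping.keys (c *c x) \<subseteq> Poly_Mapping.keys x" by (auto simp: in_keys_iff)
  then have "substitute h (c *c x) = (\<Sum>w\<in>Poly_Mapping.keys x. Poly_Mapping.lookup (c *c x) w *c prod_list (map h w))"
    unfolding substitute_def by (rule sum.mono_neutral_left[OF finite_keys]) (auto simp: in_keys_iff)
  then show ?thesis by (simp add: substitute_def csmult_sum)
qed

lemma prod_list_gen: "prod_list (map (\<lambda>i. gen (f i)) w) = word (map f w)"
  by (induction w) (simp_all add: one_word gen_def word_mult)

lemma pairing_simps:
  assumes "root_datum D"
  shows "pairing D \<mu> (l + l') = pairing D \<mu> l + pairing D \<mu> l'"
    "pairing D \<mu> (l - l') = pairing D \<mu> l - pairing D \<mu> l'"
    "pairing D (- \<mu>) l = - pairing D \<mu> l"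
    "pairing D (zscale z \<mu>) l = z * pairing D \<mu> l"
proof -
  have p: "additive (\<lambda>y. pairing D y x)" "additive (pairing D y)" for x y
    using assms unfolding root_datum_def perfect_pairing_def by blast+
  show "pairing D \<mu> (l + l') = pairing D \<mu> l + pairing D \<mu> l'"
    "pairing D \<mu> (l - l') = pairing D \<mu> l - pairing D \<mu> l'"
    using additive.add[OF p(2)] additive.diff[OF p(2)] by blast+
  show "pairing D (- \<mu>) l = - pairing D \<mu> l" using additive.minus[OF p(1)] .
  have "pairing D (zscale z \<mu>) l = int (nat z) * pairing D \<mu> l - int (nat (- z)) * pairing D \<mu> l"
    unfolding zscale_def additive.diff[OF p(1)] additive.sum[OF p(1)] by simp
  then show "pairing D (zscale z \<mu>) l = z * pairing D \<mu> l" by (cases "z \<ge> 0") simp_all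
qed

lemma sroot_words:
  assumes "root_datum D" and eq: "(\<Sum>i\<leftarrow>u. sroot D i) = (\<Sum>i\<leftarrow>w. sroot D i)"
  shows "mset u = mset w"
proof (rule ccontr)
  assume ne: "mset u \<noteq> mset w"
  interpret Z: Modules.module "zscale :: int \<Rightarrow> 'c \<Rightarrow> 'c" by (rule module_zscale)
  have inj: "inj (sroot D)" and ind: "\<not> Z.dependent (range (sroot D))"
    using assms(1) by (auto simp: root_datum_def)
  have sum: "(\<Sum>i\<leftarrow>v. sroot D i) = (\<Sum>i\<in>UNIV. zscale (wt v i) (sroot D i))" for v
  proof (induction v)
    case (Cons j v)
    have "(\<Sum>i\<in>UNIV. zscale (if j = i then 1 else 0) (sroot D i)) = sroot D j"
      by (simp add: if_distrib[of "\<lambda>x. zscale x _"] cong: if_cong)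
    then show ?case using Cons by (simp add: Z.scale_left_distrib sum.distrib)
  qed simp
  \<comment> \<open>Dependence is expressed by coefficients indexed by vectors, so the difference of
    multiplicities is transported along the inverse of \<open>sroot D\<close>.\<close>
  define c where "c = (\<lambda>x. wt u (the_inv (sroot D) x) - wt w (the_inv (sroot D) x))"
  obtain i where "count (mset u) i \<noteq> count (mset w) i" using ne by (meson multiset_eqI)
  then have i: "c (sroot D i) \<noteq> 0" by (simp add: c_def the_inv_f_f[OF inj] wt_def count_mset)
  have "(\<Sum>x\<in>range (sroot D). zscale (c x) x) = (\<Sum>i\<in>UNIV. zscale (c (sroot D i)) (sroot D i))"
    by (rule sum.reindex[OF inj, unfolded o_def])
  also have "\<dots> = 0"
    using eq unfolding sum by (simp add: c_def the_inv_f_f[OF inj] Z.scale_left_diff_distrib sum_subtractf)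
  finally have "Z.dependent (range (sroot D))"
    unfolding Z.dependent_explicit using i by (intro exI[of _ "range (sroot D)"] exI[of _ c]) auto
  then show False using ind by simp
qed

locale umod = super_datum D
  for D :: "('i::finite, 'y::ab_group_add, 'x::ab_group_add) root_data" +
  fixes M :: "(('i, 'y) U_elem, 'm) module" (structure) and G :: "bit \<Rightarrow> 'm set"
  assumes rd: "root_datum D" and Oint: "cat_O_int D M G"
begin

lemma graded: "graded_U_module D M G"
  using Oint by (simp add: cat_O_int_def cat_O_def cat_C_def)

sublocale L: left_module "UU D" M
  using graded by (simp add: graded_U_module_def)

definition act :: "('i, 'y) ugen free_alg \<Rightarrow> 'm \<Rightarrow> 'm" where
  "act x m = ucls D x \<odot> m"

lemma act_closed [simp]: "m \<in> carrier M \<Longrightarrow> act x m \<in> carrier M"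
  by (simp add: act_def L.smult_closed ucls_simps)

lemma act_add: "m \<in> carrier M \<Longrightarrow> act (x + y) m = act x m \<oplus> act y m"
    "\<lbrakk>m \<in> carrier M; m' \<in> carrier M\<rbrakk> \<Longrightarrow> act x (m \<oplus> m') = act x m \<oplus> act x m'"
  by (simp_all add: act_def ucls_simps L.smult_l_distr L.smult_r_distr)

lemma act_mult: "m \<in> carrier M \<Longrightarrow> act (x * y) m = act x (act y m)"
  by (simp add: act_def ucls_simps L.smult_assoc)

lemma act_one: "m \<in> carrier M \<Longrightarrow> act 1 m = m"
  by (simp add: act_def ucls_simps L.smult_one)

text \<open>Only the subfield of scalars free of pi is used for the linear structure; pi itself
  becomes an operator commuting with the whole action.\<close>

sublocale fm: field_module M "\<lambda>t. act (QPi t 0 *c 1)"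
proof
  fix x y c d assume x: "x \<in> carrier M"
  show "act (QPi c 0 *c 1) x \<in> carrier M" using x by simp
  have "QPi (c + d) 0 = QPi c 0 + QPi d 0" by (simp add: plus_qpi_def)
  then show "act (QPi (c + d) 0 *c 1) x = act (QPi c 0 *c 1) x \<oplus> act (QPi d 0 *c 1) x"
    using act_add(1)[OF x] by simp
  have "QPi (c * d) 0 *c 1 = QPi c 0 *c 1 * (QPi d 0 *c (1 :: ('i, 'y) ugen free_alg))"
    by (simp add: csmult_mult times_qpi_def mult.commute)
  then show "act (QPi (c * d) 0 *c 1) x = act (QPi c 0 *c 1) (act (QPi d 0 *c 1) x)"
    using act_mult[OF x] by simp
  have "QPi 1 0 = 1" by (simp add: one_qpi_def)
  then show "act (QPi 1 0 *c 1) x = x" using act_one[OF x] by simp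
  assume "y \<in> carrier M"
  then show "act (QPi c 0 *c 1) (x \<oplus> y) = act (QPi c 0 *c 1) x \<oplus> act (QPi c 0 *c 1) y"
    using act_add(2)[OF x] by simp
qed

lemma act_zero: "act x \<zero> = \<zero>" "m \<in> carrier M \<Longrightarrow> act 0 m = \<zero>"
  using act_add(2)[of "\<zero>" "\<zero>" x] act_add(1)[of m 0 0]
  by (auto intro!: fm.double_zero)

lemma act_rel: "r \<in> urels D \<Longrightarrow> m \<in> carrier M \<Longrightarrow> act r m = \<zero>"
proof -
  assume h: "r \<in> urels D" "m \<in> carrier M"
  have "ucls D 0 = \<zero>\<^bsub>UU D\<^esub>"
    using ring_hom_zero[OF ucls_hom ring_rta ring_UU] by simp
  then have "ucls D r = ucls D 0" using ucls_rel[OF h(1)] by simp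
  then show ?thesis using act_zero(2)[OF h(2)] by (simp add: act_def)
qed

definition sig :: "'m \<Rightarrow> ('m \<Rightarrow>\<^sub>0 rat poly fract)" where
  "sig = (SOME \<sigma>. (\<forall>m\<in>carrier M. fm.rho (\<sigma> m) = m) \<and>
     (\<forall>x\<in>carrier M. \<forall>y\<in>carrier M. \<sigma> (x \<oplus> y) = \<sigma> x + \<sigma> y) \<and>
     (\<forall>c. \<forall>x\<in>carrier M. \<sigma> (act (QPi c 0 *c 1) x) = psc c (\<sigma> x)))"

lemma sig: "m \<in> carrier M \<Longrightarrow> fm.rho (sig m) = m"
    "\<lbrakk>x \<in> carrier M; y \<in> carrier M\<rbrakk> \<Longrightarrow> sig (x \<oplus> y) = sig x + sig y"
    "x \<in> carrier M \<Longrightarrow> sig (act (QPi c 0 *c 1) x) = psc c (sig x)"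
  using someI_ex[OF fm.section_exists, folded sig_def] by blast+

lemma sig_zero: "sig \<zero> = 0"
  using sig(2)[of "\<zero>" "\<zero>"] by simp

text \<open>The action of \<open>x\<close> transported along the section. \<open>A 1\<close> is the
  projection onto the copy of M, so the condition A 1 p = p singles out that copy.\<close>

definition A :: "('i, 'y) ugen free_alg \<Rightarrow> ('m \<Rightarrow>\<^sub>0 rat poly fract) \<Rightarrow> ('m \<Rightarrow>\<^sub>0 rat poly fract)" where
  "A x p = sig (act x (fm.rho p))"

lemma A_sig: "m \<in> carrier M \<Longrightarrow> A x (sig m) = sig (act x m)"
  by (simp add: A_def sig)

lemma rho_A: "fm.rho (A x p) = act x (fm.rho p)"
  by (simp add: A_def sig)

lemma A_add: "A (x + y) p = A x p + A y p" "A x (p + p') = A x p + A x p'"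
  by (simp_all add: A_def act_add fm.rho_add sig)

lemma A_zero [simp]: "A 0 p = 0" "A x 0 = 0"
  using A_add(1)[of 0 0 p] A_add(2)[of x 0 0] by simp_all

lemma A_diff: "A (x - y) p = A x p - A y p"
  using A_add(1)[of "x - y" y p] by simp

lemma A_mult: "A (x * y) p = A x (A y p)"
  by (simp add: A_def act_mult sig)

lemma A_scalar: "A (QPi c 0 *c 1) p = psc c (A 1 p)"
  by (simp add: A_def act_one sig)

lemma A_psc: "A x (psc c p) = psc c (A x p)"
proof -
  have "A x (psc c p) = sig (act (x * (QPi c 0 *c 1)) (fm.rho p))"
    by (simp add: A_def fm.rho_psc act_mult)
  also have "x * (QPi c 0 *c 1) = QPi c 0 *c 1 * x" by (simp add: csmult_mult)
  finally show ?thesis by (simp add: A_def act_mult sig)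
qed

lemma A_linear: "Vector_Spaces.linear psc psc (A x)"
  unfolding Vector_Spaces.linear_iff using vector_space_psc by (simp add: A_add A_psc)

lemma A_rel: "r \<in> urels D \<Longrightarrow> A r p = 0"
  by (simp add: A_def act_rel sig_zero)

lemma A_sum: "A (sum f S) p = (\<Sum>k\<in>S. A (f k) p)" 
  by (induction S rule: infinite_finite_induct) (simp_all add: A_add)

abbreviation ev_root :: "'y \<Rightarrow> 'i \<Rightarrow> int" where "ev_root \<mu> i \<equiv> pairing D \<mu> (sroot D i)"

lemma rels:
  "gen (GK \<mu>) * gen (GE i) - (qq powi ev_root \<mu> i) *c (gen (GE i) * gen (GK \<mu>)) \<in> urels D"
  "gen (GJ \<mu>) * gen (GE i) - (pp powi ev_root \<mu> i) *c (gen (GE i) * gen (GJ \<mu>)) \<in> urels D"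
  "gen (GK \<mu>) * gen (GF i) - (qq powi (- ev_root \<mu> i)) *c (gen (GF i) * gen (GK \<mu>)) \<in> urels D"
  "gen (GJ \<mu>) * gen (GF i) - (pp powi (- ev_root \<mu> i)) *c (gen (GF i) * gen (GJ \<mu>)) \<in> urels D"
  "gen (GE i) * gen (GF j) - (pp powi (pari D i * pari D j)) *c (gen (GF j) * gen (GE i))
    - (if i = j then inverse (ppi D i * qi D i - inverse (qi D i)) *c
        (gen (GJ (zscale (dd D i) (coroot D i))) * gen (GK (zscale (dd D i) (coroot D i)))
          - gen (GK (- zscale (dd D i) (coroot D i)))) else 0) \<in> urels D"
  "x \<in> radical D \<Longrightarrow> substitute (\<lambda>i. gen (GE i)) x \<in> urels D"
  "x \<in> radical D \<Longrightarrow> substitute (\<lambda>i. gen (GF i)) x \<in> urels D"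
  unfolding urels_def Let_def by blast+

text \<open>Inside the copy of M, the part of the weight space on which pi acts by
  \<open>s\<close>.\<close>

definition V :: "rat poly fract \<Rightarrow> 'x \<Rightarrow> ('m \<Rightarrow>\<^sub>0 rat poly fract) set" where
  "V s l = {p. A 1 p = p \<and> A (pp *c 1) p = psc s p \<and>
     (\<forall>\<mu>. A (gen (GK \<mu>)) p = psc (qf powi pairing D \<mu> l) p \<and>
          A (gen (GJ \<mu>)) p = psc (s powi pairing D \<mu> l) p)}"

lemma A_const:
  assumes "A 1 p = p" "A (pp *c 1) p = psc s p" shows "A (c *c 1) p = psc (ev s c) p"
proof -
  interpret vs: vector_space "psc :: _ \<Rightarrow> ('m \<Rightarrow>\<^sub>0 rat poly fract) \<Rightarrow> _" by (rule vector_space_psc)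
  obtain a b where c: "c = QPi a b" by (cases c)
  have "QPi a b = QPi a 0 + QPi b 0 * pp"
    by (simp add: plus_qpi_def times_qpi_def pp_def)
  then have "c *c 1 = QPi a 0 *c 1 + QPi b 0 *c 1 * (pp *c (1 :: ('i, 'y) ugen free_alg))"
    by (simp add: c csmult_mult mult.commute)
  then show ?thesis using assms
    by (simp add: A_add A_mult A_scalar c A_psc vs.scale_left_distrib mult.commute)
qed

lemma A_csmult:
  assumes "p \<in> V s l" shows "A (c *c x) p = psc (ev s c) (A x p)"
proof -
  have "c *c x = x * (c *c 1)" by (simp add: csmult_mult)
  moreover have "A 1 p = p" "A (pp *c 1) p = psc s p" using assms by (simp_all add: V_def)
  ultimately show ?thesis by (simp only: A_mult A_const A_psc)
qed

lemma A_rel_eq: "x - y \<in> urels D \<Longrightarrow> A x p = A y p"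
  using A_rel[of "x - y" p] by (simp add: A_diff)

lemma psc_simps: "psc c (psc e p) = psc (c * e) p" "psc 1 p = p" "psc c 0 = 0" "psc 0 p = 0"
    "psc c (p + r) = psc c p + psc c r" "psc c (p - r) = psc c p - psc c r"
    "psc (c + e) p = psc c p + psc e p" "psc (c - e) p = psc c p - psc e p"
  by (rule poly_mapping_eqI, simp add: lookup_add lookup_minus algebra_simps)+

lemma A_const_comm: "A (c *c 1) (A x p) = A x (A (c *c 1) p)"
  by (simp add: csmult_mult flip: A_mult)

lemma A_1: "A 1 (A x p) = A x p"
  by (simp flip: A_mult)

lemma E_V:
  assumes s: "s * s = 1" and p: "p \<in> V s l"
  shows "A (gen (GE i)) p \<in> V s (l + sroot D i)" "A (gen (GF i)) p \<in> V s (l - sroot D i)"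
proof -
  have p': "A 1 p = p" "A (pp *c 1) p = psc s p" "A (gen (GK \<mu>)) p = psc (qf powi pairing D \<mu> l) p"
    "A (gen (GJ \<mu>)) p = psc (s powi pairing D \<mu> l) p" for \<mu> using p by (auto simp: V_def)
  have pair: "qf powi pairing D \<mu> (l + sroot D i) = qf powi ev_root \<mu> i * qf powi pairing D \<mu> l"
    "s powi pairing D \<mu> (l + sroot D i) = s powi ev_root \<mu> i * s powi pairing D \<mu> l"
    "qf powi pairing D \<mu> (l - sroot D i) = qf powi (- ev_root \<mu> i) * qf powi pairing D \<mu> l"
    "s powi pairing D \<mu> (l - sroot D i) = s powi (- ev_root \<mu> i) * s powi pairing D \<mu> l" for \<mu>
    by (simp_all add: pairing_simps[OF rd] sq_nz[OF s] add.commute flip: power_int_add)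
  have "A (gen (GK \<mu>)) (A (gen (GE i)) p) = psc (qf powi pairing D \<mu> (l + sroot D i)) (A (gen (GE i)) p)"
    "A (gen (GJ \<mu>)) (A (gen (GE i)) p) = psc (s powi pairing D \<mu> (l + sroot D i)) (A (gen (GE i)) p)"
    "A (gen (GK \<mu>)) (A (gen (GF i)) p) = psc (qf powi pairing D \<mu> (l - sroot D i)) (A (gen (GF i)) p)"
    "A (gen (GJ \<mu>)) (A (gen (GF i)) p) = psc (s powi pairing D \<mu> (l - sroot D i)) (A (gen (GF i)) p)" for \<mu>
    using A_rel_eq[OF rels(1), of \<mu> i p] A_rel_eq[OF rels(2), of \<mu> i p]
      A_rel_eq[OF rels(3), of \<mu> i p] A_rel_eq[OF rels(4), of \<mu> i p]
    unfolding pair A_csmult[OF p] A_mult p' A_psc psc_simps(1) ev_qq_powi[OF s] ev_pp_powi[OF s] .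
  moreover have "A (pp *c 1) (A x p) = psc s (A x p)" for x
    by (simp only: A_const_comm p' A_psc)
  ultimately show "A (gen (GE i)) p \<in> V s (l + sroot D i)" "A (gen (GF i)) p \<in> V s (l - sroot D i)"
    by (simp_all add: V_def A_1)
qed

lemma ev_den:
  assumes s: "s * s = 1"
  shows "ev s (inverse (ppi D i * qi D i - inverse (qi D i))) =
    inverse (s ^ pn i * qf powi dd D i - qf powi (- dd D i))"
proof -
  have e: "ev t (ppi D i * qi D i - inverse (qi D i)) = t ^ pn i * qf powi dd D i - qf powi (- dd D i)" if t: "t * t = 1" for t
  proof -
    have "ev t (inverse (qi D i)) = inverse (ev t (qi D i))"
      by (rule ev_inverse[OF t]) (rule ev_qi_nz)
    then show ?thesis by (simp only: ev_simps ev_mult[OF t] ev_ppi[OF t] ev_qi[OF t] power_int_minus)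
  qed
  have nz: "ev t (ppi D i * qi D i - inverse (qi D i)) \<noteq> 0" if t: "t * t = 1" for t
  proof -
    interpret qdatum qf t "dot D" "dd D" pn cartan by (rule qdatum_s[OF t])
    show ?thesis unfolding e[OF t] using denom_nz[of i] by (simp only: ep_def) simp
  qed
  have "ev s (inverse (ppi D i * qi D i - inverse (qi D i))) = inverse (ev s (ppi D i * qi D i - inverse (qi D i)))"
    by (rule ev_inverse[OF s]) (rule nz)
  then show ?thesis unfolding e[OF s] .
qed

lemma EF_raw:
  assumes s: "s * s = 1" and p: "p \<in> V s l"
  defines "nl \<equiv> \<lambda>i. pairing D (coroot D i) l"
  shows "A (gen (GE i)) (A (gen (GF j)) p) = psc (s ^ (pn i * pn j)) (A (gen (GF j)) (A (gen (GE i)) p)) +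
    (if i = j then psc ((s powi (dd D i * nl i) * qf powi (dd D i * nl i) - qf powi (- (dd D i * nl i))) /
      (s ^ pn i * qf powi dd D i - qf powi (- dd D i))) p else 0)"
proof -
  have p': "A (gen (GK \<mu>)) p = psc (qf powi pairing D \<mu> l) p"
    "A (gen (GJ \<mu>)) p = psc (s powi pairing D \<mu> l) p" for \<mu> using p by (auto simp: V_def)
  have pi: "ev s (pp powi (pari D i * pari D j)) = s ^ (pn i * pn j)"
  proof -
    have "pari D i * pari D j = int (pn i * pn j)" by (simp only: pari_pn of_nat_mult)
    then show ?thesis using ev_pp_powi[OF s, of "int (pn i * pn j)"] by (simp only: power_int_of_nat)
  qed
  show ?thesis
  proof (cases "i = j")
    case False
    then have "A (gen (GE i) * gen (GF j)) p = A ((pp powi (pari D i * pari D j)) *c (gen (GF j) * gen (GE i))) p"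
      using rels(5)[of i j] by (intro A_rel_eq) simp
    then show ?thesis using False by (simp add: A_csmult[OF p] pi A_mult)
  next
    case True
    let ?h = "zscale (dd D i) (coroot D i)"
    let ?c = "inverse (ppi D i * qi D i - inverse (qi D i))"
    have "A (gen (GE i) * gen (GF j) - (pp powi (pari D i * pari D j)) *c (gen (GF j) * gen (GE i))) p =
        A (?c *c (gen (GJ ?h) * gen (GK ?h) - gen (GK (- ?h)))) p"
      using rels(5)[of i j] True by (intro A_rel_eq) simp
    also have "\<dots> = psc (ev s ?c) (A (gen (GJ ?h)) (A (gen (GK ?h)) p) - A (gen (GK (- ?h))) p)"
      by (simp only: A_csmult[OF p] A_diff A_mult)
    also have "\<dots> = psc ((s powi (dd D i * nl i) * qf powi (dd D i * nl i) - qf powi (- (dd D i * nl i))) /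
      (s ^ pn i * qf powi dd D i - qf powi (- dd D i))) p"
      unfolding p' A_psc pairing_simps[OF rd] ev_den[OF s] psc_simps(1) nl_def psc_simps(8)[symmetric]
      by (simp only: divide_inverse mult.commute)
    finally show ?thesis
      unfolding if_P[OF True] A_diff A_csmult[OF p] A_mult pi by (simp only: diff_eq_eq add.commute)
  qed
qed

lemma wact_A:
  assumes "A 1 p = p" shows "wact (\<lambda>i. A (gen (f i))) w p = A (word (map f w)) p"
proof (induction w)
  case Nil
  then show ?case using assms by (simp add: one_word)
next
  case (Cons i w)
  have "word (map f (i # w)) = gen (f i) * word (map f w)" by (simp add: gen_def word_mult)
  then show ?case using Cons by (simp add: A_mult)
qed

text \<open>\<open>lift s t\<close> takes the value \<open>t\<close> at \<open>\<pi> = s\<close> and \<open>0\<close> at \<open>\<pi> = - s\<close>; \<open>lift s 1\<close> is an idempotent.\<close>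

definition lift :: "rat poly fract \<Rightarrow> rat poly fract \<Rightarrow> qpi" where
  "lift s t = QPi (t / 2) (s * t / 2)"

lemma ev_lift:
  assumes s: "s * s = 1" and s': "s' * s' = 1"
  shows "ev s' (lift s t) = (if s' = s then t else 0)"
proof (cases "s' = s")
  case True
  have "s * (s * t) = t" using s by (simp flip: mult.assoc)
  then show ?thesis using True by (simp add: lift_def field_simps)
next
  case False
  have "(s' - s) * (s' + s) = 0" using s s' by (simp add: algebra_simps)
  then have "s' = - s" using False by (simp add: add_eq_0_iff)
  moreover have "s * (s * t) = t" using s by (simp flip: mult.assoc)
  ultimately show ?thesis using False by (simp add: lift_def field_simps)
qed

text \<open>An element of the radical at pi = s has to come from the radical over the coefficient
  ring. Lifting its coefficients by \<open>lift s\<close> makes it 0 at the other evaluation, where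
  no condition remains.\<close>

lemma rad_A:
  assumes s: "s * s = 1" and p: "p \<in> V s l"
    and rad: "qform.rad (\<lambda>u v. ev s (fb u v)) N x"
    and rel: "\<And>z. z \<in> radical D \<Longrightarrow> substitute (\<lambda>i. gen (f i)) z \<in> urels D"
  shows "(\<Sum>u\<in>words N. psc (x u) (wact (\<lambda>i. A (gen (f i))) u p)) = 0"
proof -
  interpret qform qf s "dot D" "dd D" pn cartan "\<lambda>u v. ev s (fb u v)" by (rule qform_s[OF s])
  define z where "z = (\<Sum>u\<in>words N. lift s (x u) *c word u)"
  have "pair z (\<lambda>u. fb u v) = 0" for v
  proof (rule qpi_eqI)
    fix s' :: "rat poly fract" assume s': "s' * s' = 1"
    have "ev s' (pair z (\<lambda>u. fb u v)) = (if s' = s then \<Sum>u\<in>words N. x u * ev s (fb u v) else 0)"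
      by (simp add: z_def ev_sum ev_mult[OF s'] ev_lift[OF s s'])
    also have "\<dots> = 0"
    proof (cases "length v = N")
      case True
      then show ?thesis using rad by (simp add: rad_def)
    next
      case False
      have "ev s (fb u v) = 0" if "length u = N" for u
        using b_mset[of u v] False that by (metis size_mset)
      then show ?thesis by simp
    qed
    finally show "ev s' (pair z (\<lambda>u. fb u v)) = ev s' 0" by simp
  qed
  then have "z \<in> radical D" by (simp add: radical_iff)
  then have "A (substitute (\<lambda>i. gen (f i)) z) p = 0" using rel A_rel by blast
  then have "(\<Sum>u\<in>words N. A (lift s (x u) *c word (map f u)) p) = 0"
    by (simp only: z_def substitute_sum substitute_csmult substitute_word prod_list_gen A_sum)
  moreover have "A 1 p = p" using p by (simp add: V_def)
  ultimately show ?thesis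
    by (simp add: A_csmult[OF p] wact_A ev_lift[OF s s])
qed

text \<open>The image of the coset is a singleton because radical elements are sent to defining
  relations, so \<open>the_elem\<close> in \<open>U_plus\<close> is meaningful.\<close>

lemma U_plus_word: "U_plus D (radical D +>\<^bsub>ring_of_type_algebra\<^esub> word w) = ucls D (word (map GE w))"
proof -
  let ?f = "\<lambda>y. ucls D (substitute (\<lambda>i. gen (GE i)) y)"
  have zero: "0 \<in> radical D" by (simp add: radical_iff)
  have "?f y = ucls D (word (map GE w))" if y: "y \<in> radical D +>\<^bsub>ring_of_type_algebra\<^esub> word w" for y
  proof -
    obtain h where h: "h \<in> radical D" "y = h + word w" using y by (auto simp: a_r_coset_def')
    have r: "ucls D (substitute (\<lambda>i. gen (GE i)) h) = \<zero>\<^bsub>UU D\<^esub>"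
      by (rule ucls_rel[OF rels(6)[OF h(1)]])
    show ?thesis
      unfolding h(2) substitute_add ucls_simps(3) r substitute_word prod_list_gen
      by (rule L.R.l_zero) (rule ucls_simps)
  qed
  moreover have "word w \<in> radical D +>\<^bsub>ring_of_type_algebra\<^esub> word w"
    using zero by (auto simp: a_r_coset_def' intro!: exI[of _ 0])
  ultimately have "?f ` (radical D +>\<^bsub>ring_of_type_algebra\<^esub> word w) = {ucls D (word (map GE w))}"
    by blast
  then show ?thesis by (simp add: U_plus_def)
qed

lemma ht_wt: "ht (wt w) = int (length w)"
  by (induction w) (simp_all add: ht_def sum.distrib)

lemma E_nil:
  assumes "A 1 p = p"
  shows "\<exists>N. \<forall>w. N \<le> length w \<longrightarrow> wact (\<lambda>i. A (gen (GE i))) w p = 0"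
proof -
  obtain N :: nat where N: "\<And>\<nu> x. \<lbrakk>int N \<le> ht \<nu>; x \<in> ff_wt D \<nu>\<rbrakk> \<Longrightarrow> U_plus D x \<odot> fm.rho p = \<zero>"
    using Oint fm.rho_closed[of p] unfolding cat_O_int_def cat_O_def by blast
  have "wact (\<lambda>i. A (gen (GE i))) w p = 0" if "N \<le> length w" for w
  proof -
    have "word w \<in> fwt (wt w)" by (simp add: fwt_def word_def)
    then have "radical D +>\<^bsub>ring_of_type_algebra\<^esub> word w \<in> ff_wt D (wt w)" by (simp add: ff_wt_def)
    moreover have "int N \<le> ht (wt w)" using that by (simp add: ht_wt)
    ultimately have "U_plus D (radical D +>\<^bsub>ring_of_type_algebra\<^esub> word w) \<odot> fm.rho p = \<zero>"
      by (intro N)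
    then have "act (word (map GE w)) (fm.rho p) = \<zero>"
      by (simp only: U_plus_word act_def)
    then show ?thesis by (simp add: wact_A[OF assms] A_def sig_zero)
  qed
  then show ?thesis by blast
qed

lemma U_F_pow: "U_F D i [^]\<^bsub>UU D\<^esub> (k::nat) = ucls D (word (replicate k (GF i)))"
proof (induction k)
  case 0
  then show ?case by (simp add: ucls_simps flip: one_word)
next
  case (Suc k)
  have "U_F D i [^]\<^bsub>UU D\<^esub> Suc k = ucls D (word (replicate k (GF i))) \<otimes>\<^bsub>UU D\<^esub> ucls D (word [GF i])"
    using Suc by (simp add: U_F_def gen_def)
  also have "\<dots> = ucls D (word (replicate k (GF i) @ [GF i]))"
    by (simp only: word_mult flip: ucls_simps(2))
  finally show ?case by (simp add: replicate_append_same)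
qed

lemma F_nil:
  assumes s: "s * s = 1" and p: "p \<in> V s l"
  shows "\<exists>N. (A (gen (GF i)) ^^ N) p = 0"
proof -
  obtain N where N: "U_Fdiv D i N \<odot> fm.rho p = \<zero>"
    using Oint fm.rho_closed[of p] unfolding cat_O_int_def cat_C_int_def by blast
  have p1: "A 1 p = p" using p by (simp add: V_def)
  have "U_Fdiv D i N = ucls D (inverse (qfact D i N) *c word (replicate N (GF i)))"
    by (simp add: U_Fdiv_def U_scalar_def U_F_pow csmult_mult flip: ucls_simps(2))
  then have "A (inverse (qfact D i N) *c word (replicate N (GF i))) p = 0"
    using N by (simp add: A_def act_def sig_zero)
  then have "psc (ev s (inverse (qfact D i N))) (A (word (replicate N (GF i))) p) = 0"
    by (simp add: A_csmult[OF p])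
  moreover have "ev s (inverse (qfact D i N)) \<noteq> 0"
  proof -
    have "ev s (inverse (qfact D i N)) = inverse (ev s (qfact D i N))"
      by (rule ev_inverse[OF s]) (rule qfact_unit)
    then show ?thesis using qfact_unit[OF s, of i N] by simp
  qed
  ultimately have "A (word (replicate N (GF i))) p = 0"
    using vector_space.scale_eq_0_iff[OF vector_space_psc] by blast
  then have "wact (\<lambda>i. A (gen (GF i))) (replicate N i) p = 0" by (simp add: wact_A[OF p1])
  moreover have "wact f (replicate N i) p = (f i ^^ N) p" for f :: "'i \<Rightarrow> ('m \<Rightarrow>\<^sub>0 rat poly fract) \<Rightarrow> _"
    by (induction N) simp_all
  ultimately show ?thesis by (intro exI[of _ N]) simp
qed

lemma V_subspace: "Modules.module.subspace psc (V s l)"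
proof -
  interpret vs: vector_space "psc :: _ \<Rightarrow> ('m \<Rightarrow>\<^sub>0 rat poly fract) \<Rightarrow> _" by (rule vector_space_psc)
  show ?thesis
    by (auto simp: vs.subspace_def V_def A_add A_psc psc_simps mult.commute)
qed

lemma qmod_s:
  assumes s: "s * s = 1"
  shows "qmod qf s (dot D) (dd D) pn cartan (\<lambda>u v. ev s (fb u v)) psc (sroot D)
    (\<lambda>i. pairing D (coroot D i)) (V s) (\<lambda>i. A (gen (GE i))) (\<lambda>i. A (gen (GF i)))"
proof (intro qmod.intro qform_s[OF s] vector_space_psc qmod_axioms.intro)
  fix i j l
  have "pairing D (coroot D i) (sroot D j) * dot D i i = cartan i j * dot D i i"
    using rd by (simp add: root_datum_def cartan_mult)
  then show "pairing D (coroot D i) (l + sroot D j) = pairing D (coroot D i) l + cartan i j"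
    using dot_diag[of i] by (simp add: pairing_simps[OF rd])
  show "mset u = mset w" if "(\<Sum>i\<leftarrow>u. sroot D i) = (\<Sum>i\<leftarrow>w. sroot D i)" for u w
    using that by (rule sroot_words[OF rd])
  show "Modules.module.subspace psc (V s l)" by (rule V_subspace)
  show "Vector_Spaces.linear psc psc (A (gen (GE i)))" "Vector_Spaces.linear psc psc (A (gen (GF i)))"
    by (rule A_linear)+
  fix m assume m: "m \<in> V s l"
  then have m1: "A 1 m = m" by (simp add: V_def)
  show "A (gen (GE i)) m \<in> V s (l + sroot D i)" "A (gen (GF i)) m \<in> V s (l - sroot D i)"
    by (rule E_V[OF s m])+
  show "A (gen (GE i)) (A (gen (GF j)) m) = psc (s ^ (pn i * pn j)) (A (gen (GF j)) (A (gen (GE i)) m)) +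
     (if i = j then psc ((s powi (dd D i * pairing D (coroot D i) l) * qf powi (dd D i * pairing D (coroot D i) l) -
        qf powi - (dd D i * pairing D (coroot D i) l)) / (qdatum.ep s pn i * qf powi dd D i - qf powi - dd D i)) m else 0)"
    unfolding qdatum.ep_def[OF qdatum_s[OF s]] by (rule EF_raw[OF s m])
  show "\<exists>N. \<forall>w. N \<le> length w \<longrightarrow> wact (\<lambda>i. A (gen (GE i))) w m = 0" by (rule E_nil[OF m1])
  show "\<exists>N. (A (gen (GF i)) ^^ N) m = 0" by (rule F_nil[OF s m])
  fix N x assume "qform.rad (\<lambda>u v. ev s (fb u v)) N x"
  then show "(\<Sum>u\<in>words N. psc (x u) (wact (\<lambda>i. A (gen (GE i))) u m)) = 0"
    "(\<Sum>u\<in>words N. psc (x u) (wact (\<lambda>i. A (gen (GF i))) u m)) = 0"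
    using rad_A[OF s m _ rels(6)] rad_A[OF s m _ rels(7)] by simp_all
qed

section \<open>Sums of simple submodules\<close>

definition simple_sum :: "'m set" where
  "simple_sum = sum_of_submodules M {N. simple_U_submodule D M G N}"

lemma simple_subgroup:
  assumes "simple_U_submodule D M G N"
  shows "N \<subseteq> carrier M" "\<zero> \<in> N" "x \<in> N \<Longrightarrow> y \<in> N \<Longrightarrow> x \<oplus> y \<in> N"
proof -
  have "subgroup N (add_monoid M)"
    using assms by (simp add: simple_U_submodule_def U_submodule_def submodule_def)
  then show "N \<subseteq> carrier M" "\<zero> \<in> N" "x \<in> N \<Longrightarrow> y \<in> N \<Longrightarrow> x \<oplus> y \<in> N"
    using subgroup.subset subgroup.one_closed subgroup.m_closed by fastforce+
qed

lemma simple_sum_zero: "\<zero> \<in> simple_sum"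
  unfolding simple_sum_def sum_of_submodules_def
  by (rule CollectI, rule exI[of _ "{}"], rule exI[of _ "\<lambda>_. \<zero>"]) simp

lemma simple_sum_mem:
  assumes "simple_U_submodule D M G N" "x \<in> N" shows "x \<in> simple_sum"
proof -
  have "x \<in> carrier M" using simple_subgroup(1)[OF assms(1)] assms(2) by blast
  then have "x = (\<Oplus>N\<in>{N}. x)" by simp
  then show ?thesis
    unfolding simple_sum_def sum_of_submodules_def
    by (intro CollectI exI[of _ "{N}"] exI[of _ "\<lambda>_. x"]) (use assms in simp)
qed

lemma simple_sum_closed: "simple_sum \<subseteq> carrier M"
proof
  fix x assume "x \<in> simple_sum"
  then obtain T f where h: "x = (\<Oplus>N\<in>T. f N)" "T \<subseteq> {N. simple_U_submodule D M G N}" "\<forall>N\<in>T. f N \<in> N"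
    unfolding simple_sum_def sum_of_submodules_def by blast
  have "f \<in> T \<rightarrow> carrier M" using h simple_subgroup(1) by blast
  then show "x \<in> carrier M" unfolding h(1) by (rule L.finsum_closed)
qed

lemma simple_sum_add:
  assumes "x \<in> simple_sum" "y \<in> simple_sum" shows "x \<oplus> y \<in> simple_sum"
proof -
  let ?S = "{N. simple_U_submodule D M G N}"
  \<comment> \<open>Decompositions are indexed by the submodules themselves; both are padded with
    zeros to the common index set.\<close>
  have ex: "\<exists>f'. x = (\<Oplus>N\<in>T \<union> T'. f' N) \<and> (\<forall>N\<in>T \<union> T'. f' N \<in> N)"
    if h: "x = (\<Oplus>N\<in>T. f N)" "finite T" "T \<subseteq> ?S" "\<forall>N\<in>T. f N \<in> N" "finite T'" "T' \<subseteq> ?S" for x f T T'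
  proof -
    define f' where "f' = (\<lambda>N. if N \<in> T then f N else \<zero>)"
    have f': "f' N \<in> N" if "N \<in> T \<union> T'" for N
      using h that simple_subgroup(2) by (auto simp: f'_def)
    have "(\<Oplus>N\<in>T. f N) = (\<Oplus>N\<in>T \<union> T'. f' N)"
    proof (rule L.add.finprod_mono_neutral_cong_left)
      show "f' \<in> T \<union> T' \<rightarrow> carrier M" using f' h simple_subgroup(1) by blast
    qed (use h in \<open>auto simp: f'_def\<close>)
    then show ?thesis using h f' by blast
  qed
  obtain T f where T: "x = (\<Oplus>N\<in>T. f N)" "finite T" "T \<subseteq> ?S" "\<forall>N\<in>T. f N \<in> N"
    using assms(1) unfolding simple_sum_def sum_of_submodules_def by blast
  obtain T' g where T': "y = (\<Oplus>N\<in>T'. g N)" "finite T'" "T' \<subseteq> ?S" "\<forall>N\<in>T'. g N \<in> N"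
    using assms(2) unfolding simple_sum_def sum_of_submodules_def by blast
  obtain f' where f': "x = (\<Oplus>N\<in>T \<union> T'. f' N)" "\<forall>N\<in>T \<union> T'. f' N \<in> N"
    using ex[OF T T'(2,3)] by blast
  obtain g' where g': "y = (\<Oplus>N\<in>T \<union> T'. g' N)" "\<forall>N\<in>T \<union> T'. g' N \<in> N"
    using ex[OF T' T(2,3)] by (auto simp: Un_commute)
  have "f' \<in> T \<union> T' \<rightarrow> carrier M" "g' \<in> T \<union> T' \<rightarrow> carrier M"
    using f'(2) g'(2) T(3) T'(3) simple_subgroup(1) by blast+
  then have "x \<oplus> y = (\<Oplus>N\<in>T \<union> T'. f' N \<oplus> g' N)"
    unfolding f'(1) g'(1) by (rule L.finsum_addf[symmetric])
  moreover have "\<forall>N\<in>T \<union> T'. f' N \<oplus> g' N \<in> N"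
  proof
    fix N assume N: "N \<in> T \<union> T'"
    then have "simple_U_submodule D M G N" using T(3) T'(3) by blast
    then show "f' N \<oplus> g' N \<in> N" using f'(2) g'(2) N by (intro simple_subgroup(3)) blast+
  qed
  ultimately show ?thesis
    unfolding simple_sum_def sum_of_submodules_def
    by (intro CollectI exI[of _ "T \<union> T'"] exI[of _ "\<lambda>N. f' N \<oplus> g' N"] conjI) (use T T' in auto)
qed

lemma simple_sum_finsum: "(\<And>k. k \<in> K \<Longrightarrow> f k \<in> simple_sum) \<Longrightarrow> (\<Oplus>k\<in>K. f k) \<in> simple_sum"
proof (induction K rule: infinite_finite_induct)
  case (insert k K)
  then have "f \<in> K \<rightarrow> carrier M" "f k \<in> carrier M" using simple_sum_closed by auto
  then show ?case using insert by (simp add: simple_sum_add)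
qed (simp_all add: simple_sum_zero)

section \<open>Homogeneous components\<close>

lemma G_sub: "G b \<subseteq> carrier M"
  using graded additive_subgroup.a_subset unfolding graded_U_module_def internal_direct_sum_def by blast

text \<open>Compares two decompositions of zero, the trivial one and the one given by
  \<open>x\<close> and \<open>y\<close>.\<close>

lemma G_direct:
  assumes "x \<in> G 0" "y \<in> G 1" "x \<oplus> y = \<zero>"
  shows "x = \<zero>" "y = \<zero>"
proof -
  have xy: "x \<in> carrier M" "y \<in> carrier M" using assms G_sub by blast+
  have sub: "additive_subgroup (G b) M" for b
    using graded by (simp add: graded_U_module_def internal_direct_sum_def)
  define P where "P = (\<lambda>f. (\<forall>l. f l \<in> G l) \<and> finite {l. f l \<noteq> \<zero>} \<and>
    \<zero> = (\<Oplus>l\<in>{l. f l \<noteq> \<zero>}. f l))"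
  have "\<exists>!f. P f"
    using graded unfolding graded_U_module_def internal_direct_sum_def P_def by simp
  then have uniq: "f = g" if "P f" "P g" for f g using that by blast
  define f where "f = (\<lambda>b :: bit. if b = 0 then x else y)"
  have "l = 0 \<or> l = 1" for l :: bit by (cases l) simp_all
  then have U: "(UNIV :: bit set) = {0, 1}" by blast
  have fc: "f \<in> UNIV \<rightarrow> carrier M" using xy by (simp add: f_def)
  have fin: "finite (S :: bit set)" for S by (rule finite_subset[OF subset_UNIV]) (simp add: U)
  have fG: "f l \<in> G l" for l using assms by (cases l) (simp_all add: f_def)
  have "(\<Oplus>l\<in>{l. f l \<noteq> \<zero>}. f l) = (\<Oplus>l\<in>UNIV. f l)"
    by (rule L.add.finprod_mono_neutral_cong_left) (use fc in \<open>auto simp: fin\<close>)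
  also have "\<dots> = x \<oplus> y" unfolding U using xy by (simp add: f_def)
  finally have "P f" using assms(3) fG by (simp add: P_def fin)
  moreover have "P (\<lambda>_. \<zero>)"
    using additive_subgroup.zero_closed[OF sub] by (simp add: P_def)
  ultimately have "f = (\<lambda>_. \<zero>)" by (rule uniq)
  then show "x = \<zero>" "y = \<zero>" by (auto simp: f_def fun_eq_iff split: if_splits)
qed

definition hom_par :: "bit \<Rightarrow> ('i, 'y) ugen free_alg \<Rightarrow> bool" where
  "hom_par a x \<longleftrightarrow> (\<forall>w\<in>Poly_Mapping.keys x. sum_list (map (ugen_par D) w) = a)"

lemma act_par: "hom_par a x \<Longrightarrow> m \<in> G b \<Longrightarrow> act x m \<in> G (a + b)"
proof -
  assume h: "hom_par a x" "m \<in> G b"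
  then have "ucls D x \<in> U_par D a" by (auto simp: hom_par_def U_par_def)
  then show ?thesis using graded h(2) unfolding graded_U_module_def act_def by blast
qed

text \<open>Taken relative to \<open>a\<close>, so that on a vector of degree \<open>a\<close> the
  two parts land in degrees 0 and 1.\<close>

lemma hom_par_split: "\<exists>x0 x1. x = x0 + x1 \<and> hom_par a x0 \<and> hom_par (a + 1) x1"
proof (induction x rule: free_induct)
  case zero
  show ?case by (intro exI[of _ 0]) (simp add: hom_par_def)
next
  case (add x y)
  then obtain x0 x1 y0 y1 where "x = x0 + x1" "hom_par a x0" "hom_par (a + 1) x1"
    "y = y0 + y1" "hom_par a y0" "hom_par (a + 1) y1" by blast
  moreover have "hom_par c (u + v)" if "hom_par c u" "hom_par c v" for c u v
    using that keys_add[of u v] by (auto simp: hom_par_def)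
  ultimately show ?case
    by (intro exI[of _ "x0 + y0"] exI[of _ "x1 + y1"]) (simp add: algebra_simps)
next
  case (single w c)
  have z: "hom_par b 0" for b by (simp add: hom_par_def)
  have "b = a \<or> b = a + 1" for b :: bit by (cases a; cases b) simp_all
  then consider "sum_list (map (ugen_par D) w) = a" | "sum_list (map (ugen_par D) w) = a + 1" by blast
  then show ?case
  proof cases
    case 1
    then have "hom_par a (Poly_Mapping.single w c)" by (auto simp: hom_par_def)
    then show ?thesis using z by (metis add.right_neutral)
  next
    case 2
    then have "hom_par (a + 1) (Poly_Mapping.single w c)" by (auto simp: hom_par_def)
    then show ?thesis using z by (metis add.left_neutral)
  qed
qed

section \<open>Highest weight submodules\<close>

lemma rho_zero: "fm.rho 0 = \<zero>"
  by (simp add: fm.rho_def)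

lemma A_word: "A 1 p = p \<Longrightarrow> A (word []) p = p" "A (word (g # w)) p = A (gen g) (A (word w) p)"
  by (simp_all add: one_word gen_def word_mult flip: A_mult)

lemma A_expand:
  assumes "p \<in> V s l"
  shows "A x p = (\<Sum>w\<in>Poly_Mapping.keys x. psc (ev s (Poly_Mapping.lookup x w)) (A (word w) p))"
proof -
  have "A x p = A (\<Sum>w\<in>Poly_Mapping.keys x. Poly_Mapping.lookup x w *c word w) p"
    by (subst poly_mapping_single_sum) (simp only: single_word)
  then show ?thesis by (simp add: A_sum A_csmult[OF assms])
qed

lemma pairing_separates: "(\<And>\<mu>. pairing D \<mu> l = pairing D \<mu> l') \<Longrightarrow> l = l'"
proof -
  assume h: "\<And>\<mu>. pairing D \<mu> l = pairing D \<mu> l'"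
  have p: "perfect_pairing (pairing D)" using rd by (simp add: root_datum_def)
  then have "additive (\<lambda>\<mu>. pairing D \<mu> l')" by (simp add: perfect_pairing_def)
  then have "\<exists>!x. (\<lambda>\<mu>. pairing D \<mu> x) = (\<lambda>\<mu>. pairing D \<mu> l')" using p by (simp add: perfect_pairing_def)
  then show ?thesis using h by blast
qed

text \<open>Subtracting the eigenvalue of K at \<open>l0\<close> removes one weight and rescales the
  others, to which the induction hypothesis applies. The element mu is chosen so that the scale
  factor of the weight in question is not 0.\<close>

lemma weight_components:
  assumes "finite \<Lambda>" "\<And>l. l \<in> \<Lambda> \<Longrightarrow> p l \<in> V s l" "(\<Sum>l\<in>\<Lambda>. p l) \<in> Q"
    and sub: "Modules.module.subspace psc Q" and K: "\<And>x \<mu>. x \<in> Q \<Longrightarrow> A (gen (GK \<mu>)) x \<in> Q"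
    and "l \<in> \<Lambda>"
  shows "p l \<in> Q"
  using assms(1,2,3,6)
proof (induction \<Lambda> arbitrary: p l rule: finite_induct)
  case (insert l0 \<Lambda>)
  interpret vs: vector_space "psc :: _ \<Rightarrow> ('m \<Rightarrow>\<^sub>0 rat poly fract) \<Rightarrow> _" by (rule vector_space_psc)
  let ?S = "p l0 + (\<Sum>l\<in>\<Lambda>. p l)"
  have S: "?S \<in> Q" using insert by simp
  have Kp: "A (gen (GK \<mu>)) (p l) = psc (qf powi pairing D \<mu> l) (p l)" if "l \<in> insert l0 \<Lambda>" for l \<mu>
    using insert.prems(1)[OF that] by (simp add: V_def)
  have 1: "p l \<in> Q" if l: "l \<in> \<Lambda>" for l
  proof -
    have "l \<noteq> l0" using l insert by auto
    then obtain \<mu> where \<mu>: "pairing D \<mu> l \<noteq> pairing D \<mu> l0" using pairing_separates by blast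
    define c where "c = (\<lambda>l. qf powi pairing D \<mu> l - qf powi pairing D \<mu> l0)"
    have "A (gen (GK \<mu>)) (\<Sum>l\<in>\<Lambda>. p l) = (\<Sum>l\<in>\<Lambda>. psc (qf powi pairing D \<mu> l) (p l))"
    proof -
      have "A x (sum f S) = (\<Sum>k\<in>S. A x (f k))" for x f and S :: "'x set"
        by (induction S rule: infinite_finite_induct) (simp_all add: A_add)
      then show ?thesis using Kp by simp
    qed
    then have "A (gen (GK \<mu>)) ?S - psc (qf powi pairing D \<mu> l0) ?S = (\<Sum>l\<in>\<Lambda>. psc (c l) (p l))"
      using Kp[of l0 \<mu>] by (simp add: A_add psc_simps c_def sum_subtractf vs.scale_sum_right)
    moreover have "A (gen (GK \<mu>)) ?S - psc (qf powi pairing D \<mu> l0) ?S \<in> Q"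
      using K[OF S] S vs.subspace_diff[OF sub] vs.subspace_scale[OF sub] by blast
    ultimately have Q: "(\<Sum>l\<in>\<Lambda>. psc (c l) (p l)) \<in> Q" by simp
    have "psc (c l) (p l) \<in> Q"
    proof (rule insert.IH[OF _ Q l])
      fix l assume "l \<in> \<Lambda>"
      then show "psc (c l) (p l) \<in> V s l"
        using insert.prems(1) vs.subspace_scale[OF V_subspace] by simp
    qed
    moreover have "c l \<noteq> 0"
    proof
      assume "c l = 0"
      then have "qf powi pairing D \<mu> l = qf powi pairing D \<mu> l0" by (simp add: c_def)
      then have "qf powi (pairing D \<mu> l - pairing D \<mu> l0) = 1" by (simp add: power_int_diff)
      then show False using qf_root \<mu> by fastforce
    qed
    ultimately have "psc (inverse (c l)) (psc (c l) (p l)) \<in> Q" using vs.subspace_scale[OF sub] by blast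
    then show ?thesis using \<open>c l \<noteq> 0\<close> by (simp add: psc_simps)
  qed
  then have "(\<Sum>l\<in>\<Lambda>. p l) \<in> Q" by (intro vs.subspace_sum[OF sub])
  then have "p l0 \<in> Q" using S vs.subspace_diff[OF sub, of ?S "\<Sum>l\<in>\<Lambda>. p l"] by simp
  then show ?case using 1 insert.prems by blast
qed simp

definition sub_gen :: "'m \<Rightarrow> 'm set" where
  "sub_gen m = range (\<lambda>x. act x m)"

lemma sub_gen_U_submodule:
  assumes m: "m \<in> G b" shows "U_submodule D M G (sub_gen m)"
proof -
  have mc: "m \<in> carrier M" using m G_sub by blast
  have "subgroup (sub_gen m) (add_monoid M)"
  proof (rule subgroup.intro)
    fix x assume "x \<in> sub_gen m"
    then obtain y where y: "x = act y m" by (auto simp: sub_gen_def)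
    have "act (- y) m \<oplus> x = \<zero>"
      unfolding y using act_add(1)[OF mc, of "- y" y] act_zero(2)[OF mc] by simp
    then have "\<ominus> x = act (- y) m" using y mc by (intro L.minus_equality) simp_all
    then show "inv\<^bsub>add_monoid M\<^esub> x \<in> sub_gen m" by (simp add: a_inv_def sub_gen_def)
  qed (use mc act_zero(2)[OF mc] in \<open>auto simp: sub_gen_def image_iff act_add(1)[symmetric] intro: exI[of _ 0]\<close>)
  moreover have "c \<odot> x \<in> sub_gen m" if cx: "c \<in> carrier (UU D)" "x \<in> sub_gen m" for c x
  proof -
    obtain y z where "c = ucls D y" "x = act z m" using cx by (auto simp: carrier_UU sub_gen_def)
    then have "c \<odot> x = act (y * z) m" using act_mult[OF mc] by (simp add: act_def)
    then show ?thesis by (simp add: sub_gen_def)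
  qed
  ultimately have "submodule (sub_gen m) (UU D) M"
    by (simp add: submodule_def submodule_axioms_def)
  moreover have "graded_subset M G (sub_gen m)"
    unfolding graded_subset_def
  proof
    fix z assume "z \<in> sub_gen m"
    then obtain x where x: "z = act x m" by (auto simp: sub_gen_def)
    obtain x0 x1 where s: "x = x0 + x1" "hom_par b x0" "hom_par (b + 1) x1" using hom_par_split by blast
    have b: "b + b = 0" "b + 1 + b = 1" by (cases b; simp)+
    have "act x0 m \<in> sub_gen m \<inter> G 0" "act x1 m \<in> sub_gen m \<inter> G 1"
      using act_par[OF s(2) m] act_par[OF s(3) m] by (auto simp: b sub_gen_def)
    then show "\<exists>m0\<in>sub_gen m \<inter> G 0. \<exists>m1\<in>sub_gen m \<inter> G 1. z = m0 \<oplus> m1"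
      using act_add(1)[OF mc] x s(1) by blast
  qed
  ultimately show ?thesis by (simp add: U_submodule_def)
qed

text \<open>A nonzero submodule contains a nonzero weight component of one of its vectors, and by
  \<open>prim_simple\<close> the E_i carry this component to a nonzero multiple of the
  generator.\<close>

lemma sub_gen_simple:
  assumes s: "s * s = 1" and v: "v \<in> V s l" "\<And>i. A (gen (GE i)) v = 0" "v \<noteq> 0" and m: "fm.rho v \<in> G b"
  shows "simple_U_submodule D M G (sub_gen (fm.rho v))"
proof -
  interpret Q: qmod qf s "dot D" "dd D" pn cartan "\<lambda>u v. ev s (fb u v)" psc "sroot D"
    "\<lambda>i. pairing D (coroot D i)" "V s" "\<lambda>i. A (gen (GE i))" "\<lambda>i. A (gen (GF i))"
    by (rule qmod_s[OF s])
  let ?P = "\<lambda>l' v'. l' = l \<and> v' = v"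
  let ?N = "sub_gen (fm.rho v)"
  have prim: "Q.prim l v" using v by (simp add: Q.prim_def)
  then have P: "Q.prim l' v'" if "?P l' v'" for l' v' using that by simp
  have v1: "A 1 v = v" using v(1) by (simp add: V_def)
  \<comment> \<open>Each generator maps one weight space of the highest weight module into another,
    so every word in the generators applied to \<open>v\<close> is a weight vector there.\<close>
  have gen: "\<exists>\<mu>'. A (gen g) x \<in> Q.UP ?P \<mu>'" if x: "x \<in> Q.UP ?P \<mu>" for g x \<mu>
  proof -
    have "x \<in> V s \<mu>" using Q.UP_V[of ?P, OF P x] by simp
    then show ?thesis
      using Q.UP_E[of ?P, OF P x] Q.UP_F[OF x] Q.subspace_scale[OF Q.UP_subspace x]
      by (cases g) (auto simp: V_def)
  qed
  have "v \<in> Q.UP ?P l" using Q.UP_gen[of ?P l v "[]"] by simp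
  then have word: "\<exists>\<mu>. A (word w) v \<in> Q.UP ?P \<mu>" for w
    by (induction w) (auto simp: A_word v1 dest: gen)
  then obtain f where f: "\<And>w. A (word w) v \<in> Q.UP ?P (f w)" by metis
  have mem: "fm.rho v \<in> ?N"
    unfolding sub_gen_def by (rule range_eqI[of _ _ 1]) (simp add: act_one)
  have nz: "fm.rho x \<noteq> \<zero>" if "A 1 x = x" "x \<noteq> 0" for x
  proof
    assume "fm.rho x = \<zero>"
    then have "A 1 x = 0" by (simp add: A_def act_zero sig_zero)
    then show False using that by simp
  qed
  have "N' = {\<zero>} \<or> N' = ?N" if N': "U_submodule D M G N'" "N' \<subseteq> ?N" for N'
  proof (cases "N' = {\<zero>}")
    case False
    have bar_sign: "subgroup N' (add_monoid M)" and "submodule N' (UU D) M"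
      using N'(1) by (simp_all add: U_submodule_def submodule_def)
    then have N'act: "act x z \<in> N'" if "z \<in> N'" for x z
      using that submodule.smult_closed ucls_simps(1) unfolding act_def by metis
    have N'0: "\<zero> \<in> N'" and N'add: "\<And>x y. x \<in> N' \<Longrightarrow> y \<in> N' \<Longrightarrow> x \<oplus> y \<in> N'"
      using subgroup.one_closed[OF bar_sign] subgroup.m_closed[OF bar_sign] by simp_all
    obtain z where z: "z \<in> N'" "z \<noteq> \<zero>" using False N'0 by blast
    then obtain x where x: "z = act x (fm.rho v)" using N'(2) by (auto simp: sub_gen_def)
    \<comment> \<open>The preimage of N' in the ambient vector space, where weight components can be
      separated.\<close>
    define Qs where "Qs = {y. fm.rho y \<in> N'}"
    have sub: "Q.subspace Qs"
      by (auto simp: Q.subspace_def Qs_def rho_zero N'0 fm.rho_add N'add fm.rho_psc N'act)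
    have QA: "A x y \<in> Qs" if "y \<in> Qs" for x y
      using that by (simp add: Qs_def rho_A N'act)
    define c where "c = (\<lambda>w. psc (ev s (Poly_Mapping.lookup x w)) (A (word w) v))"
    define pl where "pl = (\<lambda>\<mu>. \<Sum>w\<in>{w \<in> Poly_Mapping.keys x. f w = \<mu>}. c w)"
    have cU: "c w \<in> Q.UP ?P (f w)" for w
      unfolding c_def by (rule Q.subspace_scale[OF Q.UP_subspace f])
    have plU: "pl \<mu> \<in> Q.UP ?P \<mu>" for \<mu>
      unfolding pl_def using cU by (intro Q.subspace_sum[OF Q.UP_subspace]) auto
    have plV: "pl \<mu> \<in> V s \<mu>" for \<mu> using Q.UP_V[of ?P, OF P plU] by simp
    have sum: "A x v = (\<Sum>\<mu>\<in>f ` Poly_Mapping.keys x. pl \<mu>)"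
    proof -
      have "A x v = (\<Sum>w\<in>Poly_Mapping.keys x. c w)"
        unfolding c_def by (rule A_expand[OF v(1)])
      also have "\<dots> = (\<Sum>\<mu>\<in>f ` Poly_Mapping.keys x. pl \<mu>)"
        unfolding pl_def by (rule sum.image_gen) simp
      finally show ?thesis .
    qed
    have Axv: "A x v \<in> Qs" using z by (simp add: Qs_def rho_A x)
    have "A x v \<noteq> 0" using z(2) rho_A[of x v] rho_zero x by auto
    then obtain \<mu> where \<mu>: "\<mu> \<in> f ` Poly_Mapping.keys x" "pl \<mu> \<noteq> 0"
      unfolding sum by (meson sum.not_neutral_contains_not_neutral)
    have plQ: "pl \<mu> \<in> Qs"
      by (rule weight_components[where \<Lambda> = "f ` Poly_Mapping.keys x" and p = pl and s = s])
        (use plV Axv sum sub QA \<mu>(1) in auto)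
    obtain y e where y: "e \<noteq> 0" "wact (\<lambda>i. A (gen (GE i))) y (pl \<mu>) = psc e v"
      using Q.prim_simple[OF prim plU \<mu>(2)] by blast
    have "wact (\<lambda>i. A (gen (GE i))) y (pl \<mu>) \<in> Qs"
      by (induction y) (simp_all add: plQ QA)
    then have "psc (inverse e) (psc e v) \<in> Qs" unfolding y by (rule Q.subspace_scale[OF sub])
    then have "fm.rho v \<in> N'" using y(1) by (simp add: Qs_def psc_simps)
    then have "?N \<subseteq> N'" using N'act by (auto simp: sub_gen_def)
    then show ?thesis using N'(2) by blast
  qed simp
  moreover have "?N \<noteq> {\<zero>}" using mem nz[OF v1 v(3)] by auto
  ultimately show ?thesis
    using sub_gen_U_submodule[OF m] by (simp add: simple_U_submodule_def)
qed

section \<open>Every vector lies in a sum of simple submodules\<close>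

lemma sig_inj: "x \<in> carrier M \<Longrightarrow> y \<in> carrier M \<Longrightarrow> sig x = sig y \<Longrightarrow> x = y"
  by (metis sig(1))

lemma V_weight_space:
  assumes s: "s * s = 1" and "p \<in> V s l" shows "fm.rho p \<in> weight_space D M l"
proof -
  have c: "A (c *c 1) p = psc (ev s c) p" for c
    using assms by (intro A_const) (simp_all add: V_def)
  have "A (gen (GK \<mu>)) p = A (qq powi pairing D \<mu> l *c 1) p" "A (gen (GJ \<mu>)) p = A (pp powi pairing D \<mu> l *c 1) p" for \<mu>
    using assms(2) by (simp_all add: c V_def ev_qq_powi[OF s] ev_pp_powi[OF s])
  then have "act (gen (GK \<mu>)) (fm.rho p) = act (qq powi pairing D \<mu> l *c 1) (fm.rho p)"
    "act (gen (GJ \<mu>)) (fm.rho p) = act (pp powi pairing D \<mu> l *c 1) (fm.rho p)" for \<mu>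
    by (simp_all add: A_def sig_inj)
  then show ?thesis
    by (simp add: weight_space_def U_K_def U_J_def U_scalar_def act_def)
qed

lemma weight_space_V:
  assumes s: "s * s = 1" and m: "m \<in> weight_space D M l"
    and pp: "act (pp *c 1) m = act (QPi s 0 *c 1) m"
  shows "sig m \<in> V s l"
proof -
  have mc: "m \<in> carrier M" using m by (simp add: weight_space_def)
  have 1: "A 1 (sig m) = sig m" by (simp add: A_sig mc act_one)
  have p: "A (pp *c 1) (sig m) = psc s (sig m)" by (simp add: A_sig mc pp sig)
  have "A (gen (GK \<mu>)) (sig m) = A (qq powi pairing D \<mu> l *c 1) (sig m)"
    "A (gen (GJ \<mu>)) (sig m) = A (pp powi pairing D \<mu> l *c 1) (sig m)" for \<mu>
    using m by (simp_all add: A_sig[OF mc] weight_space_def U_K_def U_J_def U_scalar_def act_def)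
  then show ?thesis
    by (simp add: V_def 1 p A_const[OF 1 p] ev_qq_powi[OF s] ev_pp_powi[OF s])
qed

text \<open>A primitive vector need not be homogeneous, so it may generate no graded submodule. Its
  two homogeneous components are again primitive, of the same weight and with the same value of pi,
  and each is treated separately.\<close>

lemma prim_act_simple_sum:
  assumes s: "s * s = 1" and v: "v \<in> V s l" "\<And>i. A (gen (GE i)) v = 0"
  shows "act x (fm.rho v) \<in> simple_sum"
proof -
  have "graded_subset M G (weight_space D M l)"
    using Oint by (simp add: cat_O_int_def cat_O_def cat_C_def)
  then obtain m0 m1 where m: "m0 \<in> weight_space D M l" "m0 \<in> G 0" "m1 \<in> weight_space D M l" "m1 \<in> G 1"
    "fm.rho v = m0 \<oplus> m1"
    using V_weight_space[OF s v(1)] unfolding graded_subset_def by blast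
  have mc: "m0 \<in> carrier M" "m1 \<in> carrier M" using m by (simp_all add: weight_space_def)
  \<comment> \<open>A homogeneous element sends the two components into different degrees, so if it
    kills their sum it kills both.\<close>
  have hom: "act y m0 = \<zero> \<and> act y m1 = \<zero>" if y: "hom_par a y" "A y v = 0" for a y
  proof -
    have "act y (fm.rho v) = \<zero>" using rho_A[of y v] y(2) rho_zero by simp
    then have sum: "act y m0 \<oplus> act y m1 = \<zero>" by (simp add: m(5) act_add(2) mc)
    then have sum': "act y m1 \<oplus> act y m0 = \<zero>" using mc by (simp add: L.a_comm)
    have "act y m0 \<in> G (a + 0)" "act y m1 \<in> G (a + 1)" using act_par[OF y(1)] m by blast+
    then show ?thesis using G_direct[OF _ _ sum] G_direct[OF _ _ sum'] by (cases a) auto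
  qed
  have v1: "A 1 v = v" "A (pp *c 1) v = psc s v" using v(1) by (auto simp: V_def)
  have "A (pp *c 1 - QPi s 0 *c 1) v = 0" by (simp add: A_diff v1 A_scalar)
  moreover have "hom_par 0 (pp *c 1 - QPi s 0 *c (1 :: ('i, 'y) ugen free_alg))"
  proof -
    have "pp *c 1 - QPi s 0 *c (1 :: ('i, 'y) ugen free_alg) = Poly_Mapping.single [] (pp - QPi s 0)"
      by (simp add: one_word word_def single_diff)
    then show ?thesis by (auto simp: hom_par_def)
  qed
  ultimately have "act (pp *c 1 - QPi s 0 *c 1) m0 = \<zero>" "act (pp *c 1 - QPi s 0 *c 1) m1 = \<zero>"
    using hom by blast+
  moreover have "act (y - z) n = \<zero> \<Longrightarrow> act y n = act z n" if "n \<in> carrier M" for y z n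
    using act_add(1)[OF that, of "y - z" z] that by simp
  ultimately have pp: "act (pp *c 1) m0 = act (QPi s 0 *c 1) m0" "act (pp *c 1) m1 = act (QPi s 0 *c 1) m1"
    using mc by blast+
  have E: "act (gen (GE i)) m0 = \<zero> \<and> act (gen (GE i)) m1 = \<zero>" for i
  proof (rule hom)
    show "hom_par (of_int (pari D i)) (gen (GE i))" by (simp add: hom_par_def gen_def word_def)
  qed (rule v)
  have simple_sum: "act x n \<in> simple_sum" if n: "n \<in> weight_space D M l" "n \<in> G b" "act (pp *c 1) n = act (QPi s 0 *c 1) n"
    "\<And>i. act (gen (GE i)) n = \<zero>" for n b
  proof (cases "n = \<zero>")
    case True
    then show ?thesis by (simp add: act_zero simple_sum_zero)
  next
    case False
    have nc: "n \<in> carrier M" using n(1) by (simp add: weight_space_def)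
    have "sig n \<noteq> 0" using False sig(1)[OF nc] rho_zero by auto
    moreover have "A (gen (GE i)) (sig n) = 0" for i by (simp add: A_sig[OF nc] n(4) sig_zero)
    ultimately have "simple_U_submodule D M G (sub_gen (fm.rho (sig n)))"
      using weight_space_V[OF s n(1,3)] n(2) by (intro sub_gen_simple[OF s]) (simp_all add: sig(1)[OF nc])
    then show ?thesis
      by (rule simple_sum_mem) (simp add: sig(1)[OF nc] sub_gen_def)
  qed
  have "act x m0 \<in> simple_sum" "act x m1 \<in> simple_sum" using simple_sum m pp E by blast+
  then show ?thesis by (simp add: m(5) act_add(2) mc simple_sum_add)
qed

lemma V_simple_sum:
  assumes s: "s * s = 1" and p: "p \<in> V s l"
  shows "fm.rho p \<in> simple_sum"
proof -
  interpret Q: qmod qf s "dot D" "dd D" pn cartan "\<lambda>u v. ev s (fb u v)" psc "sroot D"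
    "\<lambda>i. pairing D (coroot D i)" "V s" "\<lambda>i. A (gen (GE i))" "\<lambda>i. A (gen (GF i))"
    by (rule qmod_s[OF s])
  \<comment> \<open>Claimed for every \<open>x\<close> so that scalars and words in the F_i can be
    absorbed into \<open>x\<close> during the induction.\<close>
  have "\<forall>x. act x (fm.rho p) \<in> simple_sum"
    using Q.generated_by_prim[OF p]
  proof (rule Q.UP_induct)
    show "Q.subspace {p. \<forall>x. act x (fm.rho p) \<in> simple_sum}"
      by (auto simp: Q.subspace_def rho_zero act_zero simple_sum_zero fm.rho_add act_add(2) simple_sum_add fm.rho_psc
          simp flip: act_mult)
    fix u l' v assume v: "Q.prim l' v"
    then have v1: "v \<in> V s l'" "\<And>i. A (gen (GE i)) v = 0" by (auto simp: Q.prim_def)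
    then have "A 1 v = v" by (simp add: V_def)
    then have "act x (fm.rho (wact (\<lambda>i. A (gen (GF i))) u v)) = act (x * word (map GF u)) (fm.rho v)" for x
      by (simp add: wact_A rho_A act_mult)
    then show "\<forall>x. act x (fm.rho (wact (\<lambda>i. A (gen (GF i))) u v)) \<in> simple_sum"
      using prim_act_simple_sum[OF s v1] by simp
  qed
  then have "act 1 (fm.rho p) \<in> simple_sum" by blast
  then show ?thesis by (simp add: act_one)
qed

text \<open>The two idempotents \<open>lift 1 1\<close> and \<open>lift (- 1) 1\<close> add up to 1
  and split a weight vector into eigenvectors of pi.\<close>

lemma weight_space_simple_sum:
  assumes m: "m \<in> weight_space D M l" shows "m \<in> simple_sum"
proof -
  have mc: "m \<in> carrier M" using m by (simp add: weight_space_def)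
  have *: "act (lift s 1 *c 1) m \<in> simple_sum" if s: "s * s = 1" for s
  proof -
    let ?m = "act (lift s 1 *c 1) m"
    have comm: "act x ?m = act (lift s 1 *c 1) (act x m)" for x
      by (simp add: csmult_mult mc flip: act_mult)
    have "?m \<in> weight_space D M l"
    proof -
      have "act (gen (GK \<mu>)) m = act (qq powi pairing D \<mu> l *c 1) m"
        "act (gen (GJ \<mu>)) m = act (pp powi pairing D \<mu> l *c 1) m" for \<mu>
        using m by (simp_all add: weight_space_def U_K_def U_J_def U_scalar_def act_def)
      then have "act (gen (GK \<mu>)) ?m = act (qq powi pairing D \<mu> l *c 1) ?m"
        "act (gen (GJ \<mu>)) ?m = act (pp powi pairing D \<mu> l *c 1) ?m" for \<mu>
        by (simp_all only: comm)
      then show ?thesis using mc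
        by (simp add: weight_space_def U_K_def U_J_def U_scalar_def act_closed flip: act_def)
    qed
    moreover have "act (pp *c 1) ?m = act (QPi s 0 *c 1) ?m"
    proof -
      have "pp * lift s 1 = QPi s 0 * lift s 1"
        by (rule qpi_eqI) (simp add: ev_mult ev_lift[OF s])
      then have "pp *c 1 * (lift s 1 *c 1) = QPi s 0 *c 1 * (lift s 1 *c (1 :: ('i, 'y) ugen free_alg))"
        by (simp add: csmult_mult mult.commute)
      then show ?thesis using act_mult[OF mc] by metis
    qed
    ultimately have "sig ?m \<in> V s l" by (rule weight_space_V[OF s])
    from V_simple_sum[OF s this] show ?thesis by (simp add: sig mc)
  qed
  have "lift 1 1 + lift (- 1) 1 = 1"
    by (simp add: lift_def plus_qpi_def one_qpi_def)
  then have "lift 1 1 *c 1 + lift (- 1) 1 *c 1 = (1 :: ('i, 'y) ugen free_alg)"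
    by (simp flip: csmult_simps(2))
  then have "m = act (lift 1 1 *c 1) m \<oplus> act (lift (- 1) 1 *c 1) m"
    using act_add(1)[OF mc, of "lift 1 1 *c 1" "lift (- 1) 1 *c 1"] act_one[OF mc] by simp
  then show ?thesis using simple_sum_add[OF *[of 1] *[of "- 1"]] by simp
qed

lemma carrier_simple_sum: "carrier M = simple_sum"
proof
  show "carrier M \<subseteq> simple_sum"
  proof
    fix m assume "m \<in> carrier M"
    then obtain f where f: "\<And>l. f l \<in> weight_space D M l" "m = (\<Oplus>l\<in>{l. f l \<noteq> \<zero>}. f l)"
      using Oint unfolding cat_O_int_def cat_O_def cat_C_def internal_direct_sum_def by blast
    then show "m \<in> simple_sum" using weight_space_simple_sum by (auto intro!: simple_sum_finsum)
  qed
qed (rule simple_sum_closed)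

end

theorem theorem3p3p2:
  fixes D :: "('i::finite, 'y::ab_group_add, 'x::ab_group_add) root_data"
    and M :: "(('i, 'y) U_elem, 'm) module"
    and G :: "bit \<Rightarrow> 'm set"
  assumes "super_cartan_datum D"
    and "root_datum D"
    and "cat_O_int D M G"
  shows "\<exists>S. (\<forall>N\<in>S. simple_U_submodule D M G N) \<and> carrier M = sum_of_submodules M S"
proof -
  interpret umod D M G
    using assms by (simp add: umod_def super_datum_def umod_axioms_def)
  show ?thesis
    by (rule exI[of _ "{N. simple_U_submodule D M G N}"]) (use carrier_simple_sum in \<open>simp add: simple_sum_def\<close>)
qed

end
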